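(* Let $d\ge 2$, let $\kappa=(\kappa_1,\dots,\kappa_d)$ with all $\kappa_i\ge 0$, let $\alpha_\kappa=|\kappa|+\frac{d-2}{2}$, and let $0\le r<1$. For $(x,t),(y,s)\in\mathbb{V}_0^{d+1}$ let $$\mathsf{Q}_r(\mathsf{w}_\kappa;(x,t),(y,s))=\sum_{n=0}^\infty \mathsf{P}_n(\mathsf{w}_\kappa;(x,t),(y,s))\,r^n$$ be the Poisson kernel. If $\alpha_\kappa>0$, then $$\mathsf{Q}_r(\mathsf{w}_\kappa;(x,t),(y,s))=\frac{e^{-\frac{(t+s)r}{1-r}}}{(1-r)^{2\alpha_\kappa+1}}\,c_{\alpha_\kappa-\frac12}\,c_{\kappa-\frac{\mathbf 1}{2}}\int_{[-1,1]^{d+1}}\exp\Big\{\frac{2\sqrt r\,v}{1-r}\,\rho(x,t,y,s;u)\Big\}\Phi_\kappa(u)\,du\,(1-v^2)^{\alpha_\kappa-1}\,dv,$$ where $u\in[-1,1]^d$, $v\in[-1,1]$. If $\alpha_\kappa=0$ (equivalently $\kappa=0$ and $d=2$), then $$\mathsf{Q}_r(\mathsf{w}_0;(x,t),(y,s))=\frac{e^{-\frac{(t+s)r}{1-r}}}{1-r}\cosh\Big(\frac{2\sqrt r}{1-r}\,\rho(x,t,y,s)\Big),\qquad \rho(x,t,y,s)=\sqrt{\tfrac12(ts+\langle x,y\rangle)}.$$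
   Context: Notation: $|\kappa|=\kappa_1+\dots+\kappa_d$, $h_\kappa(x)=\prod_{i=1}^d|x_i|^{\kappa_i}$. The conic surface is $\mathbb{V}_0^{d+1}=\{(x,t)\in\mathbb{R}^d\times[0,\infty):\|x\|=t\}$ with measure $\sigma$ given by $\int_{\mathbb{V}_0^{d+1}}f\,d\sigma=\int_0^\infty t^{d-1}\int_{\mathbb{S}^{d-1}}f(t\xi,t)\,d\sigma_{\mathbb{S}}(\xi)\,dt$, where $d\sigma_{\mathbb S}$ is the surface measure of the unit sphere $\mathbb{S}^{d-1}$. The weight is $\mathsf{w}_\kappa(x,t)=h_\kappa^2(x)t^{-1}e^{-t}$ and the inner product is $\langle f,g\rangle_\kappa=\mathsf{b}_\kappa\int_{\mathbb{V}_0^{d+1}}fg\,\mathsf{w}_\kappa\,d\sigma$, with $\mathsf{b}_\kappa$ chosen so that $\langle 1,1\rangle_\kappa=1$. $\mathcal{V}_n(\mathbb{V}_0^{d+1},\mathsf{w}_\kappa)$ is the space of (restrictions to $\mathbb{V}_0^{d+1}$ of) polynomials in $(x,t)$ of degree at most $n$ that are orthogonal in $\langle\cdot,\cdot\rangle_\kappa$ to all polynomials of degree at most $n-1$, and $\mathsf{P}_n(\mathsf{w}_\kappa;\cdot,\cdot)$ is its reproducing kernel with respect to $\langle\cdot,\cdot\rangle_\kappa$. Further, $c_\lambda=\frac{\Gamma(\lambda+1)}{\Gamma(\frac12)\Gamma(\lambda+\frac12)}$, $c_{\kappa-\frac{\mathbf 1}{2}}=\prod_{i=1}^d c_{\kappa_i-\frac12}$,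 $\Phi_\kappa(u)=\prod_{i=1}^d(1+u_i)(1-u_i^2)^{\kappa_i-1}$, and $\rho(x,t,y,s;u)=\sqrt{\tfrac12(ts+x_1y_1u_1+\dots+x_dy_du_d)}$. Convention: if $\kappa_i=0$ for some $i$, the integral in $u_i$ is understood as the limit $\kappa_i\to0+$, i.e. $c_{\kappa_i-\frac12}\int_{-1}^1 f(u_i)(1+u_i)(1-u_i^2)^{\kappa_i-1}du_i$ is replaced by $f(1)$. *)

theory Defs
  imports "HOL-Analysis.Analysis" "HOL-Probability.Giry_Monad"
begin

text \<open>
  Throughout, \<open>d = CARD('d)\<close>, points of \<open>\<real>\<^sup>d\<close> are elements of \<^typ>\<open>real ^ 'd\<close>, and
  points \<open>(x, t)\<close> are elements of \<^typ>\<open>(real ^ 'd) \<times> real\<close>.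
\<close>

subsection \<open>The conic surface and its measure\<close>

definition conic_surface :: "((real ^ 'd) \<times> real) set" where
  "conic_surface = {(x, t). 0 \<le> t \<and> norm x = t}"

text \<open>
  Surface measure of the unit sphere in polar-coordinate form: \<open>\<sigma>(E)\<close> is \<open>d\<close> times the Lebesgue
  measure of the truncated cone \<open>{s \<xi> | \<xi> \<in> E, 0 < s \<le> 1}\<close>. It is a Borel measure on the whole
  of \<open>\<real>\<^sup>d\<close>, concentrated on \<^term>\<open>sphere 0 1\<close>.
\<close>

definition sphere_measure :: "(real ^ 'd) measure" where
  "sphere_measure =
     distr (scale_measure (of_nat CARD('d)) (restrict_space lborel (cball 0 1 - {0}))) borel
       (\<lambda>x. x /\<^sub>R norm x)"

definition conic_measure :: "((real ^ 'd) \<times> real) measure" where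
  "conic_measure =
     distr (density lborel (\<lambda>t. ennreal (t ^ (CARD('d) - 1)) * indicator {0..} t)
              \<Otimes>\<^sub>M sphere_measure) borel
       (\<lambda>(t, \<xi>). (t *\<^sub>R \<xi>, t))"

lemma finite_measure_sphere_measure: "finite_measure (sphere_measure :: (real ^ 'd) measure)"
proof -
  let ?R = "restrict_space lborel (cball 0 1 - {0}) :: (real ^ 'd) measure"
  let ?S = "scale_measure (of_nat CARD('d)) ?R"
  have "emeasure ?R (space ?R) = emeasure lborel (cball 0 1 - {0 :: real ^ 'd})"
    by (simp add: emeasure_restrict_space space_restrict_space)
  also have "\<dots> \<le> emeasure lborel (cball 0 1 :: (real ^ 'd) set)"
    by (intro emeasure_mono) auto
  also have "\<dots> < \<infinity>"
    by (rule emeasure_lborel_cball_finite)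
  finally have "emeasure ?R (space ?R) < \<infinity>" .
  then have "emeasure ?S (space ?S) \<noteq> \<infinity>"
    by (simp add: space_scale_measure ennreal_mult_eq_top_iff)
  then interpret finite_measure ?S by (rule finite_measureI)
  have "(\<lambda>x. x /\<^sub>R norm x) \<in> ?R \<rightarrow>\<^sub>M borel"
    by (intro measurable_restrict_space1) measurable
  then have "(\<lambda>x. x /\<^sub>R norm x) \<in> ?S \<rightarrow>\<^sub>M borel"
    by (simp add: measurable_def space_scale_measure)
  then show ?thesis
    unfolding sphere_measure_def by (rule finite_measure_distr)
qed

lemma sets_sphere_measure [measurable_cong, simp]: "sets sphere_measure = sets borel"
  by (simp add: sphere_measure_def)

lemma nn_integral_conic_measure:
  fixes f :: "(real ^ 'd) \<times> real \<Rightarrow> ennreal"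
  assumes [measurable]: "f \<in> borel_measurable borel"
  shows "(\<integral>\<^sup>+ z. f z \<partial>conic_measure) =
    (\<integral>\<^sup>+ t. indicator {0..} t * ennreal (t ^ (CARD('d) - 1)) *
       (\<integral>\<^sup>+ \<xi>. f (t *\<^sub>R \<xi>, t) \<partial>sphere_measure) \<partial>lborel)"
proof -
  interpret finite_measure "sphere_measure :: (real ^ 'd) measure"
    by (rule finite_measure_sphere_measure)
  have [measurable]: "(\<lambda>(t, \<xi>). (t *\<^sub>R \<xi>, t)) \<in>
      borel \<Otimes>\<^sub>M borel \<rightarrow>\<^sub>M (borel :: ((real ^ 'd) \<times> real) measure)"
    unfolding borel_prod by (intro borel_measurable_continuous_onI)
      (auto simp: case_prod_unfold intro!: continuous_intros)
  have [measurable]: "(\<lambda>(t, \<xi>). f (t *\<^sub>R \<xi>, t)) \<in> borel_measurable (borel \<Otimes>\<^sub>M borel)"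
    using measurable_compose[OF \<open>(\<lambda>(t, \<xi>). (t *\<^sub>R \<xi>, t)) \<in> _\<close> assms]
    by (simp add: case_prod_unfold)
  have [measurable]: "(\<lambda>(t, \<xi>). f (t *\<^sub>R \<xi>, t)) \<in> borel_measurable (lborel \<Otimes>\<^sub>M sphere_measure)"
    using \<open>(\<lambda>(t, \<xi>). f (t *\<^sub>R \<xi>, t)) \<in> borel_measurable (borel \<Otimes>\<^sub>M borel)\<close>
    by (simp cong: measurable_cong_sets sets_pair_measure_cong)
  let ?D = "density lborel (\<lambda>t. ennreal (t ^ (CARD('d) - 1)) * indicator {0..} t)"
  have "(\<integral>\<^sup>+ z. f z \<partial>conic_measure) =
      (\<integral>\<^sup>+ p. (case p of (t, \<xi>) \<Rightarrow> f (t *\<^sub>R \<xi>, t)) \<partial>(?D \<Otimes>\<^sub>M sphere_measure))"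
    unfolding conic_measure_def by (subst nn_integral_distr) (auto simp: case_prod_unfold)
  also have "\<dots> = (\<integral>\<^sup>+ t. (\<integral>\<^sup>+ \<xi>. f (t *\<^sub>R \<xi>, t) \<partial>sphere_measure) \<partial>?D)"
    by (subst nn_integral_fst[symmetric]) (auto cong: measurable_cong_sets sets_pair_measure_cong)
  also have "\<dots> = (\<integral>\<^sup>+ t. ennreal (t ^ (CARD('d) - 1)) * indicator {0..} t *
       (\<integral>\<^sup>+ \<xi>. f (t *\<^sub>R \<xi>, t) \<partial>sphere_measure) \<partial>lborel)"
    by (subst nn_integral_density) auto
  finally show ?thesis by (simp add: mult.commute)
qed


subsection \<open>Weight and inner product\<close>

text \<open>
  The case distinction is needed because \<open>0 powr 0 = 0\<close>.
\<close>

definition h_weight :: "real ^ 'd \<Rightarrow> real ^ 'd \<Rightarrow> real" where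
  "h_weight \<kappa> x = (\<Prod>i\<in>UNIV. if \<kappa> $ i = 0 then 1 else \<bar>x $ i\<bar> powr (\<kappa> $ i))"

definition cone_weight :: "real ^ 'd \<Rightarrow> (real ^ 'd) \<times> real \<Rightarrow> real" where
  "cone_weight \<kappa> = (\<lambda>(x, t). (h_weight \<kappa> x)\<^sup>2 * inverse t * exp (- t))"

definition cone_const :: "real ^ 'd \<Rightarrow> real" where
  "cone_const \<kappa> = 1 / (LINT z|conic_measure. cone_weight \<kappa> z)"

definition cone_inner ::
    "real ^ 'd \<Rightarrow> ((real ^ 'd) \<times> real \<Rightarrow> real) \<Rightarrow> ((real ^ 'd) \<times> real \<Rightarrow> real) \<Rightarrow> real" where
  "cone_inner \<kappa> f g = cone_const \<kappa> * (LINT z|conic_measure. f z * g z * cone_weight \<kappa> z)"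


subsection \<open>Orthogonal polynomials and the Poisson kernel\<close>

definition exponents :: "nat \<Rightarrow> (('d::finite \<Rightarrow> nat) \<times> nat) set" where
  "exponents n = {(a, k). (\<Sum>i\<in>UNIV. a i) + k \<le> n}"

lemma finite_exponents: "finite (exponents n :: (('d::finite \<Rightarrow> nat) \<times> nat) set)"
proof (rule finite_subset)
  show "(exponents n :: (('d \<Rightarrow> nat) \<times> nat) set) \<subseteq> (\<Pi>\<^sub>E i\<in>UNIV. {..n}) \<times> {..n}"
  proof (auto simp: exponents_def)
    fix a :: "'d \<Rightarrow> nat" and k i
    assume "sum a UNIV + k \<le> n"
    moreover have "a i \<le> sum a UNIV" by (intro member_le_sum) auto
    ultimately show "a i \<le> n" by linarith
  qed
qed (auto intro!: finite_PiE)

definition poly_fun_le :: "nat \<Rightarrow> ((real ^ 'd) \<times> real \<Rightarrow> real) set" where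
  "poly_fun_le n =
     {p. \<exists>c. \<forall>x t. p (x, t) = (\<Sum>(a, k)\<in>exponents n. c a k * (\<Prod>i\<in>UNIV. (x $ i) ^ a i) * t ^ k)}"

text \<open>Restrictions to the conic surface are represented by extension with \<open>0\<close>.\<close>

definition cone_poly_le :: "nat \<Rightarrow> ((real ^ 'd) \<times> real \<Rightarrow> real) set" where
  "cone_poly_le n = (\<lambda>p z. if z \<in> conic_surface then p z else 0) ` poly_fun_le n"

text \<open>
  For \<open>n = 0\<close> the orthogonality condition is void; for \<open>n > 0\<close> it is orthogonality to all
  polynomials of degree at most \<open>n - 1\<close>.
\<close>

definition orth_poly_space :: "real ^ 'd \<Rightarrow> nat \<Rightarrow> ((real ^ 'd) \<times> real \<Rightarrow> real) set" where
  "orth_poly_space \<kappa> n =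
     {f \<in> cone_poly_le n. \<forall>m<n. \<forall>g\<in>cone_poly_le m. cone_inner \<kappa> f g = 0}"

text \<open>
  \<open>reproducing_kernel V ip z\<close> is the element \<open>K(z, \<cdot>)\<close> of \<open>V\<close> with \<open>\<langle>f, K(z, \<cdot>)\<rangle> = f(z)\<close>
  for all \<open>f \<in> V\<close>.
\<close>

definition reproducing_kernel ::
    "('a \<Rightarrow> real) set \<Rightarrow> (('a \<Rightarrow> real) \<Rightarrow> ('a \<Rightarrow> real) \<Rightarrow> real) \<Rightarrow> 'a \<Rightarrow> 'a \<Rightarrow> real" where
  "reproducing_kernel V ip z = (THE k. k \<in> V \<and> (\<forall>f\<in>V. ip f k = f z))"

definition cone_kernel ::
    "real ^ 'd \<Rightarrow> nat \<Rightarrow> (real ^ 'd) \<times> real \<Rightarrow> (real ^ 'd) \<times> real \<Rightarrow> real" where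
  "cone_kernel \<kappa> n = reproducing_kernel (orth_poly_space \<kappa> n) (cone_inner \<kappa>)"

definition poisson_kernel ::
    "real ^ 'd \<Rightarrow> real \<Rightarrow> (real ^ 'd) \<times> real \<Rightarrow> (real ^ 'd) \<times> real \<Rightarrow> real" where
  "poisson_kernel \<kappa> r z w = (\<Sum>n. cone_kernel \<kappa> n z w * r ^ n)"


subsection \<open>Ingredients of the integral formula\<close>

definition alpha :: "real ^ 'd \<Rightarrow> real" where
  "alpha \<kappa> = (\<Sum>i\<in>UNIV. \<kappa> $ i) + (real CARD('d) - 2) / 2"

definition c_const :: "real \<Rightarrow> real" where
  "c_const l = Gamma (l + 1) / (Gamma (1/2) * Gamma (l + 1/2))"

text \<open>
  The convention for \<open>\<kappa>\<^sub>i = 0\<close>, by which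
  \<open>c\<^bsub>\<kappa>\<^sub>i-1/2\<^esub> \<integral> f(u\<^sub>i) (1 + u\<^sub>i) (1 - u\<^sub>i\<^sup>2)\<^bsup>\<kappa>\<^sub>i-1\<^esup> du\<^sub>i\<close> stands for \<open>f(1)\<close>, is built into
  \<open>c_kappa\<close>, \<open>Phi\<close> and \<open>du_measure\<close>: for such \<open>i\<close> the \<open>i\<close>-th factors of the constant and of \<open>\<Phi>\<^sub>\<kappa>\<close> are
  replaced by \<open>1\<close>, and \<open>du\<^sub>i\<close> by the unit mass at \<open>1\<close>.
\<close>

definition c_kappa :: "real ^ 'd \<Rightarrow> real" where
  "c_kappa \<kappa> = (\<Prod>i\<in>UNIV. if \<kappa> $ i = 0 then 1 else c_const (\<kappa> $ i - 1/2))"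

definition Phi :: "real ^ 'd \<Rightarrow> ('d \<Rightarrow> real) \<Rightarrow> real" where
  "Phi \<kappa> u =
     (\<Prod>i\<in>UNIV. if \<kappa> $ i = 0 then 1 else (1 + u i) * (1 - (u i)\<^sup>2) powr (\<kappa> $ i - 1))"

definition lebesgue_pm1 :: "real measure" where
  "lebesgue_pm1 = density lborel (indicator {-1..1})"

definition du_measure :: "real ^ 'd \<Rightarrow> ('d \<Rightarrow> real) measure" where
  "du_measure \<kappa> = (\<Pi>\<^sub>M i\<in>UNIV. if \<kappa> $ i = 0 then return lborel 1 else lebesgue_pm1)"

definition rho :: "(real ^ 'd) \<times> real \<Rightarrow> (real ^ 'd) \<times> real \<Rightarrow> ('d \<Rightarrow> real) \<Rightarrow> real" where
  "rho = (\<lambda>(x, t) (y, s) u. sqrt (1/2 * (t * s + (\<Sum>i\<in>UNIV. x $ i * y $ i * u i))))"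

end

theory Submission
  imports Defs "HOL-Computational_Algebra.Polynomial_FPS"
begin

text \<open>
  Write \<open>a\<close> for \<open>alpha \<kappa>\<close>. The proof avoids Dunkl theory and \<open>h\<close>-harmonics: everything is reduced to moments of
  monomials. Expanding the right-hand side in powers of \<open>r\<close> gives the candidates
  \<open>K\<^sub>n(z, w) = \<Sum>\<^sub>i B\<^sub>i(z, w) L\<^bsub>n-i\<^esub>\<^bsup>(2a+2i)\<^esup>(t + s)\<close> for the reproducing kernels, where \<open>L\<close> are Laguerre
  polynomials and \<open>B\<^sub>i\<close> is homogeneous of degree \<open>i\<close> in both points. If \<open>g\<close> is a monomial of degree \<open>j\<close>,
  then \<open>i! \<langle>g, B\<^sub>i(z, \<cdot>)\<rangle>\<close> is \<open>t\<^sup>i\<close> times a polynomial in \<open>i\<close> of degree at most \<open>j\<close> whose coefficient of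
  \<open>i\<^sup>j\<close> is \<open>t\<^bsup>-j\<^esup> g(z)\<close>; this comes from the explicit moments together with Gauss' summation of a
  terminating \<open>\<^sub>2F\<^sub>1\<close> at 1. Taking finite differences in \<open>i\<close> shows that \<open>\<langle>g, K\<^sub>n(z, \<cdot>)\<rangle> = 0\<close> for \<open>n > j\<close>
  and \<open>\<Sum>\<^bsub>n \<le> j\<^esub> \<langle>g, K\<^sub>n(z, \<cdot>)\<rangle> = g(z)\<close>, which characterizes the reproducing kernels.
\<close>

subsection \<open>Finite sums\<close>

text \<open>The shape of the candidates comes from two observations. The integral over
  \<open>v\<close> kills the odd powers of \<open>rho\<close>, so only powers of the polynomial
  \<open>rho^2\<close> remain; and each further power of \<open>r/(1-r)^2\<close> adds 2 to the
  exponent of \<open>1/(1-r)\<close> in the prefactor, which is why the Laguerre parameter moves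
  with \<open>i\<close>. Finite differences appear when \<open>K_n\<close> is paired with a monomial
  \<open>g\<close> of degree \<open>j\<close>. The Laguerre factor integrates against the radial
  moments in closed form, and the result is
  \<open>sum_n <g,K_n> r^n = sum_h T_h r^h (1-r)^(j-h)\<close> with
  \<open>T_h = sum_i <g,B_i> (-t)^(h-i)/(h-i)!\<close>. Once \<open>T_h = 0\<close> for
  \<open>h > j\<close>, the right side is a polynomial in \<open>r\<close> of degree at most
  \<open>j\<close> with value \<open>T_j\<close> at \<open>r = 1\<close>. In this computation the
  cone equation for \<open>z = (x,t)\<close> enters at one place: the coordinates contribute
  exponentials in the squares of the \<open>x_i\<close>, which merge into a single exponential in
  \<open>t^2\<close>, the form to which Gauss' sum applies. The kernels are treated uniformly for
  all \<alpha> \<ge> 0. The two formulas of the theorem only differ in how the series in powers of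
  \<open>r/(1-r)^2\<close> is recognized.\<close>

lemma pochhammer_half_product:
  fixes x :: real
  assumes "2 * k \<le> n"
  shows "pochhammer (- real n / 2) k * pochhammer ((1 - real n) / 2) k = fact n / (fact (n - 2 * k) * 4 ^ k)"
  using assms
proof (induction k)
  case (Suc k)
  obtain m where m: "n = Suc (Suc (m + 2 * k))"
    using Suc.prems by (metis add_2_eq_Suc le_Suc_ex mult_Suc_right add.assoc add.commute plus_nat.simps(2))
  have 0: "2 * k \<le> n" using Suc.prems by simp
  have 1: "fact (n - 2 * k) = (real m + 2) * (real m + 1) * fact m" "n - 2 * Suc k = m"
    by (simp_all add: m field_simps)
  have "pochhammer (- real n / 2) (Suc k) * pochhammer ((1 - real n) / 2) (Suc k)
     = (fact n / (fact (n - 2 * k) * 4 ^ k)) * ((- real n / 2 + k) * ((1 - real n) / 2 + k))"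
    unfolding Suc.IH[OF 0, symmetric] by (simp only: pochhammer_Suc mult_ac)
  also have "(- real n / 2 + k) * ((1 - real n) / 2 + k) = (real m + 2) * (real m + 1) / 4"
    by (simp add: m field_simps)
  also have "fact n / (fact (n - 2 * k) * 4 ^ k) * ((real m + 2) * (real m + 1) / 4)
     = ((real m + 2) * (real m + 1)) * fact n / ((real m + 2) * (real m + 1) * (fact m * 4 ^ Suc k))"
    unfolding 1 by simp
  also have "\<dots> = fact n / (fact (n - 2 * Suc k) * 4 ^ Suc k)"
    unfolding 1 by (subst mult_divide_mult_cancel_left) auto
  finally show ?case .
qed simp

text \<open>The left side is the terminating \<open>2F1(-n/2, (1-n)/2; c; 1)\<close>. One of the
  upper parameters is the integer \<open>-m\<close>; which one depends on the parity of
  \<open>n\<close>. Chu-Vandermonde applies in either case, and the duplication formula brings both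
  results to the same closed form.\<close>

lemma gauss_sum:
  fixes c :: real
  assumes c: "c > 1/2"
  shows "(\<Sum>k\<le>n div 2. fact n / (fact (n - 2 * k) * 4 ^ k * fact k * pochhammer c k))
    = 2 ^ n * pochhammer (c - 1/2) n / pochhammer (2 * c - 1) n"
proof -
  define m where "m = n div 2"
  have nz: "pochhammer c k \<noteq> 0" "pochhammer (c - 1/2) k \<noteq> 0" "pochhammer (c + 1/2) k \<noteq> 0" for k
    using pochhammer_pos[of c k] pochhammer_pos[of "c - 1/2" k] pochhammer_pos[of "c + 1/2" k] c by auto
  have V: "(\<Sum>k\<in>{0..m}. pochhammer a k * pochhammer (- real m) k / (fact k * pochhammer c k))
     = pochhammer (c - a) m / pochhammer c m" for a
    using Vandermonde_pochhammer[of m c a] c by force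
  have L: "(\<Sum>k\<le>n div 2. fact n / (fact (n - 2 * k) * 4 ^ k * fact k * pochhammer c k)) =
    (\<Sum>k\<in>{0..m}. (pochhammer (- real n / 2) k * pochhammer ((1 - real n) / 2) k) / (fact k * pochhammer c k))"
    unfolding m_def atLeast0AtMost
    using pochhammer_half_product[of _ n] by (intro sum.cong) auto
  show ?thesis
  proof (cases "even n")
    case True
    then have n: "n = 2 * m" by (simp add: m_def)
    have two: "2 * (c - 1/2) = 2 * c - 1" by simp
    have "(\<Sum>k\<in>{0..m}. (pochhammer (- real n / 2) k * pochhammer ((1 - real n) / 2) k) / (fact k * pochhammer c k))
      = pochhammer (c - 1/2 + m) m / pochhammer c m"
      using V[of "1/2 - m"] by (simp add: n mult.commute algebra_simps diff_divide_distrib)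
    also have "\<dots> = 2 ^ n * pochhammer (c - 1/2) n / pochhammer (2 * c - 1) n"
      using pochhammer_double[of "c - 1/2" m, unfolded two] pochhammer_product'[of "c - 1/2" m m] nz
      by (simp add: n divide_simps algebra_simps flip: mult_2)
    finally show ?thesis unfolding L .
  next
    case False
    then have n: "n = Suc (2 * m)" by (simp add: m_def)
    have "(\<Sum>k\<in>{0..m}. (pochhammer (- real n / 2) k * pochhammer ((1 - real n) / 2) k) / (fact k * pochhammer c k))
      = pochhammer (c + 1/2 + m) m / pochhammer c m"
      using V[of "- 1/2 - m"] by (simp add: n mult.commute algebra_simps add_divide_distrib diff_divide_distrib)
    also have "\<dots> = 2 ^ n * pochhammer (c - 1/2) n / pochhammer (2 * c - 1) n"
      using pochhammer_double[of c m] pochhammer_product'[of "c + 1/2" m m] nz c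
      by (simp add: n pochhammer_rec divide_simps algebra_simps flip: mult_2)
    finally show ?thesis unfolding L .
  qed
qed

text \<open>Only the degree and the leading coefficient 1 are recorded, because a finite difference
  of order at least \<open>d\<close> sees nothing else of the polynomial.\<close>

definition monic_at :: "(nat \<Rightarrow> real) \<Rightarrow> nat \<Rightarrow> bool" where
  "monic_at f d \<longleftrightarrow> (\<exists>p. lead_coeff p = 1 \<and> degree p = d \<and> (\<forall>i. f i = poly p (real i)))"

lemma monic_at_mult:
  assumes "monic_at f d" "monic_at g e"
  shows "monic_at (\<lambda>i. f i * g i) (d + e)"
proof -
  obtain p q where "lead_coeff p = 1" "degree p = d" "\<forall>i. f i = poly p (real i)"
    "lead_coeff q = 1" "degree q = e" "\<forall>i. g i = poly q (real i)"
    using assms by (auto simp: monic_at_def)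
  then show ?thesis unfolding monic_at_def
    by (intro exI[of _ "p * q"]) (metis degree_mult_eq lead_coeff_mult mult_1 poly_mult zero_neq_one leading_coeff_0_iff)
qed

lemma monic_at_pochhammer: "monic_at (\<lambda>i. pochhammer (a + real i) n) n"
proof (induction n)
  case 0
  show ?case by (auto simp: monic_at_def intro!: exI[of _ 1])
next
  case (Suc n)
  have "monic_at (\<lambda>i. a + real i + real n) 1"
    unfolding monic_at_def by (intro exI[of _ "[:a + real n, 1:]"]) auto
  from monic_at_mult[OF Suc this] show ?case by (simp add: pochhammer_Suc)
qed

text \<open>Both sides are \<open>m!\<close> times the coefficient of \<open>X^m\<close> in
  \<open>(exp X - 1)^h\<close>: the binomial expansion produces the alternating sum, while the
  series starts with \<open>X^h\<close>.\<close>

lemma finite_difference_power: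
  assumes "m \<le> h"
  shows "(\<Sum>i\<le>h. (-1) ^ (h - i) * real (h choose i) * real i ^ m) = (if m = h then fact h else 0)"
proof -
  define F :: "real fps" where "F = fps_exp 1 - 1"
  have "F ^ h = (fps_exp 1 + (- 1)) ^ h" by (simp add: F_def)
  also have "\<dots> = (\<Sum>i\<le>h. fps_const ((-1) ^ (h - i) * real (h choose i)) * fps_exp (real i))"
    unfolding binomial_ring
  proof (intro sum.cong refl)
    fix i
    have "(- 1 :: real fps) ^ k = fps_const ((- 1) ^ k)" for k by (induction k) (auto simp flip: fps_const_mult fps_const_neg)
    then show "of_nat (h choose i) * fps_exp (1::real) ^ i * (- 1) ^ (h - i)
      = fps_const ((-1) ^ (h - i) * real (h choose i)) * fps_exp (real i)"
      by (simp add: fps_exp_power_mult fps_of_nat mult_ac flip: fps_const_mult)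
  qed
  finally have "fps_nth (F ^ h) m = (\<Sum>i\<le>h. (-1) ^ (h - i) * real (h choose i) * real i ^ m) / fact m"
    by (simp add: fps_sum_nth fps_exp_def sum_divide_distrib)
  moreover have "fps_nth (F ^ h) m = (if m = h then 1 else 0)"
    using startsby_zero_power_prefix[of F h] startsby_zero_power_nth_same[of F h] assms
    by (auto simp: F_def)
  ultimately show ?thesis by (auto simp: field_simps)
qed

lemma finite_difference_monic:
  assumes "monic_at f d" "d \<le> h"
  shows "(\<Sum>i\<le>h. (-1) ^ (h - i) * real (h choose i) * f i) = (if d = h then fact h else 0)"
proof -
  obtain p where p: "lead_coeff p = 1" "degree p = d" "\<And>i. f i = poly p (real i)"
    using assms by (auto simp: monic_at_def)
  have "(\<Sum>i\<le>h. (-1) ^ (h - i) * real (h choose i) * f i)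
    = (\<Sum>i\<le>h. \<Sum>m\<le>d. coeff p m * ((-1) ^ (h - i) * real (h choose i) * real i ^ m))"
    by (simp add: p poly_altdef sum_distrib_left mult_ac)
  also have "\<dots> = (\<Sum>m\<le>d. coeff p m * (if m = h then fact h else 0))"
    using assms(2) by (subst sum.swap) (simp add: finite_difference_power flip: sum_distrib_left)
  also have "\<dots> = (if d = h then fact h else 0)"
    using p assms(2) by (auto simp: if_distrib sum.delta cong: if_cong)
  finally show ?thesis .
qed

section \<open>Multi-index sums as coefficients of products of power series\<close>

definition multi_index :: "'a set \<Rightarrow> nat \<Rightarrow> ('a \<Rightarrow> nat) set" where
  "multi_index A n = {b. (\<forall>i. i \<notin> A \<longrightarrow> b i = 0) \<and> sum b A = n}"

lemma finite_multi_index: "finite A \<Longrightarrow> finite (multi_index A n)"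
proof -
  assume A: "finite A"
  show ?thesis
  proof (rule finite_subset)
    show "multi_index A n \<subseteq> {b. \<forall>i. (i \<in> A \<longrightarrow> b i \<in> {..n}) \<and> (i \<notin> A \<longrightarrow> b i = 0)}"
      using A by (auto simp: multi_index_def intro: member_le_sum)
  qed (intro finite_set_of_finite_funs A, simp)
qed

lemma fps_prod_nth_multi_index:
  fixes F :: "'a \<Rightarrow> 'b::comm_ring_1 fps"
  assumes "finite A"
  shows "fps_nth (\<Prod>i\<in>A. F i) n = (\<Sum>b\<in>multi_index A n. \<Prod>i\<in>A. fps_nth (F i) (b i))"
  using assms
proof (induction A arbitrary: n)
  case empty
  have "multi_index {} n = (if n = 0 then {\<lambda>i::'a. 0} else {})" by (auto simp: multi_index_def)
  then show ?case by auto
next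
  case (insert a A)
  have "fps_nth (\<Prod>i\<in>insert a A. F i) n =
      (\<Sum>k\<le>n. \<Sum>b\<in>multi_index A (n - k). fps_nth (F a) k * (\<Prod>i\<in>A. fps_nth (F i) (b i)))"
    using insert by (simp add: fps_mult_nth atLeast0AtMost sum_distrib_left)
  also have "\<dots> = (\<Sum>(k, b)\<in>Sigma {..n} (\<lambda>k. multi_index A (n - k)). fps_nth (F a) k * (\<Prod>i\<in>A. fps_nth (F i) (b i)))"
    using insert by (subst sum.Sigma) (auto simp: finite_multi_index)
  also have "\<dots> = (\<Sum>b\<in>multi_index (insert a A) n. \<Prod>i\<in>insert a A. fps_nth (F i) (b i))"
  proof (intro sum.reindex_bij_witness[where i = "\<lambda>b. (b a, b(a := 0))" and j = "\<lambda>(k, b). b(a := k)"], goal_cases)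
    case (1 x)
    then show ?case using insert.hyps by (auto simp: multi_index_def fun_eq_iff)
  next
    case (2 x)
    obtain k b where x: "x = (k, b)" by force
    have "sum (b(a := k)) A = sum b A" using insert.hyps by (intro sum.cong) auto
    then show ?case using 2 insert.hyps by (auto simp: x multi_index_def)
  next
    case (3 b)
    then show ?case by auto
  next
    case (4 b)
    have "sum (b(a := 0)) A = sum b A" using insert.hyps by (intro sum.cong) auto
    then show ?case using 4 insert.hyps by (auto simp: multi_index_def)
  next
    case (5 x)
    obtain k b where x: "x = (k, b)" by force
    have "(\<Prod>i\<in>A. fps_nth (F i) ((b(a := k)) i)) = (\<Prod>i\<in>A. fps_nth (F i) (b i))" using insert.hyps by (intro prod.cong) auto
    then show ?case using insert.hyps by (simp add: x)
  qed
  finally show ?case .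
qed

text \<open>The multinomial theorem divided by \<open>n!\<close>, obtained by reading off the
  \<open>n\<close>-th coefficient of a product of exponential series.\<close>

lemma power_sum_multi_index:
  fixes f :: "'a \<Rightarrow> real"
  assumes "finite A"
  shows "(\<Sum>i\<in>A. f i) ^ n / fact n = (\<Sum>b\<in>multi_index A n. \<Prod>i\<in>A. f i ^ b i / fact (b i))"
proof -
  have "(\<Prod>i\<in>A. fps_exp (f i)) = fps_exp (\<Sum>i\<in>A. f i)"
    using assms by induction (auto simp: fps_exp_add_mult)
  then have "fps_nth (\<Prod>i\<in>A. fps_exp (f i)) n = (\<Sum>i\<in>A. f i) ^ n / fact n"
    by (simp add: fps_exp_def)
  then show ?thesis using fps_prod_nth_multi_index[OF assms, of "\<lambda>i. fps_exp (f i)" n]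
    by (simp add: fps_exp_def)
qed

text \<open>A rearranged Chu-Vandermonde identity. It serves twice: it collapses a Laguerre
  polynomial against radial moments, and it expands a shifted Pochhammer symbol in
  \<open>moment_poly_exp_nth\<close>.\<close>

lemma pochhammer_convolution:
  fixes a b :: real
  assumes "b > 0"
  shows "(\<Sum>l\<le>N. (-1) ^ l * pochhammer a l / fact l * (pochhammer (b + real l) (N - l) / fact (N - l)))
    = pochhammer (b - a) N / fact N"
proof -
  have nz: "pochhammer b k \<noteq> 0" for k using pochhammer_pos[of b k] assms by auto
  have "(\<Sum>l\<le>N. (-1) ^ l * pochhammer a l / fact l * (pochhammer (b + real l) (N - l) / fact (N - l)))
    = (\<Sum>l\<in>{0..N}. pochhammer b N / fact N * (pochhammer a l * pochhammer (- real N) l / (fact l * pochhammer b l)))"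
    unfolding atLeast0AtMost
  proof (intro sum.cong refl)
    fix l assume l: "l \<in> {..N}"
    have 1: "pochhammer (b + real l) (N - l) = pochhammer b N / pochhammer b l"
      using pochhammer_product[of l N b] l nz[of l] by simp
    have 2: "pochhammer (- real N) l = (-1) ^ l * fact N / fact (N - l)"
    proof -
      have "real (N choose l) = (-1) ^ l / fact l * pochhammer (- real N) l"
        by (simp add: binomial_gbinomial gbinomial_pochhammer)
      moreover have "real (N choose l) = fact N / (fact l * fact (N - l))"
        using l by (simp add: binomial_fact)
      ultimately have "(-1) ^ l * ((-1) ^ l * pochhammer (- real N) l) = (-1) ^ l * fact N / fact (N - l)"
        by (simp add: field_simps)
      then show ?thesis by (simp flip: mult.assoc power_add mult_2)
    qed
    show "(-1) ^ l * pochhammer a l / fact l * (pochhammer (b + real l) (N - l) / fact (N - l))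
       = pochhammer b N / fact N * (pochhammer a l * pochhammer (- real N) l / (fact l * pochhammer b l))"
      unfolding 1 2 by (simp add: field_simps)
  qed
  also have "\<dots> = pochhammer b N / fact N * (pochhammer (b - a) N / pochhammer b N)"
    unfolding sum_distrib_left[symmetric] using Vandermonde_pochhammer[of N b a] assms by force
  also have "\<dots> = pochhammer (b - a) N / fact N" using nz[of N] by simp
  finally show ?thesis .
qed

lemma sum_triangle:
  fixes g :: "nat \<Rightarrow> nat \<Rightarrow> 'a::comm_monoid_add"
  shows "(\<Sum>k\<le>n. \<Sum>i\<le>k. g i (k - i)) = (\<Sum>i\<le>n. \<Sum>l\<le>n - i. g i l)"
proof -
  have "(\<Sum>k\<le>n. \<Sum>i\<le>k. g i (k - i)) = (\<Sum>(i, l)\<in>Sigma {..n} (\<lambda>i. {..n - i}). g i l)"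
    unfolding sum.triangle_reindex_eq[symmetric] by (intro sum.cong) auto
  then show ?thesis by (simp add: sum.Sigma)
qed

lemma fps_compose_X_square_nth:
  "fps_nth (F oo fps_X ^ 2) n = (if even n then fps_nth F (n div 2) else (0::'a::comm_ring_1))"
proof -
  have "fps_nth (F oo fps_X ^ 2) n = (\<Sum>i\<in>{0..n}. if i = n div 2 then (if even n then fps_nth F i else 0) else 0)"
    unfolding fps_compose_nth by (intro sum.cong) (auto simp flip: power_mult)
  then show ?thesis by simp
qed

text \<open>Here \<open>p\<close> and \<open>m - p\<close> are the powers of \<open>t\<close> and
  \<open>s\<close> in the Laguerre polynomial at \<open>t + s\<close>. A power of \<open>s\<close>
  merely raises the index of the radial Pochhammer symbol, so the sum over it is a
  \<open>pochhammer_convolution\<close> with parameters \<open>A + i + j\<close> and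
  \<open>A + 2i + p\<close>. Their difference \<open>i + p - j\<close> involves \<open>i\<close> and
  \<open>p\<close> only through \<open>h = i + p\<close>.\<close>

lemma laguerre_pairing_sum:
  fixes A t :: real and N :: "nat \<Rightarrow> real"
  assumes A: "A > 0"
  shows "(\<Sum>i\<le>n. \<Sum>m\<le>n - i. \<Sum>p\<le>m. (-t) ^ p / fact p * ((-1) ^ (m - p) / fact (m - p))
           * (pochhammer (A + 2 * real i + real m) (n - i - m) / fact (n - i - m))
           * (pochhammer A (i + j + (m - p)) * N i))
    = (\<Sum>h\<le>n. (\<Sum>i\<le>h. pochhammer A (i + j) * N i * ((-t) ^ (h - i) / fact (h - i)))
           * (pochhammer (real h - real j) (n - h) / fact (n - h)))"
    (is "?L = ?R")
proof -
  have inner: "(\<Sum>m\<le>q. \<Sum>p\<le>m. (-t) ^ p / fact p * ((-1) ^ (m - p) / fact (m - p))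
           * (pochhammer (A + 2 * real i + real m) (q - m) / fact (q - m))
           * (pochhammer A (i + j + (m - p)) * N i))
     = (\<Sum>p\<le>q. pochhammer A (i + j) * N i * ((-t) ^ p / fact p) *
          (pochhammer (real (i + p) - real j) (q - p) / fact (q - p)))" (is "?l = ?r") for i q
  proof -
    have "?l = (\<Sum>p\<le>q. \<Sum>l\<le>q - p. (-t) ^ p / fact p * ((-1) ^ l / fact l)
           * (pochhammer (A + 2 * real i + real (p + l)) (q - (p + l)) / fact (q - (p + l)))
           * (pochhammer A (i + j + l) * N i))"
      unfolding sum_triangle[symmetric] by (intro sum.cong) auto
    also have "\<dots> = (\<Sum>p\<le>q. pochhammer A (i + j) * N i * ((-t) ^ p / fact p) *
          (\<Sum>l\<le>q - p. (-1) ^ l * pochhammer (A + real (i + j)) l / fact l *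
             (pochhammer (A + 2 * real i + real p + real l) (q - p - l) / fact (q - p - l))))"
      unfolding sum_distrib_left
      by (intro sum.cong refl) (simp add: pochhammer_product' add.assoc mult_ac)
    also have "\<dots> = ?r"
      using A by (intro sum.cong refl) (subst pochhammer_convolution, auto simp: algebra_simps)
    finally show ?thesis .
  qed
  have "?L = (\<Sum>i\<le>n. \<Sum>p\<le>n - i. pochhammer A (i + j) * N i * ((-t) ^ p / fact p) *
          (pochhammer (real (i + p) - real j) (n - i - p) / fact (n - i - p)))"
    unfolding inner ..
  also have "\<dots> = ?R"
    unfolding sum_triangle[symmetric] sum_distrib_right by (intro sum.cong refl) auto
  finally show ?thesis .
qed

lemma pochhammer_neg_nat_sum:
  "(\<Sum>m\<le>q. pochhammer (- real q) m / fact m) = (if q = 0 then 1 else 0)"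
proof -
  have "(\<Sum>m\<le>q. pochhammer (- real q) m / fact m) = (\<Sum>m\<le>q. (-1) ^ m * real (q choose m))"
    by (intro sum.cong refl) (simp add: binomial_gbinomial gbinomial_pochhammer)
  then show ?thesis using choose_alternating_sum[of q, where 'a = real] by auto
qed

text \<open>For \<open>h <= j\<close> the symbol starts at the nonpositive integer
  \<open>-(j - h)\<close>, so it contains a zero factor as soon as \<open>n > j\<close>. Summed over
  \<open>n <= j\<close>, the coefficients of \<open>T h\<close> form the binomial expansion of
  \<open>(1 - 1)^(j - h)\<close>, which leaves \<open>h = j\<close>.\<close>

lemma graded_pairing:
  fixes T :: "nat \<Rightarrow> real"
  assumes T: "\<And>h. h > j \<Longrightarrow> T h = 0"
  defines "S \<equiv> \<lambda>n. \<Sum>h\<le>n. T h * (pochhammer (real h - real j) (n - h) / fact (n - h))"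
  shows "n > j \<Longrightarrow> S n = 0" "(\<Sum>n\<le>j. S n) = T j"
proof -
  show "S n = 0" if "n > j"
    unfolding S_def
  proof (rule sum.neutral, safe)
    fix h
    have "pochhammer (real h - real j) (n - h) = 0" if "h \<le> j"
    proof -
      have "real h - real j = - real (j - h)" using that by simp
      then show ?thesis using \<open>n > j\<close> that pochhammer_of_nat_eq_0_lemma[of "j - h" "n - h", where 'a = real]
        by (simp only: diff_less_mono)
    qed
    then show "T h * (pochhammer (real h - real j) (n - h) / fact (n - h)) = 0"
      using T[of h] by (cases "h \<le> j") auto
  qed
  have "(\<Sum>n\<le>j. S n) = (\<Sum>h\<le>j. T h * (\<Sum>m\<le>j - h. pochhammer (- real (j - h)) m / fact m))"
    unfolding S_def sum_distrib_left
    by (subst sum_triangle) (intro sum.cong refl, auto simp: of_nat_diff)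
  also have "\<dots> = (\<Sum>h\<le>j. if h = j then T h else 0)"
    unfolding pochhammer_neg_nat_sum by (intro sum.cong) auto
  finally show "(\<Sum>n\<le>j. S n) = T j" by simp
qed

text \<open>The quotient of factorials is the falling factorial of \<open>i\<close>, a monic
  polynomial in \<open>i\<close> of degree \<open>m\<close>. Its zeros at \<open>i < m\<close>
  absorb the case distinction.\<close>

lemma pochhammer_falling:
  "real (fact i) * (if m \<le> i then x ^ (i - m) / fact (i - m) else 0)
     = pochhammer (1 - real m + real i) m * (x :: real) ^ (i - m)"
proof (cases "m \<le> i")
  case True
  have "fact i = pochhammer (1::real) (i - m) * pochhammer (1 + real (i - m)) m"
    using pochhammer_product'[of "1::real" "i - m" m] True by (simp add: pochhammer_fact)
  then have "fact i = fact (i - m) * pochhammer (1 - real m + real i) m"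
    using True by (simp add: pochhammer_fact of_nat_diff algebra_simps)
  then show ?thesis using True by simp
next
  case False
  have "1 - real m + real i = - real (m - i - 1)" using False by simp
  then have "pochhammer (1 - real m + real i) m = 0"
    using False pochhammer_of_nat_eq_0_lemma[of "m - i - 1" m, where 'a = real] by (simp only:)
  then show ?thesis using False by simp
qed

text \<open>Isolates the calculation for one monomial and one point. In the instance used below,
  \<open>a\<close> is \<open>alpha \<kappa>\<close>, the exponents of the coordinates are
  \<open>2 * p_j + e_j\<close> with \<open>e_j\<close> in \<open>{0,1}\<close>, \<open>P\<close> and
  \<open>E\<close> are the sums of the \<open>p_j\<close> and \<open>e_j\<close>, \<open>C\<close>
  is the product of the \<open>(x_j/2)^(e_j)\<close>, \<open>R\<close> is a product of polynomials
  \<open>moment_poly\<close>, and \<open>k\<close> is the exponent of \<open>t\<close>.\<close>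

locale moment_recursion =
  fixes a t C :: real and P E k j :: nat and R :: "real poly"
  assumes a: "a \<ge> 0" and degR: "degree R \<le> P" and j: "j = 2 * P + E + k"
begin

text \<open>\<open>U\<close> generates the coordinate contributions by degree. \<open>N i\<close> is
  the pairing of the monomial with \<open>B_i\<close> without its radial factor, \<open>M i\<close>
  is the full pairing, and \<open>T h\<close> is the combination of the \<open>M i\<close> that
  becomes a finite difference.\<close>

definition "V = fps_of_poly R * fps_exp (t\<^sup>2 / 4)"
definition "U = fps_const C * fps_X ^ E * (V oo fps_X ^ 2)"
definition "N i = (\<Sum>l\<le>i. t ^ (i - l) / fact (i - l) * (fps_nth U l / pochhammer (a + 1) ((2 * P + E + l) div 2)))
   / (2 ^ i * pochhammer (a + 1/2) i)"
definition "M i = pochhammer (2 * a + 1) (i + j) * N i"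
definition "T h = (\<Sum>i\<le>h. M i * ((-t) ^ (h - i) / fact (h - i)))"

lemma U_nth: "fps_nth U l = (if E \<le> l \<and> even (l - E) then C * fps_nth V ((l - E) div 2) else 0)"
  by (simp add: U_def mult.assoc fps_X_power_mult_nth fps_compose_X_square_nth)

lemma V_nth: "fps_nth V q = (\<Sum>s\<le>q. coeff R s * ((t\<^sup>2 / 4) ^ (q - s) / fact (q - s)))"
  by (simp add: V_def fps_mult_nth fps_exp_def atLeast0AtMost)

lemma nz: "pochhammer (a + 1) n \<noteq> 0" "pochhammer (a + 1/2) n \<noteq> 0" "pochhammer (2 * a + 1) n \<noteq> 0"
  using pochhammer_pos[of "a+1" n] pochhammer_pos[of "a+1/2" n] pochhammer_pos[of "2*a+1" n] a by auto

text \<open>Only the indices \<open>l = E + 2q\<close> contribute. With \<open>q = s + u\<close>,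
  where \<open>s\<close> belongs to \<open>R\<close> and \<open>u\<close> to the exponential, the
  powers of \<open>t\<close> combine to an exponent independent of \<open>u\<close>, since the
  exponential has argument \<open>t^2/4\<close>. The remaining sum over \<open>u\<close> is
  \<open>gauss_sum\<close> with \<open>c = a + 1 + P + E + s\<close>.\<close>

lemma inner_sum:
  "(\<Sum>l\<le>i. t ^ (i - l) / fact (i - l) * (fps_nth U l / pochhammer (a + 1) ((2 * P + E + l) div 2)))
   = C * (\<Sum>s\<le>P. if 2 * s + E \<le> i then coeff R s * (t ^ (i - (2 * s + E)) / fact (i - (2 * s + E)))
        * (2 ^ (i - (2 * s + E)) * pochhammer (a + 1/2 + real (P + E + s)) (i - (2 * s + E))
            / (pochhammer (2 * a + 1 + 2 * real (P + E + s)) (i - (2 * s + E)) * pochhammer (a + 1) (P + E + s))) else 0)"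
   (is "?L = ?R")
proof (cases "E \<le> i")
  case False
  then show ?thesis by (auto simp: U_nth intro!: sum.neutral)
next
  case True
  then obtain n0 where i: "i = E + n0" using le_Suc_ex by blast
  define Q where "Q = n0 div 2"
  let ?g = "\<lambda>q s. C * (coeff R s * (t ^ (n0 - 2 * q) / fact (n0 - 2 * q) *
      ((t\<^sup>2 / 4) ^ (q - s) / fact (q - s)) / pochhammer (a + 1) (P + E + q)))"
  have "?L = (\<Sum>l\<in>(\<lambda>q. E + 2 * q) ` {..Q}. t ^ (i - l) / fact (i - l) *
      (fps_nth U l / pochhammer (a + 1) ((2 * P + E + l) div 2)))"
  proof (intro sum.mono_neutral_right ballI)
    fix l assume "l \<in> {..i} - (\<lambda>q. E + 2 * q) ` {..Q}"
    then have l: "l \<le> i" "\<And>q. q \<le> Q \<Longrightarrow> l \<noteq> E + 2 * q" by auto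
    have "\<not> (E \<le> l \<and> even (l - E))"
    proof
      assume "E \<le> l \<and> even (l - E)"
      then have "l = E + 2 * ((l - E) div 2)" by (metis dvd_mult_div_cancel le_add_diff_inverse)
      moreover have "(l - E) div 2 \<le> Q" using l(1) by (simp add: i Q_def div_le_mono)
      ultimately show False using l(2) by blast
    qed
    then show "t ^ (i - l) / fact (i - l) * (fps_nth U l / pochhammer (a + 1) ((2 * P + E + l) div 2)) = 0"
      by (simp only: U_nth if_False mult_zero_right div_0)
  qed (auto simp: i Q_def)
  also have "\<dots> = (\<Sum>q\<le>Q. \<Sum>s\<le>q. ?g q s)"
  proof (subst sum.reindex, simp add: inj_on_def, intro sum.cong refl, goal_cases)
    case (1 q)
    have "(2 * P + E + (E + 2 * q)) div 2 = P + E + q" by simp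
    then show ?case
      unfolding o_def i by (simp add: U_nth V_nth sum_distrib_left sum_divide_distrib mult_ac add_ac)
  qed
  also have "\<dots> = (\<Sum>q\<le>Q. \<Sum>s\<le>q. ?g (s + (q - s)) s)"
    by (intro sum.cong refl) auto
  also have "\<dots> = (\<Sum>s\<le>Q. \<Sum>u\<le>Q - s. ?g (s + u) s)"
    by (rule sum_triangle)
  also have "\<dots> = (\<Sum>s\<le>Q. C * (coeff R s * (t ^ (n0 - 2 * s) / fact (n0 - 2 * s)) *
     (2 ^ (n0 - 2 * s) * pochhammer (a + 1/2 + real (P + E + s)) (n0 - 2 * s)
            / (pochhammer (2 * a + 1 + 2 * real (P + E + s)) (n0 - 2 * s) * pochhammer (a + 1) (P + E + s)))))"
  proof (intro sum.cong refl)
    fix s assume s: "s \<in> {..Q}"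
    define n c where "n = n0 - 2 * s" and "c = a + 1 + real (P + E + s)"
    have Qs: "Q - s = n div 2" using s by (auto simp: Q_def n_def)
    have c: "c > 1/2" using a by (simp add: c_def)
    have "(\<Sum>u\<le>Q - s. ?g (s + u) s) = (\<Sum>u\<le>n div 2. C * coeff R s * t ^ n / (fact n * pochhammer (a + 1) (P + E + s))
        * (fact n / (fact (n - 2 * u) * 4 ^ u * fact u * pochhammer c u)))"
      unfolding Qs
    proof (intro sum.cong refl)
      fix u assume "u \<in> {..n div 2}"
      then have u: "2 * u \<le> n" by auto
      have 1: "n0 - 2 * (s + u) = n - 2 * u" by (simp add: n_def)
      have 2: "pochhammer (a + 1) (P + E + (s + u)) = pochhammer (a + 1) (P + E + s) * pochhammer c u"
        unfolding c_def by (subst pochhammer_product'[symmetric]) (simp add: add.assoc)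
      have 3: "t ^ n = t ^ (n - 2 * u) * (t ^ 2) ^ u" using u by (simp flip: power_add power_mult)
      show "?g (s + u) s = C * coeff R s * t ^ n / (fact n * pochhammer (a + 1) (P + E + s))
        * (fact n / (fact (n - 2 * u) * 4 ^ u * fact u * pochhammer c u))"
        unfolding 1 2 3 by (simp add: power_divide mult_ac)
    qed
    also have "\<dots> = C * coeff R s * t ^ n / (fact n * pochhammer (a + 1) (P + E + s)) *
       (2 ^ n * pochhammer (c - 1/2) n / pochhammer (2 * c - 1) n)"
      unfolding sum_distrib_left[symmetric] gauss_sum[OF c] ..
    also have "c - 1/2 = a + 1/2 + real (P + E + s)" by (simp add: c_def)
    also have "2 * c - 1 = 2 * a + 1 + 2 * real (P + E + s)" by (simp add: c_def)
    finally show "(\<Sum>u\<le>Q - s. ?g (s + u) s) = C * (coeff R s * (t ^ (n0 - 2 * s) / fact (n0 - 2 * s)) *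
     (2 ^ (n0 - 2 * s) * pochhammer (a + 1/2 + real (P + E + s)) (n0 - 2 * s)
            / (pochhammer (2 * a + 1 + 2 * real (P + E + s)) (n0 - 2 * s) * pochhammer (a + 1) (P + E + s))))"
      by (simp add: n_def mult_ac)
  qed
  \<comment> \<open>The range changes from \<open>s <= Q\<close> to \<open>s <= P\<close>:
    coefficients of \<open>R\<close> vanish beyond \<open>P\<close>, and
    \<open>2 * s + E <= i\<close> expresses \<open>s <= Q\<close>.\<close>
  also have "\<dots> = ?R"
    unfolding sum_distrib_left
    using degR by (intro sum.mono_neutral_cong) (auto simp: i Q_def coeff_eq_0 add.commute)
  finally show ?thesis .
qed

text \<open>Duplication of \<open>pochhammer (2 * a + 1) (2 * w)\<close> with
  \<open>w = P + E + s\<close> cancels every Pochhammer symbol in the denominators. Each summand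
  becomes a power of \<open>t\<close> times a polynomial in \<open>i\<close> of degree
  \<open>P + s + E + k\<close>, so that only \<open>s = P\<close> reaches the degree
  \<open>j\<close>.\<close>

lemma M_closed:
  "fact i * M i = 4 ^ P * 2 ^ E * C * (\<Sum>s\<le>P. coeff R s * (pochhammer (1 - real (2 * s + E) + real i) (2 * s + E)
      * t ^ (i - (2 * s + E)) * pochhammer (a + 1/2 + real i) (P - s) * pochhammer (2 * a + 1 + real (2 * P + E) + real i) k))"
proof -
  have "fact i * M i = (\<Sum>s\<le>P. fact i * (pochhammer (2 * a + 1) (i + j) * (C * (if 2 * s + E \<le> i then coeff R s * (t ^ (i - (2 * s + E)) / fact (i - (2 * s + E)))
        * (2 ^ (i - (2 * s + E)) * pochhammer (a + 1/2 + real (P + E + s)) (i - (2 * s + E))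
            / (pochhammer (2 * a + 1 + 2 * real (P + E + s)) (i - (2 * s + E)) * pochhammer (a + 1) (P + E + s))) else 0)
        / (2 ^ i * pochhammer (a + 1/2) i))))"
    unfolding M_def N_def inner_sum sum_distrib_left sum_divide_distrib ..
  also have "\<dots> = (\<Sum>s\<le>P. 4 ^ P * 2 ^ E * C * (coeff R s * (real (fact i) * (if 2 * s + E \<le> i then t ^ (i - (2 * s + E)) / fact (i - (2 * s + E)) else 0)
       * pochhammer (a + 1/2 + real i) (P - s) * pochhammer (2 * a + 1 + real (2 * P + E) + real i) k)))"
  proof (intro sum.cong refl)
    fix s assume s: "s \<in> {..P}"
    show "fact i * (pochhammer (2 * a + 1) (i + j) * (C * (if 2 * s + E \<le> i then coeff R s * (t ^ (i - (2 * s + E)) / fact (i - (2 * s + E)))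
        * (2 ^ (i - (2 * s + E)) * pochhammer (a + 1/2 + real (P + E + s)) (i - (2 * s + E))
            / (pochhammer (2 * a + 1 + 2 * real (P + E + s)) (i - (2 * s + E)) * pochhammer (a + 1) (P + E + s))) else 0)
        / (2 ^ i * pochhammer (a + 1/2) i)))
      = 4 ^ P * 2 ^ E * C * (coeff R s * (real (fact i) * (if 2 * s + E \<le> i then t ^ (i - (2 * s + E)) / fact (i - (2 * s + E)) else 0)
       * pochhammer (a + 1/2 + real i) (P - s) * pochhammer (2 * a + 1 + real (2 * P + E) + real i) k))"
    proof (cases "2 * s + E \<le> i")
      case True
      define n w where "n = i - (2 * s + E)" and "w = P + E + s"
      have n: "i = n + 2 * s + E" using True by (simp add: n_def)
      have i1: "i + j = (2 * w + n) + k" using s by (simp add: n w_def j)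
      have e1: "pochhammer (2 * a + 1) (i + j) = pochhammer (2 * a + 1) (2 * w)
          * pochhammer (2 * a + 1 + 2 * real w) n * pochhammer (2 * a + 1 + real (2 * P + E) + real i) k"
        unfolding i1 pochhammer_product' using s by (simp add: n w_def algebra_simps)
      have w4: "2 ^ (w * 2) = (4::real) ^ w" by (simp add: power2_eq_square mult.commute[of w] power_mult flip: power_mult_distrib)
      have e2: "pochhammer (2 * a + 1) (2 * w) = 4 ^ w * pochhammer (a + 1/2) w * pochhammer (a + 1) w"
        using pochhammer_double[of "a + 1/2" w] w4 by (simp add: algebra_simps)
      have i2: "w + n = i + (P - s)" using s by (simp add: n w_def)
      have e3: "pochhammer (a + 1/2) w * pochhammer (a + 1/2 + real w) n
          = pochhammer (a + 1/2) i * pochhammer (a + 1/2 + real i) (P - s)"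
        unfolding pochhammer_product'[symmetric] i2 ..
      have e4: "(4::real) ^ w * 2 ^ n = 4 ^ P * 2 ^ E * 2 ^ i"
      proof -
        have "(4::real) ^ w * 2 ^ n = 2 ^ (2 * w + n)" by (simp add: power_add power_mult)
        also have "2 * w + n = 2 * P + E + i" by (simp add: w_def n)
        finally show ?thesis by (simp add: power_add power_mult)
      qed
      have nz': "pochhammer (2 * a + 1 + 2 * real w) n \<noteq> 0"
        using pochhammer_pos[of "2 * a + 1 + 2 * real w" n] a by auto
      have "fact i * (pochhammer (2 * a + 1) (i + j) * (C * (coeff R s * (t ^ n / fact n)
        * (2 ^ n * pochhammer (a + 1/2 + real w) n
            / (pochhammer (2 * a + 1 + 2 * real w) n * pochhammer (a + 1) w)))
        / (2 ^ i * pochhammer (a + 1/2) i)))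
        = (4 ^ w * 2 ^ n) * (pochhammer (a + 1/2) w * pochhammer (a + 1/2 + real w) n) *
          (C * coeff R s * fact i * t ^ n / fact n * pochhammer (2 * a + 1 + real (2 * P + E) + real i) k) / (2 ^ i * pochhammer (a + 1/2) i)"
        unfolding e1 e2 using nz nz' by simp
      also have "\<dots> = 4 ^ P * 2 ^ E * C * (coeff R s * (fact i * (t ^ n / fact n)
       * pochhammer (a + 1/2 + real i) (P - s) * pochhammer (2 * a + 1 + real (2 * P + E) + real i) k))"
        unfolding e3 e4 using nz by simp
      finally show ?thesis using True by (simp only: n_def w_def if_True of_nat_fact)
    qed simp
  qed
  also have "\<dots> = 4 ^ P * 2 ^ E * C * (\<Sum>s\<le>P. coeff R s * (pochhammer (1 - real (2 * s + E) + real i) (2 * s + E)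
      * t ^ (i - (2 * s + E)) * pochhammer (a + 1/2 + real i) (P - s) * pochhammer (2 * a + 1 + real (2 * P + E) + real i) k))"
    unfolding pochhammer_falling sum_distrib_left by (simp only: mult.assoc)
  finally show ?thesis .
qed

text \<open>After multiplication by \<open>h!\<close> and merging of the powers of \<open>t\<close>,
  \<open>T h\<close> is an \<open>h\<close>-th finite difference of polynomials in \<open>i\<close>
  of degree at most \<open>j\<close>. It vanishes for \<open>h > j\<close>, and for
  \<open>h = j\<close> it extracts the leading coefficient of the summand
  \<open>s = P\<close>.\<close>

lemma T_closed:
  assumes h: "h \<ge> j"
  shows "T h = (if h = j then 4 ^ P * 2 ^ E * C * coeff R P * t ^ k else 0)"
proof -
  define f where "f s i = pochhammer (1 - real (2 * s + E) + real i) (2 * s + E) *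
    pochhammer (a + 1/2 + real i) (P - s) * pochhammer (2 * a + 1 + real (2 * P + E) + real i) k" for s i
  have mon: "monic_at (f s) (2 * s + E + (P - s) + k)" for s
    unfolding f_def by (intro monic_at_mult monic_at_pochhammer)
  \<comment> \<open>Truncated subtraction breaks the addition of exponents when
    \<open>i < 2 * s + E\<close>, but there the Pochhammer factor is 0.\<close>
  have tt: "pochhammer (1 - real (2 * s + E) + real i) (2 * s + E) * t ^ (i - (2 * s + E)) * t ^ (h - i)
     = pochhammer (1 - real (2 * s + E) + real i) (2 * s + E) * t ^ (h - (2 * s + E))" if "i \<le> h" for s i
  proof (cases "2 * s + E \<le> i")
    case True
    then show ?thesis using that by (simp flip: power_add)
  next
    case False
    have "1 - real (2 * s + E) + real i = - real (2 * s + E - i - 1)" using False by simp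
    then have "pochhammer (1 - real (2 * s + E) + real i) (2 * s + E) = 0"
      using False pochhammer_of_nat_eq_0_lemma[of "2 * s + E - i - 1" "2 * s + E", where 'a = real] by (simp only:)
    then show ?thesis by simp
  qed
  have "fact h * T h = (\<Sum>i\<le>h. (-1) ^ (h - i) * real (h choose i) * (fact i * M i) * t ^ (h - i))"
    unfolding T_def sum_distrib_left
  proof (intro sum.cong refl)
    fix i assume "i \<in> {..h}"
    then have "fact h = real (h choose i) * fact i * fact (h - i)" by (simp add: binomial_fact)
    moreover have "(-t) ^ (h - i) = (-1) ^ (h - i) * t ^ (h - i)" by (rule power_minus)
    ultimately show "fact h * (M i * ((- t) ^ (h - i) / fact (h - i))) =
      (-1) ^ (h - i) * real (h choose i) * (fact i * M i) * t ^ (h - i)" by simp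
  qed
  also have "\<dots> = (\<Sum>i\<le>h. \<Sum>s\<le>P. 4 ^ P * 2 ^ E * C * coeff R s * t ^ (h - (2 * s + E)) *
      ((-1) ^ (h - i) * real (h choose i) * f s i))"
    unfolding M_closed sum_distrib_left sum_distrib_right
  proof (intro sum.cong refl, goal_cases)
    case (1 i s)
    then have "i \<le> h" by simp
    let ?X = "pochhammer (1 - real (2 * s + E) + real i) (2 * s + E)"
    let ?K = "(-1) ^ (h - i) * real (h choose i) * (4 ^ P * 2 ^ E * C) * coeff R s *
      pochhammer (a + 1/2 + real i) (P - s) * pochhammer (2 * a + 1 + real (2 * P + E) + real i) k"
    have "(-1) ^ (h - i) * real (h choose i) * (4 ^ P * 2 ^ E * C * (coeff R s * (?X * t ^ (i - (2 * s + E)) *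
        pochhammer (a + 1/2 + real i) (P - s) * pochhammer (2 * a + 1 + real (2 * P + E) + real i) k))) * t ^ (h - i)
      = ?K * (?X * t ^ (i - (2 * s + E)) * t ^ (h - i))"
      by (simp only: mult_ac)
    also have "\<dots> = ?K * (?X * t ^ (h - (2 * s + E)))"
      by (simp only: tt[OF \<open>i \<le> h\<close>])
    also have "\<dots> = 4 ^ P * 2 ^ E * C * coeff R s * t ^ (h - (2 * s + E)) *
      ((-1) ^ (h - i) * real (h choose i) * f s i)"
      by (simp only: mult_ac f_def)
    finally show ?case .
  qed
  also have "\<dots> = (\<Sum>s\<le>P. 4 ^ P * 2 ^ E * C * coeff R s * t ^ (h - (2 * s + E)) *
      (\<Sum>i\<le>h. (-1) ^ (h - i) * real (h choose i) * f s i))"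
    by (subst sum.swap) (simp only: sum_distrib_left)
  also have "\<dots> = (\<Sum>s\<le>P. if s = P then (if h = j then fact h * (4 ^ P * 2 ^ E * C * coeff R P * t ^ k) else 0) else 0)"
    using h by (intro sum.cong refl) (subst finite_difference_monic[OF mon], auto simp: j)
  finally have "fact h * T h = (if h = j then fact h * (4 ^ P * 2 ^ E * C * coeff R P * t ^ k) else 0)" by simp
  then show ?thesis by (auto split: if_splits)
qed

end

subsection \<open>One-dimensional integrals\<close>

lemma has_bochner_integral_pair_mult:
  fixes f :: "'a \<Rightarrow> real" and g :: "'b \<Rightarrow> real"
  assumes "sigma_finite_measure M" "sigma_finite_measure N"
    and f: "has_bochner_integral M f u" and g: "has_bochner_integral N g v"
  shows "has_bochner_integral (M \<Otimes>\<^sub>M N) (\<lambda>(x, y). f x * g y) (u * v)"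
proof -
  interpret M: sigma_finite_measure M by fact
  interpret N: sigma_finite_measure N by fact
  interpret pair_sigma_finite M N ..
  have [measurable]: "f \<in> borel_measurable M" "g \<in> borel_measurable N"
    and fi: "integrable M f" and gi: "integrable N g"
    using f g by (auto simp: has_bochner_integral_iff)
  have int: "integrable (M \<Otimes>\<^sub>M N) (\<lambda>(x, y). f x * g y)"
    using fi gi by (intro Fubini_integrable) (auto simp: abs_mult)
  then have "integral\<^sup>L (M \<Otimes>\<^sub>M N) (\<lambda>(x, y). f x * g y) = (\<integral>x. \<integral>y. f x * g y \<partial>N \<partial>M)"
    by (subst integral_fst'[symmetric]) auto
  also have "\<dots> = u * v"
    using f g by (simp add: has_bochner_integral_iff)
  finally show ?thesis using int by (simp add: has_bochner_integral_iff)
qed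

lemma has_bochner_integral_half_lines:
  fixes f :: "real \<Rightarrow> real"
  assumes "has_bochner_integral lborel (\<lambda>x. indicator {0<..} x * f x) u"
    and "has_bochner_integral lborel (\<lambda>x. indicator {0<..} x * f (- x)) v"
    and [measurable]: "f \<in> borel_measurable borel"
  shows "has_bochner_integral lborel f (u + v)"
proof -
  have "has_bochner_integral lborel (\<lambda>x. indicator {0<..} (- x) * f x) v"
    using lborel_has_bochner_integral_real_affine_iff[of "-1" "\<lambda>x. indicator {0<..} x * f (- x)" v 0] assms(2)
    by (simp add: ac_simps)
  from has_bochner_integral_add[OF assms(1) this]
  have "has_bochner_integral lborel (\<lambda>x. indicator {0<..} x * f x + indicator {0<..} (- x) * f x) (u + v)" .
  moreover have "AE x in lborel. indicator {0<..} x * f x + indicator {0<..} (- x) * f x = f x"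
    using AE_lborel_singleton[of "0::real"] by eventually_elim (auto simp: indicator_def)
  ultimately show ?thesis
    by (subst (asm) has_bochner_integral_cong_AE) auto
qed

text \<open>Nonnegativity turns the gauge integral into an absolutely convergent one, as the change
  of variables requires, and allows the result to be stated for the Bochner integral. Both the
  Gaussian and the beta moments are instances.\<close>

lemma has_bochner_integral_square_substitution:
  fixes f :: "real \<Rightarrow> real"
  assumes f: "(f has_integral I) {0<..}" and nn: "\<And>x. x > 0 \<Longrightarrow> f x \<ge> 0"
    and [measurable]: "f \<in> borel_measurable borel"
  shows "has_bochner_integral lborel (\<lambda>x. indicator {0<..} x * (2 * x * f (x\<^sup>2))) I"
proof -
  have img: "(\<lambda>x::real. x\<^sup>2) ` {0<..} = {0<..}"
  proof (safe, goal_cases)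
    case (2 x)
    then show ?case by (intro image_eqI[of _ _ "sqrt x"]) auto
  qed auto
  have "f absolutely_integrable_on {0<..}" "integral {0<..} f = I"
    using f nn by (auto intro!: nonnegative_absolutely_integrable_1 simp: has_integral_iff)
  then have "(\<lambda>x. \<bar>2 * x\<bar> * f (x\<^sup>2)) absolutely_integrable_on {0<..} \<and>
      integral {0<..} (\<lambda>x. \<bar>2 * x\<bar> * f (x\<^sup>2)) = I"
    by (subst has_absolute_integral_change_of_variables_1'[where g = "\<lambda>x. x\<^sup>2"])
       (auto simp: img intro!: derivative_eq_intros inj_onI)
  then have "((\<lambda>x. \<bar>2 * x\<bar> * f (x\<^sup>2)) has_integral I) {0<..}"
    by (auto simp: has_integral_iff set_lebesgue_integral_eq_integral)
  then have "(\<integral>\<^sup>+x. ennreal (\<bar>2 * x\<bar> * f (x\<^sup>2)) * indicator {0<..} x \<partial>lborel) = ennreal I"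
    by (intro nn_integral_has_integral_lebesgue') (auto intro!: nn mult_nonneg_nonneg)
  also have "(\<integral>\<^sup>+x. ennreal (\<bar>2 * x\<bar> * f (x\<^sup>2)) * indicator {0<..} x \<partial>lborel)
     = (\<integral>\<^sup>+x. ennreal (indicator {0<..} x * (2 * x * f (x\<^sup>2))) \<partial>lborel)"
    by (intro nn_integral_cong) (auto simp: indicator_def)
  finally show ?thesis
    using nn by (intro has_bochner_integral_nn_integral has_integral_nonneg[OF f])
      (auto simp: indicator_def intro!: AE_I2 mult_nonneg_nonneg)
qed

lemma has_integral_Diff_singleton:
  fixes f :: "real \<Rightarrow> real"
  assumes "(f has_integral I) S"
  shows "(f has_integral I) (S - {a})"
proof -
  have 1: "negligible {x \<in> S - (S - {a}). f x \<noteq> 0}"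
    by (rule negligible_subset[OF negligible_sing[of a]]) auto
  have "{x \<in> S - {a} - S. f x \<noteq> 0} = {}" by auto
  then have 2: "negligible {x \<in> S - {a} - S. f x \<noteq> 0}" by (simp only: negligible_empty)
  show ?thesis using has_integral_spike_set_eq[OF 1 2] assms by blast
qed

lemma has_bochner_integral_Gamma:
  fixes s :: real
  assumes "s > 0"
  shows "has_bochner_integral lborel (\<lambda>t. indicator {0<..} t * (t powr (s - 1) * exp (- t))) (Gamma s)"
proof -
  have "Gamma s = (\<integral>\<^sup>+t. ennreal (indicator {0..} t * t powr (s - 1) / exp t) \<partial>lborel)"
    by (rule Gamma_conv_nn_integral_real[OF assms])
  also have "\<dots> = (\<integral>\<^sup>+t. ennreal (indicator {0<..} t * (t powr (s - 1) * exp (- t))) \<partial>lborel)"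
    using AE_lborel_singleton[of "0::real"]
    by (intro nn_integral_cong_AE) (eventually_elim, auto simp: indicator_def exp_minus field_simps)
  finally show ?thesis
    using assms by (intro has_bochner_integral_nn_integral) (auto simp: Gamma_real_nonneg)
qed

lemma mult_powr_square:
  fixes x s :: real
  assumes "x > 0"
  shows "x * (x\<^sup>2) powr (s - 1) = x powr (2 * s - 1)"
proof -
  have "x * (x\<^sup>2) powr (s - 1) = exp (ln x) * exp ((s - 1) * (2 * ln x))"
    using assms by (simp add: powr_def ln_realpow)
  also have "\<dots> = exp ((2 * s - 1) * ln x)"
    unfolding exp_add[symmetric] by (simp add: algebra_simps)
  finally show ?thesis using assms by (simp add: powr_def)
qed

lemma has_bochner_integral_Gamma_square:
  fixes q :: real
  assumes "q > - 1"
  shows "has_bochner_integral lborel (\<lambda>x. indicator {0<..} x * (x powr q * exp (- x\<^sup>2))) (Gamma ((q + 1) / 2) / 2)"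
proof -
  define s where "s = (q + 1) / 2"
  have s: "s > 0" using assms by (simp add: s_def)
  have Ioi_eq: "{0..} - {0} = {0::real<..}" by auto
  have "((\<lambda>t. t powr (s - 1) / exp t) has_integral Gamma s) {0<..}"
    using has_integral_Diff_singleton[OF Gamma_integral_real[OF s], of 0]
    by (simp add: Ioi_eq)
  from has_integral_divide[OF this, of 2]
  have "((\<lambda>t. t powr (s - 1) * exp (- t) / 2) has_integral Gamma s / 2) {0<..}"
    by (simp add: exp_minus field_simps)
  then have "has_bochner_integral lborel (\<lambda>x. indicator {0<..} x * (2 * x * ((x\<^sup>2) powr (s - 1) * exp (- x\<^sup>2) / 2))) (Gamma s / 2)"
    by (rule has_bochner_integral_square_substitution) auto
  also have "(\<lambda>x. indicator {0<..} x * (2 * x * ((x\<^sup>2) powr (s - 1) * exp (- x\<^sup>2) / 2)))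
     = (\<lambda>x. indicator {0<..} x * (x powr q * exp (- x\<^sup>2)))"
  proof
    fix x :: real
    have "x * (x\<^sup>2) powr (s - 1) = x powr q" if "x > 0"
    proof -
      have "2 * s - 1 = q" by (simp add: s_def add_divide_distrib distrib_left)
      then show ?thesis using mult_powr_square[OF that, of s] by (simp only:)
    qed
    then show "indicator {0<..} x * (2 * x * ((x\<^sup>2) powr (s - 1) * exp (- x\<^sup>2) / 2)) = indicator {0<..} x * (x powr q * exp (- x\<^sup>2))"
      by (auto simp: indicator_def)
  qed
  finally show ?thesis by (simp add: s_def)
qed

text \<open>One coordinate's factor of \<open>h_\<kappa>^2\<close>, with the convention of
  \<open>h_weight\<close>: for exponent 0 it equals 1 also at \<open>x = 0\<close>.\<close>

definition weight_factor :: "real \<Rightarrow> real \<Rightarrow> real" where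
  "weight_factor k x = (if k = 0 then 1 else \<bar>x\<bar> powr k)\<^sup>2"

lemma weight_factor_measurable [measurable]: "weight_factor k \<in> borel_measurable borel"
  unfolding weight_factor_def by measurable

lemma weight_factor_pos: "x > 0 \<Longrightarrow> weight_factor k x = x powr (2 * k)"
  by (auto simp: weight_factor_def power2_eq_square simp flip: powr_add)

lemma weight_factor_minus [simp]: "weight_factor k (- x) = weight_factor k x"
  by (simp add: weight_factor_def)

lemma gaussian_moment:
  assumes "k \<ge> 0"
  shows "has_bochner_integral lborel (\<lambda>x. x ^ n * weight_factor k x * exp (- x\<^sup>2))
    (if even n then Gamma (k + (real n + 1) / 2) else 0)"
proof -
  have *: "has_bochner_integral lborel (\<lambda>x. indicator {0<..} x * (x ^ n * weight_factor k x * exp (- x\<^sup>2)))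
     (Gamma (k + (real n + 1) / 2) / 2)"
  proof -
    have 1: "(\<lambda>x::real. indicator {0<..} x * (x ^ n * weight_factor k x * exp (- x\<^sup>2)))
       = (\<lambda>x. indicator {0<..} x * (x powr (2 * k + n) * exp (- x\<^sup>2)))"
      by (auto simp: fun_eq_iff indicator_def weight_factor_pos powr_add powr_realpow)
    have 2: "k + (real n + 1) / 2 = (2 * k + real n + 1) / 2" by (simp add: field_simps)
    show ?thesis
      unfolding 1 2 by (rule has_bochner_integral_Gamma_square) (use assms in auto)
  qed
  show ?thesis
  proof (cases "even n")
    case True
    then show ?thesis
      using has_bochner_integral_half_lines[OF * , of "Gamma (k + (real n + 1) / 2) / 2"] * by simp
  next
    case False
    then show ?thesis
      using has_bochner_integral_half_lines[OF * , of "- (Gamma (k + (real n + 1) / 2) / 2)"]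
        has_bochner_integral_minus[OF *] by simp
  qed
qed

lemma beta_moment:
  assumes "b > 0"
  shows "has_bochner_integral lborel (\<lambda>v. indicator {-1..1} v * (v ^ n * (1 - v\<^sup>2) powr (b - 1)))
    (if even n then Beta ((real n + 1) / 2) b else 0)"
proof -
  define s where "s = (real n + 1) / 2"
  have *: "has_bochner_integral lborel (\<lambda>x. indicator {0<..} x * (indicator {-1..1} x * (x ^ n * (1 - x\<^sup>2) powr (b - 1))))
     (Beta s b / 2)"
  proof -
    have s: "s > 0" by (simp add: s_def)
    have Ioc_eq: "{0..1} - {0} = {0::real<..1}" by auto
    have "((\<lambda>t. t powr (s - 1) * (1 - t) powr (b - 1)) has_integral Beta s b) {0..1}"
      by (rule has_integral_Beta_real) (use s assms in auto)
    from has_integral_Diff_singleton[OF this, of 0]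
    have "((\<lambda>t. t powr (s - 1) * (1 - t) powr (b - 1)) has_integral Beta s b) {0<..1}"
      by (simp add: Ioc_eq)
    \<comment> \<open>Extension by zero to the half-line, where the substitution lemma is
      stated.\<close>
    then have "((\<lambda>t. if t \<in> {0<..1} then t powr (s - 1) * (1 - t) powr (b - 1) else 0) has_integral Beta s b) {0<..}"
      by (subst has_integral_restrict) auto
    then have "((\<lambda>t. (if t \<in> {0<..1} then t powr (s - 1) * (1 - t) powr (b - 1) else 0) / 2) has_integral Beta s b / 2) {0<..}"
      by (rule has_integral_divide)
    then have "has_bochner_integral lborel (\<lambda>x. indicator {0<..} x * (2 * x * ((if x\<^sup>2 \<in> {0<..1} then (x\<^sup>2) powr (s - 1) * (1 - x\<^sup>2) powr (b - 1) else 0) / 2)))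
      (Beta s b / 2)"
      by (rule has_bochner_integral_square_substitution) auto
    also have "(\<lambda>x. indicator {0<..} x * (2 * x * ((if x\<^sup>2 \<in> {0<..1} then (x\<^sup>2) powr (s - 1) * (1 - x\<^sup>2) powr (b - 1) else 0) / 2)))
       = (\<lambda>x. indicator {0<..} x * (indicator {-1..1} x * (x ^ n * (1 - x\<^sup>2) powr (b - 1))))"
    proof
      fix x :: real
      have "x * (x\<^sup>2) powr (s - 1) = x ^ n" if "x > 0"
        using mult_powr_square[OF that, of s] powr_realpow[OF that, of n] by (simp add: s_def field_simps)
      moreover have "x\<^sup>2 \<le> 1 \<longleftrightarrow> x \<le> 1" if "x > 0" using that by (simp add: power_le_one_iff abs_square_le_1)
      ultimately show "indicator {0<..} x * (2 * x * ((if x\<^sup>2 \<in> {0<..1} then (x\<^sup>2) powr (s - 1) * (1 - x\<^sup>2) powr (b - 1) else 0) / 2))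
         = indicator {0<..} x * (indicator {-1..1} x * (x ^ n * (1 - x\<^sup>2) powr (b - 1)))"
        by (auto simp: indicator_def mult.assoc[symmetric])
    qed
    finally show ?thesis .
  qed
  show ?thesis
  proof (cases "even n")
    case True
    have "(\<lambda>x. indicator {0<..} x * (indicator {- 1..1} (- x) * ((- x) ^ n * (1 - (- x)\<^sup>2) powr (b - 1))))
      = (\<lambda>x. indicator {0<..} x * (indicator {-1..1} x * (x ^ n * (1 - x\<^sup>2) powr (b - 1))))"
      using True by (auto simp: fun_eq_iff indicator_def)
    then show ?thesis
      using has_bochner_integral_half_lines[OF * , of "Beta s b / 2"] * True by (simp add: s_def)
  next
    case False
    have "(\<lambda>x. indicator {0<..} x * (indicator {- 1..1} (- x) * ((- x) ^ n * (1 - (- x)\<^sup>2) powr (b - 1))))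
      = (\<lambda>x. - (indicator {0<..} x * (indicator {-1..1} x * (x ^ n * (1 - x\<^sup>2) powr (b - 1)))))"
      using False by (auto simp: fun_eq_iff indicator_def)
    then show ?thesis
      using has_bochner_integral_half_lines[OF * , of "- (Beta s b / 2)"]
        has_bochner_integral_minus[OF *] False by simp
  qed
qed

text \<open>Lebesgue measure on the vector type is the image of a product measure indexed by
  \<open>Basis\<close>, so the coordinates are carried over along the bijection from
  \<open>i\<close> to \<open>axis i 1\<close>.\<close>

lemma has_bochner_integral_lborel_prod:
  fixes f :: "'d::finite \<Rightarrow> real \<Rightarrow> real"
  assumes f: "\<And>i. has_bochner_integral lborel (f i) (v i)"
  shows "has_bochner_integral (lborel :: (real ^ 'd) measure) (\<lambda>x. \<Prod>i\<in>UNIV. f i (x $ i)) (\<Prod>i\<in>UNIV. v i)"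
proof -
  interpret product_sigma_finite "\<lambda>_::real ^ 'd. lborel :: real measure" ..
  define e where "e i = (axis i 1 :: real ^ 'd)" for i
  have e: "bij_betw e UNIV Basis"
    by (auto simp: bij_betw_def inj_on_def e_def axis_eq_axis Basis_vec_def)
  define g where "g b = f (the_inv_into UNIV e b)" for b
  have ge: "g (e i) = f i" for i
    using e by (simp add: g_def the_inv_into_f_f bij_betw_def)
  have bm: "f i \<in> borel_measurable borel" for i using f[of i] by (auto simp: has_bochner_integral_iff)
  have gi: "integrable lborel (g b)" if "b \<in> Basis" for b
    using f by (simp add: g_def has_bochner_integral_iff)
  have sumc: "(\<Sum>b\<in>Basis. w b *\<^sub>R b) $ i = w (e i)" for w :: "real ^ 'd \<Rightarrow> real" and i
  proof -
    have "(\<Sum>b\<in>Basis. w b *\<^sub>R b) $ i = (\<Sum>j\<in>UNIV. w (e j) * (e j $ i))"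
      unfolding sum_component by (subst sum.reindex_bij_betw[OF e, symmetric]) simp
    also have "\<dots> = (\<Sum>j\<in>UNIV. if j = i then w (e j) else 0)"
      by (intro sum.cong) (auto simp: e_def axis_def)
    finally show ?thesis by simp
  qed
  have pr: "(\<Prod>i\<in>UNIV. f i ((\<Sum>b\<in>Basis. w b *\<^sub>R b) $ i)) = (\<Prod>b\<in>Basis. g b (w b))" for w :: "real ^ 'd \<Rightarrow> real"
    unfolding sumc by (subst prod.reindex_bij_betw[OF e, symmetric]) (simp add: ge)
  have "has_bochner_integral (\<Pi>\<^sub>M b\<in>(Basis::(real^'d) set). lborel) (\<lambda>w. \<Prod>b\<in>Basis. g b (w b)) (\<Prod>b\<in>Basis. integral\<^sup>L lborel (g b))"
    unfolding has_bochner_integral_iff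
    using product_integrable_prod[of Basis g] product_integral_prod[of Basis g] gi by auto
  also have "(\<Prod>b\<in>Basis. integral\<^sup>L lborel (g b)) = (\<Prod>i\<in>UNIV. v i)"
    using f by (subst prod.reindex_bij_betw[OF e, symmetric]) (simp add: ge has_bochner_integral_iff)
  finally have "has_bochner_integral (\<Pi>\<^sub>M b\<in>(Basis::(real^'d) set). lborel)
    (\<lambda>w. \<Prod>i\<in>UNIV. f i ((\<Sum>b\<in>Basis. w b *\<^sub>R b) $ i)) (\<Prod>i\<in>UNIV. v i)"
    unfolding pr .
  then have "has_bochner_integral (distr (\<Pi>\<^sub>M b\<in>(Basis::(real^'d) set). lborel) borel (\<lambda>w. \<Sum>b\<in>Basis. w b *\<^sub>R b))
    (\<lambda>x. \<Prod>i\<in>UNIV. f i (x $ i)) (\<Prod>i\<in>UNIV. v i)"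
    using bm by (subst has_bochner_integral_distr) auto
  then show ?thesis by (subst lborel_eq)
qed

subsection \<open>Polar coordinates and the moments of the cone weight\<close>

text \<open>The radial factor of \<open>conic_measure\<close> is also the one of Lebesgue measure in
  polar coordinates. This is what lets Gaussian integrals over the whole space determine moments on
  the cone.\<close>

definition radial_measure :: "nat \<Rightarrow> real measure" where
  "radial_measure d = density lborel (\<lambda>t. ennreal (t ^ (d - 1)) * indicator {0..} t)"

lemma sigma_finite_radial_measure: "sigma_finite_measure (radial_measure d)"
  unfolding radial_measure_def
  by (subst sigma_finite_measure.sigma_finite_iff_density_finite'[OF sigma_finite_lborel]) (auto simp: indicator_def)

lemma sets_radial_measure [measurable_cong, simp]: "sets (radial_measure d) = sets borel"
  by (simp add: radial_measure_def)

lemma emeasure_radial_atMost: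
  assumes "d > 0"
  shows "emeasure (radial_measure d) {..r} = ennreal (if r \<ge> 0 then r ^ d / d else 0)"
proof -
  have "emeasure (radial_measure d) {..r} = (\<integral>\<^sup>+t. ennreal (t ^ (d - 1)) * indicator {0..r} t \<partial>lborel)"
    unfolding radial_measure_def by (subst emeasure_density) (auto intro!: nn_integral_cong simp: indicator_def)
  also have "\<dots> = ennreal (if r \<ge> 0 then r ^ d / d else 0)"
  proof (cases "r \<ge> 0")
    case True
    have "((\<lambda>t. t ^ d / d) has_real_derivative t ^ (d - 1)) (at t)" for t :: real
      using assms by (auto intro!: derivative_eq_intros)
    then show ?thesis
      using True assms by (subst nn_integral_FTC_Icc[where F = "\<lambda>t. t ^ d / d"]) (auto simp: zero_power)
  qed auto
  finally show ?thesis .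
qed

lemma emeasure_sphere_measure:
  assumes "B \<in> sets borel"
  shows "emeasure (sphere_measure :: (real ^ 'd) measure) B
    = of_nat CARD('d) * emeasure lborel {x. norm x \<le> 1 \<and> x \<noteq> 0 \<and> x /\<^sub>R norm x \<in> B}"
proof -
  let ?R = "restrict_space lborel (cball 0 1 - {0}) :: (real ^ 'd) measure"
  have m: "(\<lambda>x. x /\<^sub>R norm x) \<in> scale_measure (of_nat CARD('d)) ?R \<rightarrow>\<^sub>M borel"
  proof -
    have "(\<lambda>x. x /\<^sub>R norm x) \<in> ?R \<rightarrow>\<^sub>M borel"
      by (intro measurable_restrict_space1) measurable
    then show ?thesis by (simp add: measurable_def space_scale_measure)
  qed
  have "emeasure (sphere_measure :: (real ^ 'd) measure) B
    = emeasure (scale_measure (of_nat CARD('d)) ?R) ((\<lambda>x. x /\<^sub>R norm x) -` B \<inter> space (scale_measure (of_nat CARD('d)) ?R))"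
    unfolding sphere_measure_def by (rule emeasure_distr[OF m assms])
  also have "\<dots> = of_nat CARD('d) * emeasure ?R {x. norm x \<le> 1 \<and> x \<noteq> 0 \<and> x /\<^sub>R norm x \<in> B}"
    by (simp add: space_scale_measure space_restrict_space)
       (intro arg_cong[where f = "\<lambda>X. _ * emeasure _ X"], auto)
  also have "emeasure ?R {x. norm x \<le> 1 \<and> x \<noteq> 0 \<and> x /\<^sub>R norm x \<in> B}
    = emeasure lborel {x. norm x \<le> 1 \<and> x \<noteq> 0 \<and> x /\<^sub>R norm x \<in> B}"
    by (intro emeasure_restrict_space) auto
  finally show ?thesis .
qed

lemma emeasure_lborel_scaled_cone:
  fixes B :: "(real ^ 'd) set"
  assumes r: "r > 0" and B: "B \<in> sets borel"
  shows "emeasure lborel {x. norm x \<le> r \<and> x \<noteq> 0 \<and> x /\<^sub>R norm x \<in> B}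
     = ennreal (r ^ CARD('d)) * emeasure lborel {x. norm x \<le> 1 \<and> x \<noteq> 0 \<and> x /\<^sub>R norm x \<in> B}"
proof -
  let ?X = "\<lambda>r. {x :: real ^ 'd. norm x \<le> r \<and> x \<noteq> 0 \<and> x /\<^sub>R norm x \<in> B}"
  have [measurable]: "?X r \<in> sets borel" for r
    using B by measurable
  have l: "(lborel :: (real ^ 'd) measure) = density (distr lborel borel (\<lambda>x. 0 + r *\<^sub>R x)) (\<lambda>_. \<bar>r\<bar> ^ DIM(real ^ 'd))"
    using r by (intro lborel_affine) auto
  have "emeasure lborel (?X r) = (\<integral>\<^sup>+x. ennreal (r ^ CARD('d)) * indicator (?X r) (r *\<^sub>R x) \<partial>lborel)"
    using r by (subst l, subst emeasure_density) (auto simp: nn_integral_distr)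
  also have "\<dots> = (\<integral>\<^sup>+x. ennreal (r ^ CARD('d)) * indicator (?X 1) x \<partial>lborel)"
  proof (intro nn_integral_cong)
    fix x :: "real ^ 'd"
    have e: "(r *\<^sub>R x) /\<^sub>R norm (r *\<^sub>R x) = x /\<^sub>R norm x" using r by simp
    have "r *\<^sub>R x \<in> ?X r \<longleftrightarrow> x \<in> ?X 1" unfolding mem_Collect_eq e using r by simp
    then show "ennreal (r ^ CARD('d)) * indicator (?X r) (r *\<^sub>R x) = ennreal (r ^ CARD('d)) * indicator (?X 1) x"
      by (simp only: indicator_def)
  qed
  also have "\<dots> = ennreal (r ^ CARD('d)) * emeasure lborel (?X 1)"
    by (subst nn_integral_cmult) auto
  finally show ?thesis .
qed

text \<open>For a fixed set \<open>B\<close> of directions both sides are measures in the radial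
  variable. They agree on the half-lines \<open>{..r}\<close> because a truncated cone scales with
  \<open>r^d\<close>, and half-lines generate the Borel sets. The origin, where the direction is
  meaningless, is a null set.\<close>

lemma polar_decomposition:
  "distr lborel (borel \<Otimes>\<^sub>M borel) (\<lambda>x :: real ^ 'd. (norm x, x /\<^sub>R norm x)) = radial_measure CARD('d) \<Otimes>\<^sub>M sphere_measure"
proof (rule pair_measure_eqI[symmetric])
  interpret finite_measure "sphere_measure :: (real ^ 'd) measure" by (rule finite_measure_sphere_measure)
  show "sigma_finite_measure (sphere_measure :: (real ^ 'd) measure)" ..
  show "sigma_finite_measure (radial_measure CARD('d))" by (rule sigma_finite_radial_measure)
  show "sets (radial_measure CARD('d) \<Otimes>\<^sub>M sphere_measure) =
    sets (distr lborel (borel \<Otimes>\<^sub>M borel) (\<lambda>x :: real ^ 'd. (norm x, x /\<^sub>R norm x)))"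
    by (simp cong: sets_pair_measure_cong)
  fix A :: "real set" and B :: "(real ^ 'd) set"
  assume "A \<in> sets (radial_measure CARD('d))" "B \<in> sets sphere_measure"
  then have A [measurable]: "A \<in> sets borel" and B [measurable]: "B \<in> sets borel" by auto
  define X where "X = {x :: real ^ 'd. x \<noteq> 0 \<and> x /\<^sub>R norm x \<in> B}"
  have [measurable]: "X \<in> sets borel" unfolding X_def by measurable
  let ?M = "distr (density lborel (indicator X)) borel (norm :: real ^ 'd \<Rightarrow> real)"
  let ?N = "scale_measure (emeasure sphere_measure B) (radial_measure CARD('d))"
  have eM: "emeasure ?M C = emeasure lborel {x. norm x \<in> C \<and> x \<in> X}" if [measurable]: "C \<in> sets borel" for C
  proof -
    have "emeasure ?M C = (\<integral>\<^sup>+x. indicator X x * indicator (norm -` C) x \<partial>lborel)"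
    proof -
      have "norm -` C \<in> sets (borel :: (real ^ 'd) measure)"
        using measurable_sets[of norm borel borel C] that by simp
      then show ?thesis by (subst emeasure_distr) (auto simp: emeasure_density)
    qed
    also have "\<dots> = (\<integral>\<^sup>+x. indicator {x. norm x \<in> C \<and> x \<in> X} x \<partial>lborel)"
      by (intro nn_integral_cong) (auto simp: indicator_def)
    also have "\<dots> = emeasure lborel {x. norm x \<in> C \<and> x \<in> X}"
      by (intro nn_integral_indicator) measurable
    finally show ?thesis .
  qed
  have eq: "emeasure ?M {..r} = emeasure ?N {..r}" for r
  proof (cases "r > 0")
    case True
    have "emeasure ?M {..r} = ennreal (r ^ CARD('d)) * emeasure lborel {x. norm x \<le> 1 \<and> x \<noteq> 0 \<and> x /\<^sub>R norm x \<in> B}"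
      using emeasure_lborel_scaled_cone[OF True B] eM[of "{..r}"] by (simp add: X_def)
    \<comment> \<open>The factor \<open>d\<close> built into \<open>sphere_measure\<close>
      compensates the \<open>1/d\<close> in the radial mass of \<open>{..r}\<close>.\<close>
    also have "ennreal (r ^ CARD('d)) = ennreal (r ^ CARD('d) / CARD('d)) * of_nat CARD('d)"
      using True by (simp add: ennreal_of_nat_eq_real_of_nat flip: ennreal_mult')
    also have "\<dots> * emeasure lborel {x. norm x \<le> 1 \<and> x \<noteq> 0 \<and> x /\<^sub>R norm x \<in> B}
      = emeasure ?N {..r}"
      using True by (simp add: emeasure_sphere_measure emeasure_radial_atMost mult_ac)
    finally show ?thesis .
  next
    case False
    have "{x. norm x \<in> {..r} \<and> x \<in> X} = {}"
      using False by (auto simp: X_def) (smt (verit) norm_ge_zero zero_less_norm_iff)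
    then have "emeasure ?M {..r} = 0" unfolding eM[OF borel_closed[OF closed_atMost]] by (simp only: emeasure_empty)
    also have "emeasure ?N {..r} = 0"
      using False by (auto simp: emeasure_radial_atMost)
    finally show ?thesis by simp
  qed
  have "?N = ?M"
  proof (rule measure_eqI_generator_eq[where E = "range (\<lambda>a. {..a})" and \<Omega> = UNIV and A = "\<lambda>n. {..real n}"])
    show "Int_stable (range (\<lambda>a::real. {..a}))"
      by (auto simp: Int_stable_def)
    show "(\<Union>i. {..real i}) = UNIV" using real_arch_simple by auto
    show "emeasure ?N {..real i} \<noteq> \<infinity>" for i
      using emeasure_finite by (simp add: emeasure_radial_atMost ennreal_mult_eq_top_iff)
    show "sets ?N = sigma_sets UNIV (range (\<lambda>a::real. {..a}))" "sets ?M = sigma_sets UNIV (range (\<lambda>a::real. {..a}))"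
      by (simp_all add: borel_eq_atMost)
  qed (use eq in auto)
  then have "emeasure ?N A = emeasure ?M A" by simp
  then have "emeasure (radial_measure CARD('d)) A * emeasure sphere_measure B = emeasure lborel {x. norm x \<in> A \<and> x \<in> X}"
    by (simp add: eM mult.commute)
  also have "\<dots> = emeasure lborel {x. norm x \<in> A \<and> x /\<^sub>R norm x \<in> B}"
  proof (rule emeasure_eq_AE)
    show "AE x in lborel. (x \<in> {x. norm x \<in> A \<and> x \<in> X}) = (x \<in> {x. norm x \<in> A \<and> x /\<^sub>R norm x \<in> B})"
      using AE_lborel_singleton[of "0 :: real ^ 'd"] by eventually_elim (auto simp: X_def)
  qed measurable
  also have "\<dots> = emeasure (distr lborel (borel \<Otimes>\<^sub>M borel) (\<lambda>x :: real ^ 'd. (norm x, x /\<^sub>R norm x))) (A \<times> B)"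
    by (subst emeasure_distr) (auto intro!: arg_cong[where f = "emeasure _"])
  finally show "emeasure (radial_measure CARD('d)) A * emeasure sphere_measure B =
    emeasure (distr lborel (borel \<Otimes>\<^sub>M borel) (\<lambda>x :: real ^ 'd. (norm x, x /\<^sub>R norm x))) (A \<times> B)" .
qed

lemma AE_sphere_measure: "AE x in (sphere_measure :: (real ^ 'd) measure). norm x = 1"
proof -
  have "emeasure (sphere_measure :: (real ^ 'd) measure) {x. norm x \<noteq> 1} = 0"
  proof -
    have e: "{x :: real ^ 'd. norm x \<le> 1 \<and> x \<noteq> 0 \<and> x /\<^sub>R norm x \<in> {x. norm x \<noteq> 1}} = {}"
    proof -
      have "norm (x /\<^sub>R norm x) = 1" if "x \<noteq> 0" for x :: "real ^ 'd" using that by simp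
      then show ?thesis by blast
    qed
    have b: "{x :: real ^ 'd. norm x \<noteq> 1} \<in> sets borel" by measurable
    show ?thesis unfolding emeasure_sphere_measure[OF b] e by simp
  qed
  then show ?thesis by (intro AE_I[of _ _ "{x. norm x \<noteq> 1}"]) (auto simp: sphere_measure_def)
qed

lemma has_bochner_integral_radial_measure:
  assumes "has_bochner_integral lborel (\<lambda>t. indicator {0<..} t * (t ^ (d - 1) * f t)) v"
    and [measurable]: "f \<in> borel_measurable borel"
  shows "has_bochner_integral (radial_measure d) f v"
proof -
  have "has_bochner_integral (density lborel (\<lambda>t. ennreal (indicator {0..} t * t ^ (d - 1)))) f v"
  proof (rule has_bochner_integral_density)
    have "AE t in lborel. indicator {0<..} t * (t ^ (d - 1) * f t) = (indicator {0..} t * t ^ (d - 1)) *\<^sub>R f t"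
      using AE_lborel_singleton[of "0::real"] by eventually_elim (auto simp: indicator_def)
    then show "has_bochner_integral lborel (\<lambda>t. (indicator {0..} t * t ^ (d - 1)) *\<^sub>R f t) v"
      using assms(1) by (subst (asm) has_bochner_integral_cong_AE) auto
  qed (auto simp: indicator_def)
  also have "density lborel (\<lambda>t. ennreal (indicator {0..} t * t ^ (d - 1))) = radial_measure d"
    unfolding radial_measure_def by (intro density_cong) (auto simp: indicator_def)
  finally show ?thesis .
qed

section \<open>Weighted monomials and their moments on the sphere and on the cone\<close>

definition cone_monomial :: "('d::finite \<Rightarrow> nat) \<Rightarrow> nat \<Rightarrow> (real ^ 'd) \<times> real \<Rightarrow> real" where
  "cone_monomial a k z = (\<Prod>i\<in>UNIV. (fst z $ i) ^ a i) * snd z ^ k"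

definition weighted_monomial :: "real ^ 'd \<Rightarrow> ('d \<Rightarrow> nat) \<Rightarrow> real ^ 'd \<Rightarrow> real" where
  "weighted_monomial \<kappa> a x = (\<Prod>i\<in>UNIV. (x $ i) ^ a i * weight_factor (\<kappa> $ i) (x $ i))"

lemma h_weight_square: "(h_weight \<kappa> x)\<^sup>2 = (\<Prod>i\<in>UNIV. weight_factor (\<kappa> $ i) (x $ i))"
  by (simp add: h_weight_def weight_factor_def prod_power_distrib)

lemma weighted_monomial_measurable [measurable]: "weighted_monomial \<kappa> a \<in> borel_measurable borel"
  unfolding weighted_monomial_def by measurable

lemma cone_monomial_weight:
  "cone_monomial a k (x, t) * cone_weight \<kappa> (x, t) = weighted_monomial \<kappa> a x * (t ^ k * inverse t * exp (- t))"
  by (simp add: cone_monomial_def cone_weight_def h_weight_square weighted_monomial_def prod.distrib)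

lemma weighted_monomial_scaleR:
  fixes \<kappa> x :: "real ^ 'd"
  assumes "t > 0"
  shows "weighted_monomial \<kappa> a (t *\<^sub>R x) = t powr (\<Sum>i\<in>UNIV. real (a i) + 2 * \<kappa> $ i) * weighted_monomial \<kappa> a x"
proof -
  have "(t * y) ^ n * weight_factor k (t * y) = t powr (real n + 2 * k) * (y ^ n * weight_factor k y)" for y k n
  proof -
    have "(t powr k)\<^sup>2 = t powr (2 * k)" by (simp add: power2_eq_square flip: powr_add)
    then have "weight_factor k (t * y) = t powr (2 * k) * weight_factor k y"
      using assms by (auto simp: weight_factor_def abs_mult powr_mult power_mult_distrib)
    moreover have "(t * y) ^ n = t powr real n * y ^ n"
      using assms by (simp add: power_mult_distrib powr_realpow)
    ultimately show ?thesis by (simp add: powr_add)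
  qed
  then have "weighted_monomial \<kappa> a (t *\<^sub>R x) = (\<Prod>i\<in>UNIV. t powr (real (a i) + 2 * \<kappa> $ i) * ((x $ i) ^ a i * weight_factor (\<kappa> $ i) (x $ i)))"
    by (simp add: weighted_monomial_def)
  also have "\<dots> = (\<Prod>i\<in>UNIV. t powr (real (a i) + 2 * \<kappa> $ i)) * weighted_monomial \<kappa> a x"
    by (simp add: prod.distrib weighted_monomial_def)
  finally show ?thesis using assms by (simp add: powr_sum)
qed

text \<open>This number is the Gamma parameter of the total radial integral: the surface measure
  contributes \<open>t^(d-1)\<close>, the weight \<open>t^(2|\<kappa>|)\<close> and
  \<open>t^(-1)\<close>.\<close>

lemma two_alpha: "2 * alpha \<kappa> + 1 = 2 * (\<Sum>i\<in>UNIV. \<kappa> $ i) + real CARD('d) - 1" for \<kappa> :: "real ^ 'd"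
  by (simp add: alpha_def field_simps)

lemma Gamma_add_nat: "x > 0 \<Longrightarrow> Gamma (x + real n) = pochhammer x n * Gamma (x :: real)"
  by (subst pochhammer_Gamma) (auto simp: Gamma_eq_zero_iff elim!: nonpos_Ints_cases)

context
  fixes \<kappa> :: "real ^ 'd"
  assumes card: "CARD('d) \<ge> 2" and \<kappa>: "\<And>i. 0 \<le> \<kappa> $ i"
begin

lemma alpha_nonneg: "alpha \<kappa> \<ge> 0"
  using card \<kappa> by (auto simp: alpha_def intro!: add_nonneg_nonneg sum_nonneg)

text \<open>The integral of the weighted monomial times \<open>exp(-|x|^2)\<close> over the whole
  space is evaluated twice: as a product of one-dimensional Gaussian moments, and in polar
  coordinates as a Gamma integral times the unknown moment \<open>I\<close>. Integrability on the
  sphere comes from the bound 1.\<close>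

lemma sphere_moment:
  "has_bochner_integral sphere_measure (weighted_monomial \<kappa> a)
     (if \<forall>i. even (a i) then 2 * (\<Prod>i\<in>UNIV. Gamma (\<kappa> $ i + (real (a i) + 1) / 2)) / Gamma (alpha \<kappa> + 1 + (\<Sum>i\<in>UNIV. real (a i)) / 2) else 0)"
proof -
  interpret S: finite_measure "sphere_measure :: (real ^ 'd) measure" by (rule finite_measure_sphere_measure)
  define p where "p = (\<Sum>i\<in>UNIV. real (a i) + 2 * \<kappa> $ i)"
  define G where "G = (\<Prod>i\<in>UNIV. if even (a i) then Gamma (\<kappa> $ i + (real (a i) + 1) / 2) else 0)"
  have p: "p \<ge> 0" using \<kappa> by (auto simp: p_def intro!: sum_nonneg)
  have pd: "(p + real (CARD('d) - 1) + 1) / 2 = alpha \<kappa> + 1 + (\<Sum>i\<in>UNIV. real (a i)) / 2"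
  proof -
    have "p = (\<Sum>i\<in>UNIV. real (a i)) + 2 * (\<Sum>i\<in>UNIV. \<kappa> $ i)"
      by (simp add: p_def sum.distrib sum_distrib_left)
    then show ?thesis using card by (simp add: alpha_def field_simps of_nat_diff)
  qed
  have pos: "Gamma (alpha \<kappa> + 1 + (\<Sum>i\<in>UNIV. real (a i)) / 2) > 0"
  proof (rule Gamma_real_pos)
    have "(\<Sum>i\<in>UNIV. real (a i)) / 2 \<ge> 0" by (simp add: sum_nonneg)
    then show "alpha \<kappa> + 1 + (\<Sum>i\<in>UNIV. real (a i)) / 2 > 0" using alpha_nonneg by linarith
  qed
  have int: "integrable sphere_measure (weighted_monomial \<kappa> a)"
  proof (rule S.integrable_const_bound[where B = 1])
    show "AE x in sphere_measure. norm (weighted_monomial \<kappa> a x) \<le> 1"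
      using AE_sphere_measure
    proof eventually_elim
      case (elim x)
      have x: "\<bar>x $ i\<bar> \<le> 1" for i using component_le_norm_cart[of x i] elim by simp
      have "\<bar>x $ i ^ a i * weight_factor (\<kappa> $ i) (x $ i)\<bar> \<le> 1" for i
      proof -
        have "\<bar>x $ i\<bar> powr (\<kappa> $ i) \<le> 1" using x \<kappa> by (intro powr_le1) auto
        then have "weight_factor (\<kappa> $ i) (x $ i) \<le> 1" "weight_factor (\<kappa> $ i) (x $ i) \<ge> 0"
          by (auto simp: weight_factor_def intro!: power_le_one)
        moreover have "\<bar>x $ i\<bar> ^ a i \<le> 1" using x by (intro power_le_one) auto
        ultimately show ?thesis by (simp add: abs_mult power_abs mult_le_one)
      qed
      then show ?case by (auto simp: weighted_monomial_def abs_prod intro!: prod_le_1)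
    qed
  qed simp
  define I where "I = integral\<^sup>L sphere_measure (weighted_monomial \<kappa> a)"
  have "has_bochner_integral (radial_measure CARD('d)) (\<lambda>t. t powr p * exp (- t\<^sup>2))
      (Gamma ((p + real (CARD('d) - 1) + 1) / 2) / 2)"
  proof (rule has_bochner_integral_radial_measure)
    have "has_bochner_integral lborel (\<lambda>t. indicator {0<..} t * (t powr (p + real (CARD('d) - 1)) * exp (- t\<^sup>2)))
      (Gamma ((p + real (CARD('d) - 1) + 1) / 2) / 2)"
      using p by (intro has_bochner_integral_Gamma_square) (smt (verit) of_nat_0_le_iff)
    also have "(\<lambda>t. indicator {0<..} t * (t powr (p + real (CARD('d) - 1)) * exp (- t\<^sup>2)))
      = (\<lambda>t. indicator {0<..} t * (t ^ (CARD('d) - 1) * (t powr p * exp (- t\<^sup>2))))"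
      by (auto simp: fun_eq_iff indicator_def powr_add powr_realpow simp del: of_nat_diff)
    finally show "has_bochner_integral lborel (\<lambda>t. indicator {0<..} t * (t ^ (CARD('d) - 1) * (t powr p * exp (- t\<^sup>2))))
      (Gamma ((p + real (CARD('d) - 1) + 1) / 2) / 2)" .
  qed simp
  from has_bochner_integral_pair_mult[OF sigma_finite_radial_measure S.sigma_finite_measure_axioms this, of "weighted_monomial \<kappa> a" I]
  have 1: "has_bochner_integral (radial_measure CARD('d) \<Otimes>\<^sub>M sphere_measure)
     (\<lambda>(t, x). t powr p * exp (- t\<^sup>2) * weighted_monomial \<kappa> a x)
     (Gamma (alpha \<kappa> + 1 + (\<Sum>i\<in>UNIV. real (a i)) / 2) / 2 * I)"
    using int unfolding pd by (simp add: I_def has_bochner_integral_iff)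
  have "has_bochner_integral lborel (\<lambda>x :: real ^ 'd. \<Prod>i\<in>UNIV. (x $ i) ^ a i * weight_factor (\<kappa> $ i) (x $ i) * exp (- (x $ i)\<^sup>2)) G"
    unfolding G_def by (intro has_bochner_integral_lborel_prod gaussian_moment \<kappa>)
  also have "(\<lambda>x :: real ^ 'd. \<Prod>i\<in>UNIV. (x $ i) ^ a i * weight_factor (\<kappa> $ i) (x $ i) * exp (- (x $ i)\<^sup>2))
     = (\<lambda>x. weighted_monomial \<kappa> a x * exp (- (norm x)\<^sup>2))"
  proof
    fix x :: "real ^ 'd"
    have "(norm x)\<^sup>2 = (\<Sum>i\<in>UNIV. (x $ i)\<^sup>2)"
      unfolding power2_norm_eq_inner inner_vec_def by (simp add: power2_eq_square)
    then have "exp (- (norm x)\<^sup>2) = (\<Prod>i\<in>UNIV. exp (- (x $ i)\<^sup>2))"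
      by (simp add: exp_sum flip: sum_negf)
    then show "(\<Prod>i\<in>UNIV. (x $ i) ^ a i * weight_factor (\<kappa> $ i) (x $ i) * exp (- (x $ i)\<^sup>2))
      = weighted_monomial \<kappa> a x * exp (- (norm x)\<^sup>2)"
      by (simp add: prod.distrib weighted_monomial_def)
  qed
  finally have "has_bochner_integral lborel (\<lambda>x. weighted_monomial \<kappa> a x * exp (- (norm x)\<^sup>2)) G" .
  also have "?this \<longleftrightarrow> has_bochner_integral lborel
      (\<lambda>x. (\<lambda>(t, x). t powr p * exp (- t\<^sup>2) * weighted_monomial \<kappa> a x) (norm x, x /\<^sub>R norm x)) G"
  proof (rule has_bochner_integral_cong_AE)
    show "AE x in lborel. weighted_monomial \<kappa> a x * exp (- (norm x)\<^sup>2) =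
      (\<lambda>(t, x). t powr p * exp (- t\<^sup>2) * weighted_monomial \<kappa> a x) (norm x, x /\<^sub>R norm x)"
      using AE_lborel_singleton[of "0 :: real ^ 'd"]
    proof eventually_elim
      case (elim x)
      then show ?case
        using weighted_monomial_scaleR[of "norm x" \<kappa> a "x /\<^sub>R norm x"] by (simp add: p_def)
    qed
  qed measurable
  finally have "has_bochner_integral (radial_measure CARD('d) \<Otimes>\<^sub>M sphere_measure)
     (\<lambda>(t, x). t powr p * exp (- t\<^sup>2) * weighted_monomial \<kappa> a x) G"
    unfolding polar_decomposition[symmetric]
    by (subst has_bochner_integral_distr) auto
  with 1 have "Gamma (alpha \<kappa> + 1 + (\<Sum>i\<in>UNIV. real (a i)) / 2) / 2 * I = G"
    by (rule has_bochner_integral_eq)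
  then have "I = 2 * G / Gamma (alpha \<kappa> + 1 + (\<Sum>i\<in>UNIV. real (a i)) / 2)"
    using pos by (simp add: field_simps)
  moreover have "G = (if \<forall>i. even (a i) then \<Prod>i\<in>UNIV. Gamma (\<kappa> $ i + (real (a i) + 1) / 2) else 0)"
    by (auto simp: G_def intro!: prod_zero)
  ultimately show ?thesis using int by (auto simp: has_bochner_integral_iff I_def)
qed

text \<open>Dividing by the total mass \<open>cone_mass\<close> turns the Gamma quotients into
  Pochhammer symbols. The exponents of \<open>x\<close> and \<open>t\<close> enter the radial symbol
  only through their sum, a fact on which the pairing computation rests.\<close>

definition cone_moment_value :: "('d \<Rightarrow> nat) \<Rightarrow> nat \<Rightarrow> real" where
  "cone_moment_value a k = (if \<forall>i. even (a i) then
     (\<Prod>i\<in>UNIV. pochhammer (\<kappa> $ i + 1/2) (a i div 2)) / pochhammer (alpha \<kappa> + 1) ((\<Sum>i\<in>UNIV. a i) div 2)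
       * pochhammer (2 * alpha \<kappa> + 1) ((\<Sum>i\<in>UNIV. a i) + k) else 0)"

definition cone_mass :: real where
  "cone_mass = Gamma (2 * alpha \<kappa> + 1) * (2 * (\<Prod>i\<in>UNIV. Gamma (\<kappa> $ i + 1/2)) / Gamma (alpha \<kappa> + 1))"

lemma cone_mass_pos: "cone_mass > 0"
  using alpha_nonneg \<kappa> unfolding cone_mass_def
  by (intro mult_pos_pos divide_pos_pos prod_pos Gamma_real_pos ballI) (auto intro: add_nonneg_pos)

lemma cone_moment:
  "has_bochner_integral conic_measure (\<lambda>z. cone_monomial a k z * cone_weight \<kappa> z) (cone_mass * cone_moment_value a k)"
proof -
  interpret S: finite_measure "sphere_measure :: (real ^ 'd) measure" by (rule finite_measure_sphere_measure)
  define p where "p = (\<Sum>i\<in>UNIV. real (a i) + 2 * \<kappa> $ i)"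
  define s where "s = 2 * alpha \<kappa> + 1 + real ((\<Sum>i\<in>UNIV. a i) + k)"
  define v where "v = (if \<forall>i. even (a i) then 2 * (\<Prod>i\<in>UNIV. Gamma (\<kappa> $ i + (real (a i) + 1) / 2)) / Gamma (alpha \<kappa> + 1 + (\<Sum>i\<in>UNIV. real (a i)) / 2) else 0)"
  have s: "s > 0" using alpha_nonneg unfolding s_def by (smt (verit) of_nat_0_le_iff)
  have ps: "s - 1 = real (CARD('d) - 1) + p + real k - 1"
  proof -
    have "p = (\<Sum>i\<in>UNIV. real (a i)) + 2 * (\<Sum>i\<in>UNIV. \<kappa> $ i)"
      by (simp add: p_def sum.distrib sum_distrib_left)
    then show ?thesis using card unfolding s_def two_alpha by (simp add: of_nat_diff)
  qed
  have "has_bochner_integral (radial_measure CARD('d)) (\<lambda>t. t powr p * (t ^ k * inverse t * exp (- t))) (Gamma s)"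
  proof (rule has_bochner_integral_radial_measure)
    have pw: "t powr (real D + p + real k - 1) = t ^ D * (t powr p * (t ^ k * inverse t))" if "t > 0" for t D
      using that by (simp add: powr_diff powr_add powr_realpow divide_inverse)
    have "(\<lambda>t. indicator {0<..} t * (t powr (s - 1) * exp (- t))) =
      (\<lambda>t. indicator {0<..} t * (t ^ (CARD('d) - 1) * (t powr p * (t ^ k * inverse t * exp (- t)))))"
      unfolding ps by (rule ext) (simp add: indicator_def pw del: of_nat_diff)
    then show "has_bochner_integral lborel (\<lambda>t. indicator {0<..} t * (t ^ (CARD('d) - 1) * (t powr p * (t ^ k * inverse t * exp (- t))))) (Gamma s)"
      using has_bochner_integral_Gamma[OF s] by simp
  qed simp
  from has_bochner_integral_pair_mult[OF sigma_finite_radial_measure S.sigma_finite_measure_axioms this sphere_moment[of a]]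
  have 1: "has_bochner_integral (radial_measure CARD('d) \<Otimes>\<^sub>M sphere_measure)
      (\<lambda>(t, x). t powr p * (t ^ k * inverse t * exp (- t)) * weighted_monomial \<kappa> a x) (Gamma s * v)"
    by (simp add: v_def)
  have [measurable]: "(\<lambda>(t, \<xi>). (t *\<^sub>R \<xi>, t)) \<in> borel \<Otimes>\<^sub>M borel \<rightarrow>\<^sub>M (borel :: ((real ^ 'd) \<times> real) measure)"
    unfolding borel_prod by (intro borel_measurable_continuous_onI)
      (auto simp: case_prod_unfold intro!: continuous_intros)
  have [measurable]: "(\<lambda>z. cone_monomial a k z * cone_weight \<kappa> z) \<in> borel_measurable (borel :: ((real ^ 'd) \<times> real) measure)"
  proof -
    have "(\<lambda>z. cone_monomial a k z * cone_weight \<kappa> z) = (\<lambda>z. weighted_monomial \<kappa> a (fst z) * (snd z ^ k * inverse (snd z) * exp (- snd z)))"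
      using cone_monomial_weight by (auto simp: fun_eq_iff)
    also have "\<dots> \<in> borel_measurable borel" unfolding borel_prod[symmetric] by measurable
    finally show ?thesis .
  qed
  \<comment> \<open>The scaling law of \<open>weighted_monomial\<close> holds for
    \<open>t > 0\<close> only; the vertex \<open>t = 0\<close> has measure zero.\<close>
  have "AE z in radial_measure CARD('d) \<Otimes>\<^sub>M (sphere_measure :: (real ^ 'd) measure). fst z > 0"
  proof (subst pair_sigma_finite.AE_pair_measure)
    show "pair_sigma_finite (radial_measure CARD('d)) (sphere_measure :: (real ^ 'd) measure)"
      unfolding pair_sigma_finite_def using sigma_finite_radial_measure S.sigma_finite_measure_axioms by auto
    have "AE t in radial_measure CARD('d). t > 0"
      unfolding radial_measure_def
    proof (subst AE_density)
      show "AE t in lborel. 0 < ennreal (t ^ (CARD('d) - 1)) * indicator {0..} t \<longrightarrow> 0 < t"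
        using AE_lborel_singleton[of "0::real"] by eventually_elim (auto simp: indicator_def)
    qed simp
    then show "AE x in radial_measure CARD('d). AE y in (sphere_measure :: (real ^ 'd) measure). fst (x, y) > 0" by auto
    show "{x \<in> space (radial_measure CARD('d) \<Otimes>\<^sub>M (sphere_measure :: (real ^ 'd) measure)). fst x > 0}
      \<in> sets (radial_measure CARD('d) \<Otimes>\<^sub>M sphere_measure)" by measurable
  qed simp
  then have AE: "AE z in radial_measure CARD('d) \<Otimes>\<^sub>M sphere_measure.
      (\<lambda>(t, x). t powr p * (t ^ k * inverse t * exp (- t)) * weighted_monomial \<kappa> a x) z =
      (\<lambda>z. cone_monomial a k z * cone_weight \<kappa> z) ((\<lambda>(t, \<xi>). (t *\<^sub>R \<xi>, t)) z)"
    by eventually_elim (auto simp: cone_monomial_weight weighted_monomial_scaleR p_def split: prod.splits)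
  have "has_bochner_integral (radial_measure CARD('d) \<Otimes>\<^sub>M sphere_measure)
     (\<lambda>z. (\<lambda>z. cone_monomial a k z * cone_weight \<kappa> z) ((\<lambda>(t, \<xi>). (t *\<^sub>R \<xi>, t)) z)) (Gamma s * v)"
    by (rule has_bochner_integral_cong_AE[THEN iffD1, OF _ _ AE 1]) measurable
  then have "has_bochner_integral conic_measure (\<lambda>z. cone_monomial a k z * cone_weight \<kappa> z) (Gamma s * v)"
    unfolding conic_measure_def radial_measure_def
    by (subst has_bochner_integral_distr) measurable
  also have "Gamma s * v = cone_mass * cone_moment_value a k"
  proof (cases "\<forall>i. even (a i)")
    case True
    define m where "m = (\<Sum>i\<in>UNIV. a i) div 2"
    have "even (\<Sum>i\<in>UNIV. a i)" using True by (auto intro: dvd_sum)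
    then have m: "(\<Sum>i\<in>UNIV. real (a i)) / 2 = real m"
      by (simp add: m_def real_of_nat_div flip: of_nat_sum)
    have "Gamma (\<kappa> $ i + (real (a i) + 1) / 2) = pochhammer (\<kappa> $ i + 1/2) (a i div 2) * Gamma (\<kappa> $ i + 1/2)" for i
    proof -
      have "\<kappa> $ i + (real (a i) + 1) / 2 = \<kappa> $ i + 1/2 + real (a i div 2)" using True by (simp add: real_of_nat_div add_divide_distrib)
      then show ?thesis using Gamma_add_nat[of "\<kappa> $ i + 1/2" "a i div 2"] \<kappa>[of i] by (simp only:)
    qed
    moreover have "Gamma s = pochhammer (2 * alpha \<kappa> + 1) ((\<Sum>i\<in>UNIV. a i) + k) * Gamma (2 * alpha \<kappa> + 1)"
      unfolding s_def using alpha_nonneg by (intro Gamma_add_nat) auto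
    moreover have "Gamma (alpha \<kappa> + 1 + real m) = pochhammer (alpha \<kappa> + 1) m * Gamma (alpha \<kappa> + 1)"
      using alpha_nonneg by (intro Gamma_add_nat) auto
    ultimately show ?thesis
      using True by (simp add: v_def m cone_mass_def cone_moment_value_def prod.distrib mult_ac flip: m_def)
  qed (auto simp: v_def cone_moment_value_def)
  finally show ?thesis .
qed

lemma cone_const_eq: "cone_const \<kappa> = 1 / cone_mass"
  using cone_moment[of "\<lambda>_. 0" 0]
  by (simp add: cone_const_def has_bochner_integral_iff cone_monomial_def cone_moment_value_def)

end

subsection \<open>Generating functions\<close>

text \<open>The dominating series makes the double family absolutely summable, so summation by rows
  and along antidiagonals give the same value.\<close>

lemma sums_triangle:
  fixes f g :: "nat \<Rightarrow> nat \<Rightarrow> real"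
  assumes bound: "\<And>i j. \<bar>f i j\<bar> \<le> g i j"
    and g: "\<And>i. g i sums G i" and G: "summable G"
    and s: "\<And>i. f i sums s i"
  shows "(\<lambda>n. \<Sum>i\<le>n. f i (n - i)) sums (\<Sum>i. s i)" "summable s"
proof -
  have g0: "g i j \<ge> 0" for i j using bound[of i j] by linarith
  have G0: "G i \<ge> 0" for i using sums_le[OF _ sums_zero g[of i]] g0 by auto
  have gs: "((\<lambda>j. g i j) has_sum G i) UNIV" for i
    using g g0 by (intro sums_nonneg_imp_has_sum) auto
  have "(\<lambda>(i, j). g i j) summable_on Sigma UNIV (\<lambda>_. UNIV)"
  proof (rule summable_on_SigmaI[where g = G])
    show "G summable_on UNIV" using G G0 by (rule summable_nonneg_imp_summable_on)
  qed (use gs g0 in simp_all)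
  then have "(\<lambda>x. norm ((\<lambda>(i, j). g i j) x)) summable_on Sigma UNIV (\<lambda>_. UNIV)"
    by (rule summable_on_iff_abs_summable_on_real[THEN iffD1])
  then have "(\<lambda>x. norm ((\<lambda>(i, j). f i j) x)) summable_on Sigma UNIV (\<lambda>_. UNIV)"
    by (rule Infinite_Sum.abs_summable_on_comparison_test) (use bound g0 in \<open>simp add: split_beta\<close>)
  then have "(\<lambda>(i, j). f i j) summable_on Sigma UNIV (\<lambda>_. UNIV)"
    by (rule summable_on_iff_abs_summable_on_real[THEN iffD2])
  then obtain S where S: "((\<lambda>(i, j). f i j) has_sum S) (Sigma UNIV (\<lambda>_. UNIV))"
    by (auto simp: summable_on_def)
  have fs: "((\<lambda>j. f i j) has_sum s i) UNIV" for i
  proof (rule norm_summable_imp_has_sum[OF _ s])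
    show "summable (\<lambda>j. norm (f i j))"
      by (rule summable_comparison_test'[where g = "g i"]) (use bound g in \<open>auto simp: sums_iff\<close>)
  qed
  have "(s has_sum S) UNIV"
    using has_sum_SigmaD[OF S, of s] fs by simp
  then have 1: "s sums S" by (rule has_sum_imp_sums)
  have "((\<lambda>(n, i). f i (n - i)) has_sum S) (Sigma UNIV (\<lambda>n. {..n}))"
    using S by (subst has_sum_reindex_bij_witness[where i = "\<lambda>(i, j). (i + j, i)" and j = "\<lambda>(n, i). (i, n - i)"
       and T = "Sigma UNIV (\<lambda>_. UNIV)" and h = "\<lambda>(i, j). f i j" and s' = S]) auto
  then have "((\<lambda>n. \<Sum>i\<le>n. f i (n - i)) has_sum S) UNIV"
    by (rule has_sum_SigmaD) auto
  then have "(\<lambda>n. \<Sum>i\<le>n. f i (n - i)) sums S" by (rule has_sum_imp_sums)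
  then show "(\<lambda>n. \<Sum>i\<le>n. f i (n - i)) sums (\<Sum>i. s i)" "summable s" using 1 by (auto simp: sums_iff)
qed

lemma pochhammer_sums:
  fixes r A :: real
  assumes "0 \<le> r" "r < 1"
  shows "(\<lambda>n. pochhammer A n / fact n * r ^ n) sums ((1 - r) powr (- A))"
proof -
  have "((- A) gchoose n) * (- r) ^ n = pochhammer A n / fact n * r ^ n" for n
    by (simp add: gbinomial_pochhammer power_minus[of r])
  then show ?thesis using gen_binomial_real[of "- r" "- A"] assms by simp
qed

text \<open>\<open>laguerre_coeff A T j\<close> is the Laguerre polynomial \<open>L\<^sub>j\<^bsup>(A-1)\<^esup>(T)\<close>.\<close>

definition laguerre_coeff :: "real \<Rightarrow> real \<Rightarrow> nat \<Rightarrow> real" where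
  "laguerre_coeff A T j = (\<Sum>m\<le>j. (- T) ^ m / fact m * (pochhammer (A + real m) (j - m) / fact (j - m)))"

lemma pochhammer_nonneg_real: "(a::real) \<ge> 0 \<Longrightarrow> pochhammer a n \<ge> 0"
  using pochhammer_pos[of a n] by (cases "a = 0") (auto simp: pochhammer_0_left)

text \<open>As a double series in the power \<open>m\<close> of \<open>T\<close> and the remaining
  index \<open>l\<close>, each row is a binomial series, and the row sums form an exponential
  series. The same double series at \<open>-|T|\<close> has nonnegative terms and dominates.\<close>

lemma laguerre_sums:
  fixes r A T :: real
  assumes r: "0 \<le> r" "r < 1" and A: "A \<ge> 0"
  shows "(\<lambda>j. laguerre_coeff A T j * r ^ j) sums ((1 - r) powr (- A) * exp (- (T * r / (1 - r))))"
proof -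
  define f where "f T m l = (- T) ^ m / fact m * (pochhammer (A + real m) l / fact l) * r ^ (m + l)" for T m l
  define s where "s T m = (1 - r) powr (- A) * ((- (T * r / (1 - r))) ^ m / fact m)" for T m
  have fs: "f T m sums s T m" for T m
  proof -
    have "(\<lambda>l. (- T) ^ m / fact m * r ^ m * (pochhammer (A + real m) l / fact l * r ^ l)) sums
       ((- T) ^ m / fact m * r ^ m * (1 - r) powr (- (A + real m)))"
      by (intro sums_mult pochhammer_sums r)
    also have "(\<lambda>l. (- T) ^ m / fact m * r ^ m * (pochhammer (A + real m) l / fact l * r ^ l)) = f T m"
      by (simp add: fun_eq_iff f_def power_add)
    also have "(- T) ^ m / fact m * r ^ m * (1 - r) powr (- (A + real m)) = s T m"
    proof -
      have "(1 - r) powr (- (A + real m)) = (1 - r) powr (- A) / (1 - r) ^ m"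
        using r by (simp add: powr_diff powr_realpow)
      moreover have "(- (T * r / (1 - r))) ^ m = (- T) ^ m * r ^ m / (1 - r) ^ m"
      proof -
        have "- (T * r / (1 - r)) = (- T) * r / (1 - r)" by simp
        then show ?thesis by (simp only: power_mult_distrib power_divide)
      qed
      ultimately show ?thesis by (simp add: s_def mult_ac)
    qed
    finally show ?thesis .
  qed
  have ss: "s T sums ((1 - r) powr (- A) * exp (- (T * r / (1 - r))))" for T
    unfolding s_def using exp_converges[of "- (T * r / (1 - r))"]
    by (intro sums_mult) (simp add: divide_inverse mult.commute)
  have b: "\<bar>f T m l\<bar> \<le> f (- \<bar>T\<bar>) m l" for m l
    using r A by (simp add: f_def abs_mult power_abs pochhammer_nonneg_real)
  have "(\<lambda>n. \<Sum>i\<le>n. f T i (n - i)) sums (\<Sum>i. s T i)"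
    by (rule sums_triangle(1)[OF b fs _ fs]) (use ss in \<open>auto simp: sums_iff\<close>)
  moreover have "(\<Sum>i\<le>n. f T i (n - i)) = laguerre_coeff A T n * r ^ n" for n
    unfolding laguerre_coeff_def sum_distrib_right by (intro sum.cong) (auto simp: f_def)
  ultimately show ?thesis using ss[of T] by (simp add: sums_iff)
qed

lemma abs_laguerre_coeff_le:
  "A \<ge> 0 \<Longrightarrow> \<bar>laguerre_coeff A T j\<bar> \<le> laguerre_coeff A (- \<bar>T\<bar>) j"
  unfolding laguerre_coeff_def
  by (rule order.trans[OF sum_abs]) (auto intro!: sum_mono simp: abs_mult power_abs pochhammer_nonneg_real)

text \<open>Raising the parameter by \<open>2i\<close> multiplies the generating function by
  \<open>(1-r)^(-2i)\<close>, which together with \<open>r^i\<close> gives the powers of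
  \<open>r/(1-r)^2\<close>. The factorial in the bound on \<open>B\<close> yields convergence for
  every \<open>r < 1\<close>.\<close>

lemma laguerre_series_sums:
  fixes r A T D :: real and B :: "nat \<Rightarrow> real"
  assumes r: "0 \<le> r" "r < 1" and A: "A \<ge> 0" and B: "\<And>i. \<bar>B i\<bar> \<le> D ^ i / fact i" and D: "D \<ge> 0"
  shows "(\<lambda>n. (\<Sum>i\<le>n. B i * laguerre_coeff (A + 2 * real i) T (n - i)) * r ^ n) sums
     (exp (- (T * r / (1 - r))) / (1 - r) powr A * (\<Sum>i. B i * (r / (1 - r)\<^sup>2) ^ i))" (is ?thesis1)
    and "summable (\<lambda>i. B i * (r / (1 - r)\<^sup>2) ^ i)" (is ?thesis2)
proof -
  define f where "f B T i j = B i * r ^ i * (laguerre_coeff (A + 2 * real i) T j * r ^ j)" for T i j and B :: "nat \<Rightarrow> real"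
  define s where "s B T i = exp (- (T * r / (1 - r))) / (1 - r) powr A * (B i * (r / (1 - r)\<^sup>2) ^ i)" for T i and B :: "nat \<Rightarrow> real"
  have fs: "f B T i sums s B T i" for B T i
  proof -
    have "f B T i sums (B i * r ^ i * ((1 - r) powr (- (A + 2 * real i)) * exp (- (T * r / (1 - r)))))"
      unfolding f_def using A by (intro sums_mult laguerre_sums r) auto
    also have "(1 - r) powr (- (A + 2 * real i)) = 1 / ((1 - r) powr A * ((1 - r)\<^sup>2) ^ i)"
    proof -
      have "(1 - r) powr (2 * real i) = (1 - r) ^ (2 * i)" using r powr_realpow[of "1 - r" "2 * i"] by simp
      then show ?thesis using r by (simp add: powr_minus powr_diff power_mult divide_inverse)
    qed
    also have "B i * r ^ i * (1 / ((1 - r) powr A * ((1 - r)\<^sup>2) ^ i) * exp (- (T * r / (1 - r)))) = s B T i"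
      by (simp add: s_def power_divide)
    finally show ?thesis .
  qed
  define B' where "B' i = D ^ i / fact i" for i
  have "summable (\<lambda>i. (D * (r / (1 - r)\<^sup>2)) ^ i / fact i)"
    using summable_exp_generic[of "D * (r / (1 - r)\<^sup>2)"] by (simp add: divide_inverse mult.commute)
  moreover have "(D * q) ^ i / fact i = B' i * q ^ i" for q i
    by (simp add: B'_def power_mult_distrib)
  ultimately have "summable (\<lambda>i. B' i * (r / (1 - r)\<^sup>2) ^ i)" by (simp only:)
  then have G: "summable (s B' T)" for T unfolding s_def by (rule summable_mult)
  have b: "\<bar>f B T i j\<bar> \<le> f B' (- \<bar>T\<bar>) i j" for i j
  proof -
    have "\<bar>f B T i j\<bar> = \<bar>B i\<bar> * r ^ i * (\<bar>laguerre_coeff (A + 2 * real i) T j\<bar> * r ^ j)"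
      using r by (simp add: f_def abs_mult)
    also have "\<dots> \<le> f B' (- \<bar>T\<bar>) i j"
      unfolding f_def using r B A D abs_laguerre_coeff_le[of "A + 2 * real i" T j]
      by (intro mult_mono) (auto simp: B'_def)
    finally show ?thesis .
  qed
  have *: "(\<lambda>n. \<Sum>i\<le>n. f B T i (n - i)) sums (\<Sum>i. s B T i)"
    by (rule sums_triangle(1)[OF b fs G fs])
  have "summable (\<lambda>i. B i * (r / (1 - r)\<^sup>2) ^ i)"
  proof (rule summable_comparison_test'[where g = "\<lambda>i. B' i * (r / (1 - r)\<^sup>2) ^ i" and N = 0])
    fix i show "norm (B i * (r / (1 - r)\<^sup>2) ^ i) \<le> B' i * (r / (1 - r)\<^sup>2) ^ i"
    proof -
      have "\<bar>B i\<bar> * (r / (1 - r)\<^sup>2) ^ i \<le> B' i * (r / (1 - r)\<^sup>2) ^ i"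
        unfolding B'_def using B[of i] r by (intro mult_right_mono) auto
      then show ?thesis using r by (simp add: abs_mult power_abs)
    qed
  qed fact
  then show ?thesis2 .
  then have "(\<Sum>i. s B T i) = exp (- (T * r / (1 - r))) / (1 - r) powr A * (\<Sum>i. B i * (r / (1 - r)\<^sup>2) ^ i)"
    unfolding s_def by (rule suminf_mult)
  moreover have "(\<Sum>i\<le>n. f B T i (n - i)) = (\<Sum>i\<le>n. B i * laguerre_coeff (A + 2 * real i) T (n - i)) * r ^ n" for n
    unfolding sum_distrib_right by (intro sum.cong refl) (auto simp: f_def simp flip: power_add)
  ultimately show ?thesis1 using * by simp
qed

text \<open>The \<open>n\<close>-th moment of the density \<open>c (1+u) (1-u^2)^(k-1)\<close>,
  normalized to mass 1. The index is rounded up because for odd \<open>n\<close> only the summand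
  \<open>u\<close> of \<open>1 + u\<close> contributes, with total exponent
  \<open>n + 1\<close>.\<close>

definition moment_ratio :: "real \<Rightarrow> nat \<Rightarrow> real" where
  "moment_ratio k n = pochhammer (1/2) ((n + 1) div 2) / pochhammer (k + 1/2) ((n + 1) div 2)"

lemma moment_ratio_bounds:
  assumes "k \<ge> 0"
  shows "0 \<le> moment_ratio k n" "moment_ratio k n \<le> 1"
proof -
  have "pochhammer (1/2) m \<le> pochhammer (k + 1/2) m" for m
    using assms by (induction m) (auto simp: pochhammer_Suc intro!: mult_mono pochhammer_nonneg_real)
  moreover have "pochhammer (k + 1/2) m > 0" for m using assms by (intro pochhammer_pos) auto
  moreover have "pochhammer (1/2::real) m \<ge> 0" for m by (intro pochhammer_nonneg_real) auto
  ultimately show "0 \<le> moment_ratio k n" "moment_ratio k n \<le> 1"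
    unfolding moment_ratio_def by (simp_all only: divide_nonneg_pos divide_le_eq_1_pos)
qed

text \<open>
  \<open>1/k!\<close> times the image of \<open>(c + \<Sum>\<^sub>i z\<^sub>i)\<^sup>k\<close> under the Dunkl intertwining operator of the group \<open>\<int>\<^sub>2\<^sup>d\<close>, which
  multiplies each monomial by the moments of \<open>c\<^bsub>k-1/2\<^esub> (1 + u) (1 - u\<^sup>2)\<^bsup>k-1\<^esup>\<close>. At \<open>k = 0\<close> these moments are \<open>1\<close>,
  so the limit convention for \<open>\<kappa>\<^sub>i = 0\<close> needs no case distinction here.
\<close>

definition intertwined_power :: "real ^ 'd \<Rightarrow> ('d \<Rightarrow> real) \<Rightarrow> real \<Rightarrow> nat \<Rightarrow> real" where
  "intertwined_power \<kappa> z c k = (\<Sum>l\<le>k. c ^ (k - l) / fact (k - l) *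
      (\<Sum>b\<in>multi_index UNIV l. \<Prod>i\<in>UNIV. z i ^ b i * moment_ratio (\<kappa> $ i) (b i) / fact (b i)))"

text \<open>These are the \<open>B_i\<close>. The denominator is what remains when the even
  \<open>v\<close>-moment \<open>(1/2)_k / (alpha+1/2)_k\<close> meets the \<open>1/(2k)!\<close> of
  the exponential, the factor \<open>1/2\<close> inside \<open>rho^2\<close> and the square of
  \<open>2 sqrt r/(1-r)\<close>.\<close>

definition bessel_part :: "real ^ 'd \<Rightarrow> ('d \<Rightarrow> real) \<Rightarrow> real \<Rightarrow> nat \<Rightarrow> real" where
  "bessel_part \<kappa> z c k = intertwined_power \<kappa> z c k / (2 ^ k * pochhammer (alpha \<kappa> + 1/2) k)"

lemma power_add_sum_multi_index:
  fixes z :: "'d::finite \<Rightarrow> real"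
  shows "(c + (\<Sum>i\<in>UNIV. z i)) ^ k / fact k = (\<Sum>l\<le>k. c ^ (k - l) / fact (k - l) *
      (\<Sum>b\<in>multi_index UNIV l. \<Prod>i\<in>UNIV. z i ^ b i / fact (b i)))"
proof -
  have "(c + (\<Sum>i\<in>UNIV. z i)) ^ k / fact k = ((\<Sum>i\<in>UNIV. z i) + c) ^ k / fact k" by (simp add: add.commute)
  also have "\<dots> = (\<Sum>l\<le>k. c ^ (k - l) / fact (k - l) * ((\<Sum>i\<in>UNIV. z i) ^ l / fact l))"
    unfolding binomial_ring sum_divide_distrib
    by (intro sum.cong refl) (simp add: binomial_fact mult_ac)
  finally show ?thesis unfolding power_sum_multi_index[OF finite] .
qed

lemma intertwined_power_zero:
  "intertwined_power 0 z c k = (c + (\<Sum>i\<in>UNIV. z i)) ^ k / fact k"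
proof -
  have "moment_ratio 0 n = 1" for n
    using pochhammer_pos[of "1/2::real" "(n + 1) div 2"] by (simp add: moment_ratio_def)
  then show ?thesis unfolding power_add_sum_multi_index by (simp add: intertwined_power_def)
qed

lemma abs_bessel_part_le:
  assumes \<kappa>: "\<And>i. 0 \<le> \<kappa> $ i" and a: "alpha \<kappa> \<ge> 0"
  shows "\<bar>bessel_part \<kappa> z c k\<bar> \<le> (\<bar>c\<bar> + (\<Sum>i\<in>UNIV. \<bar>z i\<bar>)) ^ k / fact k"
proof -
  have "\<bar>intertwined_power \<kappa> z c k\<bar> \<le> (\<Sum>l\<le>k. \<bar>c\<bar> ^ (k - l) / fact (k - l) *
      (\<Sum>b\<in>multi_index UNIV l. \<Prod>i\<in>UNIV. \<bar>z i\<bar> ^ b i / fact (b i)))"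
    unfolding intertwined_power_def
  proof (rule order.trans[OF sum_abs], rule sum_mono)
    fix l
    have "\<bar>\<Sum>b\<in>multi_index UNIV l. \<Prod>i\<in>UNIV. z i ^ b i * moment_ratio (\<kappa> $ i) (b i) / fact (b i)\<bar>
       \<le> (\<Sum>b\<in>multi_index UNIV l. \<Prod>i\<in>UNIV. \<bar>z i\<bar> ^ b i / fact (b i))"
    proof (rule order.trans[OF sum_abs], rule sum_mono, unfold abs_prod, rule prod_mono, safe)
      fix b :: "'a \<Rightarrow> nat" and i
      show "\<bar>z i ^ b i * moment_ratio (\<kappa> $ i) (b i) / fact (b i)\<bar> \<le> \<bar>z i\<bar> ^ b i / fact (b i)"
        using moment_ratio_bounds[OF \<kappa>, of i "b i"]
        by (auto simp: abs_mult power_abs intro!: divide_right_mono mult_left_le)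
    qed auto
    then show "\<bar>c ^ (k - l) / fact (k - l) * (\<Sum>b\<in>multi_index UNIV l. \<Prod>i\<in>UNIV. z i ^ b i * moment_ratio (\<kappa> $ i) (b i) / fact (b i))\<bar>
      \<le> \<bar>c\<bar> ^ (k - l) / fact (k - l) * (\<Sum>b\<in>multi_index UNIV l. \<Prod>i\<in>UNIV. \<bar>z i\<bar> ^ b i / fact (b i))"
      by (auto simp: abs_mult power_abs intro!: mult_left_mono divide_right_mono)
  qed
  also have "\<dots> = (\<bar>c\<bar> + (\<Sum>i\<in>UNIV. \<bar>z i\<bar>)) ^ k / fact k" by (rule power_add_sum_multi_index[symmetric])
  finally have 1: "\<bar>intertwined_power \<kappa> z c k\<bar> \<le> (\<bar>c\<bar> + (\<Sum>i\<in>UNIV. \<bar>z i\<bar>)) ^ k / fact k" .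
  have "1 \<le> 2 ^ k * pochhammer (alpha \<kappa> + 1/2) k"
  proof (induction k)
    case (Suc k)
    have "1 * 1 \<le> (2 ^ k * pochhammer (alpha \<kappa> + 1/2) k) * (2 * (alpha \<kappa> + 1/2 + real k))"
      using Suc a by (intro mult_mono) auto
    then show ?case by (simp only: pochhammer_Suc power_Suc mult_ac mult_1)
  qed simp
  then have "\<bar>intertwined_power \<kappa> z c k\<bar> / (2 ^ k * pochhammer (alpha \<kappa> + 1/2) k) \<le> \<bar>intertwined_power \<kappa> z c k\<bar> / 1"
    by (intro divide_left_mono) auto
  moreover have "\<bar>2 ^ k * pochhammer (alpha \<kappa> + 1/2) k\<bar> = 2 ^ k * pochhammer (alpha \<kappa> + 1/2) k"
    using a by (intro abs_of_nonneg mult_nonneg_nonneg pochhammer_nonneg_real) auto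
  ultimately have "\<bar>bessel_part \<kappa> z c k\<bar> \<le> \<bar>intertwined_power \<kappa> z c k\<bar>"
    unfolding bessel_part_def abs_divide by (simp only: div_by_1)
  with 1 show ?thesis by linarith
qed

subsection \<open>The reproducing kernels\<close>

lemma coeff_mult_top:
  fixes p q :: "'a::comm_semiring_0 poly"
  assumes "degree p \<le> m" "degree q \<le> n"
  shows "coeff (p * q) (m + n) = coeff p m * coeff q n"
proof -
  have "coeff (p * q) (m + n) = (\<Sum>i\<le>m + n. if i = m then coeff p m * coeff q n else 0)"
    unfolding coeff_mult
  proof (intro sum.cong refl)
    fix i
    show "coeff p i * coeff q (m + n - i) = (if i = m then coeff p m * coeff q n else 0)"
      using assms by (cases i m rule: linorder_cases) (auto simp: coeff_eq_0)
  qed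
  then show ?thesis by simp
qed

text \<open>Degree bounds replace exact degrees because the coefficient of interest vanishes at
  points with suitable zero coordinates.\<close>

lemma degree_coeff_prod_top:
  fixes p :: "'b \<Rightarrow> 'a::comm_semiring_1 poly"
  assumes "finite A" "\<And>i. i \<in> A \<Longrightarrow> degree (p i) \<le> m i"
  shows "degree (\<Prod>i\<in>A. p i) \<le> sum m A \<and> coeff (\<Prod>i\<in>A. p i) (sum m A) = (\<Prod>i\<in>A. coeff (p i) (m i))"
  using assms
proof (induction A rule: finite_induct)
  case (insert i A)
  then have IH: "degree (\<Prod>i\<in>A. p i) \<le> sum m A" "coeff (\<Prod>i\<in>A. p i) (sum m A) = (\<Prod>i\<in>A. coeff (p i) (m i))"
    and i: "degree (p i) \<le> m i" by auto
  have "degree (p i * (\<Prod>i\<in>A. p i)) \<le> m i + sum m A"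
    using degree_mult_le[of "p i" "\<Prod>i\<in>A. p i"] IH i by linarith
  then show ?case using insert.hyps coeff_mult_top[OF i IH(1)] IH(2) by simp
qed auto

text \<open>As a polynomial in \<open>X\<close> this is \<open>p!\<close> times the Laguerre
  polynomial \<open>L_p^(c-1)\<close> at \<open>-x X\<close>. It is the polynomial whose product
  with the series \<open>exp(x X)\<close> has coefficients \<open>(c+q)_p x^q / q!\<close>.\<close>

definition moment_poly :: "real \<Rightarrow> nat \<Rightarrow> real \<Rightarrow> real poly" where
  "moment_poly c p x = (\<Sum>s\<le>p. monom (fact p / fact (p - s) * pochhammer (c + real s) (p - s) / fact s * x ^ s) s)"

lemma coeff_moment_poly:
  "coeff (moment_poly c p x) s = (if s \<le> p then fact p / fact (p - s) * pochhammer (c + real s) (p - s) / fact s * x ^ s else 0)"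
  by (simp add: moment_poly_def coeff_sum if_distrib sum.delta cong: if_cong)

lemma degree_moment_poly: "degree (moment_poly c p x) \<le> p"
  by (rule degree_le) (simp add: coeff_moment_poly)

text \<open>The Cauchy product is a \<open>pochhammer_convolution\<close> with first parameter
  \<open>-q\<close>; the terms with \<open>s > q\<close> vanish together with their binomial
  coefficients.\<close>

lemma moment_poly_exp_nth:
  assumes "c > 0"
  shows "fps_nth (fps_of_poly (moment_poly c p x) * fps_exp x) q = x ^ q / fact q * pochhammer (c + real q) p"
proof -
  have "fps_nth (fps_of_poly (moment_poly c p x) * fps_exp x) q
     = (\<Sum>s\<le>q. if s \<le> p then x ^ q / fact q * (fact p * (real (q choose s) * (pochhammer (c + real s) (p - s) / fact (p - s)))) else 0)"
    unfolding fps_mult_nth atLeast0AtMost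
  proof (intro sum.cong refl)
    fix s assume "s \<in> {..q}"
    then have "real (q choose s) = fact q / (fact s * fact (q - s))" "x ^ q = x ^ s * x ^ (q - s)"
      by (auto simp: binomial_fact simp flip: power_add)
    then show "fps_nth (fps_of_poly (moment_poly c p x)) s * fps_nth (fps_exp x) (q - s)
      = (if s \<le> p then x ^ q / fact q * (fact p * (real (q choose s) * (pochhammer (c + real s) (p - s) / fact (p - s)))) else 0)"
      by (simp add: coeff_moment_poly fps_exp_def mult_ac)
  qed
  also have "\<dots> = (\<Sum>s\<le>p. x ^ q / fact q * (fact p * (real (q choose s) * (pochhammer (c + real s) (p - s) / fact (p - s)))))"
    by (rule sum.mono_neutral_cong) auto
  also have "\<dots> = x ^ q / fact q * (fact p * (\<Sum>s\<le>p. (-1) ^ s * pochhammer (- real q) s / fact s * (pochhammer (c + real s) (p - s) / fact (p - s))))"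
  proof -
    have "real (q choose s) = (-1) ^ s * pochhammer (- real q) s / fact s" for s
      by (simp add: binomial_gbinomial gbinomial_pochhammer)
    then show ?thesis by (simp only: sum_distrib_left)
  qed
  also have "\<dots> = x ^ q / fact q * pochhammer (c + real q) p"
    unfolding pochhammer_convolution[OF assms] by simp
  finally show ?thesis .
qed

text \<open>The share of a single coordinate when exponent \<open>a\<close> of the monomial meets
  exponent \<open>b\<close> of a term of \<open>B_i\<close>; odd total exponents integrate to
  0.\<close>

definition paired_coeff :: "real \<Rightarrow> real \<Rightarrow> nat \<Rightarrow> nat \<Rightarrow> real" where
  "paired_coeff k x a b = x ^ b * moment_ratio k b / fact b *
     (if even (a + b) then pochhammer (k + 1/2) ((a + b) div 2) else 0)"

text \<open>With \<open>a = 2p + e\<close> and \<open>b = 2q + e\<close>, the denominator of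
  \<open>moment_ratio\<close> cancels against the Pochhammer symbol of the moment and leaves
  \<open>(k + 1/2 + e + q)_p\<close>. Such a polynomial in \<open>q\<close>, multiplied by
  exponential coefficients, is what \<open>moment_poly\<close> generates.\<close>

lemma paired_coeff_fps:
  assumes k: "k \<ge> 0"
  shows "Abs_fps (paired_coeff k x a) = fps_const (x ^ (a mod 2) / 2 ^ (a mod 2)) * fps_X ^ (a mod 2) *
     ((fps_of_poly (moment_poly (k + 1/2 + real (a mod 2)) (a div 2) (x\<^sup>2 / 4)) * fps_exp (x\<^sup>2 / 4)) oo fps_X ^ 2)"
    (is "_ = ?R")
proof (rule fps_ext)
  fix b
  define e p where "e = a mod 2" and "p = a div 2"
  have a: "a = 2 * p + e" and e: "e = 0 \<or> e = 1" by (auto simp: e_def p_def)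
  have c: "k + 1/2 + real e > 0" using k by simp
  have R: "fps_nth ?R b = (if e \<le> b \<and> even (b - e) then x ^ e / 2 ^ e * ((x\<^sup>2 / 4) ^ ((b - e) div 2) / fact ((b - e) div 2)
       * pochhammer (k + 1/2 + real e + real ((b - e) div 2)) p) else 0)"
    using moment_poly_exp_nth[OF c, of p "x\<^sup>2 / 4"]
    by (simp add: mult.assoc fps_X_power_mult_nth fps_compose_X_square_nth flip: e_def p_def)
  show "fps_nth (Abs_fps (paired_coeff k x a)) b = fps_nth ?R b"
  proof (cases "e \<le> b \<and> even (b - e)")
    case True
    then obtain q where b: "b = 2 * q + e" by (metis dvdE le_add_diff_inverse2)
    have q: "(b - e) div 2 = q" by (simp add: b)
    have ev: "even (a + b)" "(a + b) div 2 = (q + e) + p" "(b + 1) div 2 = q + e" using e by (auto simp: a b)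
    have nz: "pochhammer (k + 1/2) (q + e) > 0" using k by (intro pochhammer_pos) auto
    have f: "pochhammer (1/2) (q + e) / fact b = 1 / (4 ^ q * 2 ^ e * fact q :: real)"
    proof -
      have "(fact (2 * q) :: real) = 4 ^ q * pochhammer (1/2) q * fact q"
        using fact_double[of q, where 'a = real] by (simp add: power_mult)
      moreover have "pochhammer (1/2) q > (0 :: real)" by (intro pochhammer_pos) auto
      ultimately show ?thesis using e by (auto simp: b pochhammer_Suc field_simps)
    qed
    have "paired_coeff k x a b = x ^ b * (pochhammer (1/2) (q + e) / fact b) / pochhammer (k + 1/2) (q + e) *
       (pochhammer (k + 1/2) (q + e) * pochhammer (k + 1/2 + real (q + e)) p)"
      unfolding paired_coeff_def moment_ratio_def ev pochhammer_product' using ev(1) by simp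
    also have "\<dots> = x ^ e / 2 ^ e * ((x\<^sup>2 / 4) ^ q / fact q * pochhammer (k + 1/2 + real e + real q) p)"
      unfolding f using nz by (simp add: b power_add power_mult power_divide add_ac)
    finally show ?thesis unfolding R q fps_nth_Abs_fps if_P[OF True] .
  next
    case False
    \<comment> \<open>For \<open>b < e\<close> the truncated difference \<open>b - e\<close> is 0
      and hence even, which makes \<open>b = 0\<close>, \<open>e = 1\<close> a separate case;
      \<open>a\<close> is then odd.\<close>
    have "odd (a + b) \<or> (b = 0 \<and> e = 1)" using False e by (auto simp: a)
    then have "odd (a + b)" by (auto simp: a)
    then show ?thesis unfolding R if_not_P[OF False] by (simp add: paired_coeff_def)
  qed
qed

section \<open>Pairings of monomials with the candidate kernels\<close>

context
  fixes \<kappa> :: "real ^ 'd"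
  assumes card: "CARD('d) \<ge> 2" and \<kappa>: "\<And>i. 0 \<le> \<kappa> $ i"
begin

definition has_cone_mean :: "((real ^ 'd) \<times> real \<Rightarrow> real) \<Rightarrow> real \<Rightarrow> bool" where
  "has_cone_mean f v \<longleftrightarrow> has_bochner_integral conic_measure (\<lambda>z. f z * cone_weight \<kappa> z) (cone_mass \<kappa> * v)"

lemma has_cone_mean_monomial: "has_cone_mean (cone_monomial a k) (cone_moment_value \<kappa> a k)"
  unfolding has_cone_mean_def by (rule cone_moment[OF card \<kappa>])

lemma has_cone_mean_sum:
  "(\<And>i. i \<in> I \<Longrightarrow> has_cone_mean (f i) (v i)) \<Longrightarrow> has_cone_mean (\<lambda>z. \<Sum>i\<in>I. f i z) (\<Sum>i\<in>I. v i)"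
  unfolding has_cone_mean_def sum_distrib_left sum_distrib_right by (rule has_bochner_integral_sum)

lemma has_cone_mean_cmult: "has_cone_mean f v \<Longrightarrow> has_cone_mean (\<lambda>z. c * f z) (c * v)"
  unfolding has_cone_mean_def using has_bochner_integral_mult_right[of c conic_measure "\<lambda>z. f z * cone_weight \<kappa> z" "cone_mass \<kappa> * v"]
  by (simp add: mult_ac)

lemma has_cone_mean_cmult':
  "has_cone_mean (\<lambda>z. g z * f z) v \<Longrightarrow> has_cone_mean (\<lambda>z. g z * (c * f z)) (c * v)"
  using has_cone_mean_cmult[of "\<lambda>z. g z * f z" v c] by (simp only: mult.left_commute)

lemma cone_monomial_mult: "cone_monomial a k z * cone_monomial b l z = cone_monomial (\<lambda>i. a i + b i) (k + l) z"
  by (simp add: cone_monomial_def power_add prod.distrib mult_ac)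

definition bessel_coeff :: "real ^ 'd \<Rightarrow> real \<Rightarrow> nat \<Rightarrow> nat \<Rightarrow> ('d \<Rightarrow> nat) \<Rightarrow> real" where
  "bessel_coeff x t i l b = t ^ (i - l) / fact (i - l) * (\<Prod>j\<in>UNIV. (x $ j) ^ b j * moment_ratio (\<kappa> $ j) (b j) / fact (b j))
     / (2 ^ i * pochhammer (alpha \<kappa> + 1/2) i)"

lemma bessel_part_expand:
  "snd w ^ e * bessel_part \<kappa> (\<lambda>j. x $ j * fst w $ j) (t * snd w) i =
     (\<Sum>l\<le>i. \<Sum>b\<in>multi_index UNIV l. bessel_coeff x t i l b * cone_monomial b (i - l + e) w)"
proof -
  have "snd w ^ e * bessel_part \<kappa> (\<lambda>j. x $ j * fst w $ j) (t * snd w) i =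
    (\<Sum>l\<le>i. \<Sum>b\<in>multi_index UNIV l. snd w ^ e * ((t * snd w) ^ (i - l) / fact (i - l) *
       (\<Prod>j\<in>UNIV. (x $ j * fst w $ j) ^ b j * moment_ratio (\<kappa> $ j) (b j) / fact (b j)) / (2 ^ i * pochhammer (alpha \<kappa> + 1/2) i)))"
    unfolding bessel_part_def intertwined_power_def sum_divide_distrib sum_distrib_left ..
  also have "\<dots> = (\<Sum>l\<le>i. \<Sum>b\<in>multi_index UNIV l. bessel_coeff x t i l b * cone_monomial b (i - l + e) w)"
  proof (intro sum.cong refl)
    fix l b
    have "(\<Prod>j\<in>UNIV. (x $ j * fst w $ j) ^ b j * moment_ratio (\<kappa> $ j) (b j) / fact (b j))
      = (\<Prod>j\<in>UNIV. (x $ j) ^ b j * moment_ratio (\<kappa> $ j) (b j) / fact (b j)) * (\<Prod>j\<in>UNIV. (fst w $ j) ^ b j)"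
      unfolding prod.distrib[symmetric] by (intro prod.cong refl) (simp add: power_mult_distrib)
    then show "snd w ^ e * ((t * snd w) ^ (i - l) / fact (i - l) *
       (\<Prod>j\<in>UNIV. (x $ j * fst w $ j) ^ b j * moment_ratio (\<kappa> $ j) (b j) / fact (b j)) / (2 ^ i * pochhammer (alpha \<kappa> + 1/2) i))
       = bessel_coeff x t i l b * cone_monomial b (i - l + e) w"
      by (simp add: bessel_coeff_def cone_monomial_def power_mult_distrib power_add)
  qed
  finally show ?thesis .
qed

text \<open>The exponent \<open>k\<close> of the monomial does not occur: powers of \<open>t\<close>
  only influence the radial symbol, which is split off here.\<close>

definition pair_seq :: "('d \<Rightarrow> nat) \<Rightarrow> real ^ 'd \<Rightarrow> real \<Rightarrow> nat \<Rightarrow> real" where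
  "pair_seq a x t i = (\<Sum>l\<le>i. t ^ (i - l) / fact (i - l) *
      (fps_nth (\<Prod>j\<in>UNIV. Abs_fps (paired_coeff (\<kappa> $ j) (x $ j) (a j))) l / pochhammer (alpha \<kappa> + 1) ((sum a UNIV + l) div 2)))
      / (2 ^ i * pochhammer (alpha \<kappa> + 1/2) i)"

text \<open>Since \<open>B_i\<close> is homogeneous of degree \<open>i\<close> in \<open>w\<close>,
  all its terms produce the same radial symbol, which factors out. The angular moments factor over
  the coordinates up to a denominator depending on \<open>l\<close> alone, so the sum over
  multi-indices of degree \<open>l\<close> is a coefficient of a product of power series.\<close>

lemma bessel_part_pairing:
  "has_cone_mean (\<lambda>w. cone_monomial a k w * (snd w ^ e * bessel_part \<kappa> (\<lambda>j. x $ j * fst w $ j) (t * snd w) i))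
     (pochhammer (2 * alpha \<kappa> + 1) (i + (sum a UNIV + k) + e) * pair_seq a x t i)"
proof -
  have 1: "has_cone_mean (\<lambda>w. cone_monomial a k w * (snd w ^ e * bessel_part \<kappa> (\<lambda>j. x $ j * fst w $ j) (t * snd w) i))
     (\<Sum>l\<le>i. \<Sum>b\<in>multi_index UNIV l. bessel_coeff x t i l b * cone_moment_value \<kappa> (\<lambda>j. a j + b j) (k + (i - l + e)))"
    unfolding bessel_part_expand sum_distrib_left mult.left_commute[of "cone_monomial a k _"] cone_monomial_mult
    by (intro has_cone_mean_sum has_cone_mean_cmult has_cone_mean_monomial)
  have "(\<Sum>l\<le>i. \<Sum>b\<in>multi_index UNIV l. bessel_coeff x t i l b * cone_moment_value \<kappa> (\<lambda>j. a j + b j) (k + (i - l + e)))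
     = (\<Sum>l\<le>i. pochhammer (2 * alpha \<kappa> + 1) (i + (sum a UNIV + k) + e) * (t ^ (i - l) / fact (i - l) *
      (fps_nth (\<Prod>j\<in>UNIV. Abs_fps (paired_coeff (\<kappa> $ j) (x $ j) (a j))) l / pochhammer (alpha \<kappa> + 1) ((sum a UNIV + l) div 2))
        / (2 ^ i * pochhammer (alpha \<kappa> + 1/2) i)))"
    unfolding fps_prod_nth_multi_index[OF finite] sum_divide_distrib sum_distrib_left
  proof (intro sum.cong refl)
    fix l b assume l: "l \<in> {..i}" and b: "b \<in> multi_index (UNIV :: 'd set) l"
    have sb: "(\<Sum>j\<in>UNIV. a j + b j) = sum a UNIV + l" using b by (simp add: multi_index_def sum.distrib)
    have deg: "sum a UNIV + l + (k + (i - l + e)) = i + (sum a UNIV + k) + e" using l by auto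
    have "(\<Prod>j\<in>UNIV. fps_nth (Abs_fps (paired_coeff (\<kappa> $ j) (x $ j) (a j))) (b j)) =
      (\<Prod>j\<in>UNIV. (x $ j) ^ b j * moment_ratio (\<kappa> $ j) (b j) / fact (b j)) *
      (if \<forall>j. even (a j + b j) then \<Prod>j\<in>UNIV. pochhammer (\<kappa> $ j + 1/2) ((a j + b j) div 2) else 0)"
      unfolding fps_nth_Abs_fps paired_coeff_def prod.distrib by (auto intro!: prod_zero)
    then show "bessel_coeff x t i l b * cone_moment_value \<kappa> (\<lambda>j. a j + b j) (k + (i - l + e)) =
      pochhammer (2 * alpha \<kappa> + 1) (i + (sum a UNIV + k) + e) * (t ^ (i - l) / fact (i - l) *
      ((\<Prod>j\<in>UNIV. fps_nth (Abs_fps (paired_coeff (\<kappa> $ j) (x $ j) (a j))) (b j)) / pochhammer (alpha \<kappa> + 1) ((sum a UNIV + l) div 2))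
        / (2 ^ i * pochhammer (alpha \<kappa> + 1/2) i))"
      by (auto simp: bessel_coeff_def cone_moment_value_def[OF card \<kappa>] sb deg mult_ac)
  qed
  also have "\<dots> = pochhammer (2 * alpha \<kappa> + 1) (i + (sum a UNIV + k) + e) * pair_seq a x t i"
    unfolding pair_seq_def sum_distrib_left sum_divide_distrib ..
  finally show ?thesis using 1 by simp
qed

definition pair_T :: "('d \<Rightarrow> nat) \<Rightarrow> nat \<Rightarrow> real ^ 'd \<Rightarrow> real \<Rightarrow> nat \<Rightarrow> real" where
  "pair_T a k x t h = (\<Sum>i\<le>h. pochhammer (2 * alpha \<kappa> + 1) (i + (sum a UNIV + k)) * pair_seq a x t i * ((- t) ^ (h - i) / fact (h - i)))"

text \<open>On the cone the squares of the coordinates add up to \<open>t^2\<close>, so the product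
  of the coordinate series has the form \<open>U\<close> and \<open>T_closed\<close>
  applies.\<close>

lemma pair_T_value:
  assumes xt: "(x, t) \<in> conic_surface" and h: "h \<ge> sum a UNIV + k"
  shows "pair_T a k x t h = (if h = sum a UNIV + k then cone_monomial a k (x, t) else 0)"
proof -
  define P E where "P = (\<Sum>j\<in>UNIV. a j div 2)" and "E = (\<Sum>j\<in>UNIV. a j mod 2)"
  define q where "q j = moment_poly (\<kappa> $ j + 1/2 + real (a j mod 2)) (a j div 2) ((x $ j)\<^sup>2 / 4)" for j
  define R where "R = (\<Prod>j\<in>UNIV. q j)"
  define C where "C = (\<Prod>j\<in>UNIV. (x $ j) ^ (a j mod 2) / 2 ^ (a j mod 2))"
  have sa: "sum a UNIV = 2 * P + E"
    unfolding P_def E_def sum_distrib_left sum.distrib[symmetric] by simp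
  have R: "degree R \<le> P" "coeff R P = (\<Prod>j\<in>UNIV. ((x $ j)\<^sup>2 / 4) ^ (a j div 2))"
    using degree_coeff_prod_top[of UNIV q "\<lambda>j. a j div 2"]
    by (auto simp: R_def P_def q_def degree_moment_poly coeff_moment_poly)
  have tx: "t\<^sup>2 = (\<Sum>j\<in>UNIV. (x $ j)\<^sup>2)"
  proof -
    have "t\<^sup>2 = x \<bullet> x" using xt by (simp add: conic_surface_def flip: power2_norm_eq_inner)
    then show ?thesis by (simp add: inner_vec_def power2_eq_square)
  qed
  interpret moment_recursion "alpha \<kappa>" t C P E k "sum a UNIV + k" R
    by unfold_locales (use alpha_nonneg[OF card \<kappa>] R sa in auto)
  have "(\<Prod>j\<in>UNIV. Abs_fps (paired_coeff (\<kappa> $ j) (x $ j) (a j))) = U"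
  proof -
    have 1: "(\<Prod>j\<in>A. fps_const (c j)) = fps_const (\<Prod>j\<in>A. c j)" for c :: "'d \<Rightarrow> real" and A
      by (induction A rule: infinite_finite_induct) auto
    have 2: "(\<Prod>j\<in>A. fps_exp (c j)) = fps_exp (\<Sum>j\<in>A. c j)" for c :: "'d \<Rightarrow> real" and A
      by (induction A rule: infinite_finite_induct) (auto simp: fps_exp_add_mult)
    have 3: "(\<Prod>j\<in>A. fps_of_poly (q j)) = fps_of_poly (\<Prod>j\<in>A. q j)" for A
      by (induction A rule: infinite_finite_induct) (auto simp: fps_of_poly_mult)
    have t4: "t\<^sup>2 / 4 = (\<Sum>j\<in>UNIV. (x $ j)\<^sup>2 / 4)" by (simp add: tx sum_divide_distrib)
    have V: "V = (\<Prod>j\<in>UNIV. fps_of_poly (q j) * fps_exp ((x $ j)\<^sup>2 / 4))"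
      unfolding V_def unfolding R_def prod.distrib 2 3 t4 ..
    have cp: "V oo fps_X ^ 2 = (\<Prod>j\<in>UNIV. (fps_of_poly (q j) * fps_exp ((x $ j)\<^sup>2 / 4)) oo fps_X ^ 2)"
      unfolding V by (rule fps_compose_prod_distrib) simp
    have "U = (\<Prod>j\<in>UNIV. fps_const ((x $ j) ^ (a j mod 2) / 2 ^ (a j mod 2)) * fps_X ^ (a j mod 2) *
      ((fps_of_poly (q j) * fps_exp ((x $ j)\<^sup>2 / 4)) oo fps_X ^ 2))"
      unfolding U_def cp unfolding prod.distrib 1 C_def E_def power_sum ..
    then show ?thesis unfolding q_def by (simp add: paired_coeff_fps[OF \<kappa>])
  qed
  then have "pair_seq a x t i = N i" for i
    by (simp add: pair_seq_def N_def sa)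
  then have "pair_T a k x t h = T h"
    by (simp add: pair_T_def T_def M_def)
  \<comment> \<open>The powers of 4 and 2 undo the scalings of \<open>(x $ j)\<^sup>2\<close> by 4
    in \<open>R\<close> and of the odd factors by 2 in \<open>C\<close>.\<close>
  moreover have "4 ^ P * 2 ^ E * C * coeff R P * t ^ k = cone_monomial a k (x, t)"
  proof -
    have "4 ^ P * 2 ^ E * C * coeff R P = (\<Prod>j\<in>UNIV. 4 ^ (a j div 2) * 2 ^ (a j mod 2) *
       ((x $ j) ^ (a j mod 2) / 2 ^ (a j mod 2)) * ((x $ j)\<^sup>2 / 4) ^ (a j div 2))"
      unfolding R(2) C_def unfolding P_def E_def power_sum prod.distrib ..
    also have "\<dots> = (\<Prod>j\<in>UNIV. (x $ j) ^ a j)"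
    proof (intro prod.cong refl)
      fix j
      have "(x $ j) ^ a j = (x $ j) ^ (a j mod 2) * ((x $ j)\<^sup>2) ^ (a j div 2)"
        by (simp flip: power_mult power_add)
      then show "4 ^ (a j div 2) * 2 ^ (a j mod 2) * ((x $ j) ^ (a j mod 2) / 2 ^ (a j mod 2)) *
        ((x $ j)\<^sup>2 / 4) ^ (a j div 2) = (x $ j) ^ a j" by (simp add: power_divide)
    qed
    finally show ?thesis by (simp add: cone_monomial_def)
  qed
  ultimately show ?thesis using T_closed[OF h] by simp
qed

definition kernel_sum :: "nat \<Rightarrow> (real ^ 'd) \<times> real \<Rightarrow> (real ^ 'd) \<times> real \<Rightarrow> real" where
  "kernel_sum n z w = (\<Sum>i\<le>n. bessel_part \<kappa> (\<lambda>j. fst z $ j * fst w $ j) (snd z * snd w) i *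
      laguerre_coeff (2 * alpha \<kappa> + 1 + 2 * real i) (snd z + snd w) (n - i))"

lemma kernel_sum_commute: "kernel_sum n z w = kernel_sum n w z"
  by (simp add: kernel_sum_def mult.commute add.commute)

lemma kernel_sum_expand:
  "kernel_sum n (x, t) w = (\<Sum>i\<le>n. \<Sum>m\<le>n - i. \<Sum>p\<le>m. ((- t) ^ p / fact p * ((-1) ^ (m - p) / fact (m - p))
           * (pochhammer (2 * alpha \<kappa> + 1 + 2 * real i + real m) (n - i - m) / fact (n - i - m))) *
        (snd w ^ (m - p) * bessel_part \<kappa> (\<lambda>j. x $ j * fst w $ j) (t * snd w) i))"
proof -
  have *: "(- (t + s)) ^ m / fact m = (\<Sum>p\<le>m. (- t) ^ p / fact p * ((-1) ^ (m - p) / fact (m - p)) * s ^ (m - p))" for s m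
  proof -
    have "(- (t + s)) ^ m = (- t + (- s)) ^ m" by simp
    then have "(- (t + s)) ^ m / fact m = (\<Sum>p\<le>m. real (m choose p) * (- t) ^ p * (- s) ^ (m - p) / fact m)"
      by (simp only: binomial_ring sum_divide_distrib)
    also have "\<dots> = (\<Sum>p\<le>m. (- t) ^ p / fact p * ((-1) ^ (m - p) / fact (m - p)) * s ^ (m - p))"
      by (intro sum.cong refl) (simp add: binomial_fact power_minus[of s])
    finally show ?thesis .
  qed
  show ?thesis
    unfolding kernel_sum_def laguerre_coeff_def * sum_distrib_left sum_distrib_right fst_conv snd_conv
    by (intro sum.cong refl) (simp only: mult_ac)
qed

lemma kernel_sum_pairing:
  "has_cone_mean (\<lambda>w. cone_monomial a k w * kernel_sum n (x, t) w)
     (\<Sum>h\<le>n. pair_T a k x t h * (pochhammer (real h - real (sum a UNIV + k)) (n - h) / fact (n - h)))"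
proof -
  have "has_cone_mean (\<lambda>w. cone_monomial a k w * kernel_sum n (x, t) w)
    (\<Sum>i\<le>n. \<Sum>m\<le>n - i. \<Sum>p\<le>m. (-t) ^ p / fact p * ((-1) ^ (m - p) / fact (m - p))
           * (pochhammer (2 * alpha \<kappa> + 1 + 2 * real i + real m) (n - i - m) / fact (n - i - m))
           * (pochhammer (2 * alpha \<kappa> + 1) (i + (sum a UNIV + k) + (m - p)) * pair_seq a x t i))"
    unfolding kernel_sum_expand sum_distrib_left
    by (intro has_cone_mean_sum has_cone_mean_cmult' bessel_part_pairing)
  then show ?thesis
    using alpha_nonneg[OF card \<kappa>] by (subst (asm) laguerre_pairing_sum) (auto simp: pair_T_def)
qed

definition pair_value :: "('d \<Rightarrow> nat) \<Rightarrow> nat \<Rightarrow> (real ^ 'd) \<times> real \<Rightarrow> nat \<Rightarrow> real" where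
  "pair_value a k z n = (\<Sum>h\<le>n. pair_T a k (fst z) (snd z) h * (pochhammer (real h - real (sum a UNIV + k)) (n - h) / fact (n - h)))"

lemma kernel_sum_monomial_mean:
  "has_cone_mean (\<lambda>w. cone_monomial a k w * kernel_sum n z w) (pair_value a k z n)"
  using kernel_sum_pairing[of a k n "fst z" "snd z"] by (simp add: pair_value_def)

lemma pair_value_sum:
  assumes z: "z \<in> conic_surface"
  shows "n > sum a UNIV + k \<Longrightarrow> pair_value a k z n = 0" "(\<Sum>n\<le>sum a UNIV + k. pair_value a k z n) = cone_monomial a k z"
proof -
  have T: "pair_T a k (fst z) (snd z) h = 0" if "h > sum a UNIV + k" for h
    using pair_T_value[of "fst z" "snd z" a k h] that z by simp
  show "n > sum a UNIV + k \<Longrightarrow> pair_value a k z n = 0"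
    unfolding pair_value_def by (rule graded_pairing(1)[OF T])
  show "(\<Sum>n\<le>sum a UNIV + k. pair_value a k z n) = cone_monomial a k z"
  proof -
    have "(\<Sum>n\<le>sum a UNIV + k. pair_value a k z n) = pair_T a k (fst z) (snd z) (sum a UNIV + k)"
      unfolding pair_value_def by (rule graded_pairing(2)[OF T])
    then show ?thesis using pair_T_value[of "fst z" "snd z" a k "sum a UNIV + k"] z by simp
  qed
qed

section \<open>Polynomial functions and identification of the reproducing kernels\<close>

lemma poly_fun_le_iff:
  "p \<in> poly_fun_le n \<longleftrightarrow> (\<exists>c. p = (\<lambda>z. \<Sum>(a, k)\<in>exponents n. c a k * cone_monomial a k z))"
  by (auto simp: poly_fun_le_def cone_monomial_def fun_eq_iff mult.assoc)

lemma poly_fun_le_monomial: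
  assumes "sum a UNIV + k \<le> n"
  shows "cone_monomial a k \<in> poly_fun_le n"
  unfolding poly_fun_le_iff
proof (intro exI ext)
  fix z
  have "(\<Sum>(b, l)\<in>exponents n. (if b = a \<and> l = k then 1 else 0) * cone_monomial b l z)
     = (\<Sum>y\<in>exponents n. if y = (a, k) then cone_monomial a k z else 0)"
    by (intro sum.cong) (auto split: if_splits)
  also have "\<dots> = cone_monomial a k z"
    using assms by (simp add: finite_exponents) (simp add: exponents_def)
  finally show "cone_monomial a k z = (\<Sum>(b, l)\<in>exponents n. (if b = a \<and> l = k then 1 else 0) * cone_monomial b l z)" ..
qed

lemma poly_fun_le_cmult: "p \<in> poly_fun_le n \<Longrightarrow> (\<lambda>z. c * p z) \<in> poly_fun_le n"
proof -
  assume "p \<in> poly_fun_le n"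
  then obtain d where d: "p = (\<lambda>z. \<Sum>(a, k)\<in>exponents n. d a k * cone_monomial a k z)"
    unfolding poly_fun_le_iff by auto
  show ?thesis unfolding poly_fun_le_iff
    by (intro exI[of _ "\<lambda>a k. c * d a k"]) (simp add: d sum_distrib_left split_beta mult.assoc)
qed

lemma poly_fun_le_sum:
  assumes "finite I" "\<And>i. i \<in> I \<Longrightarrow> p i \<in> poly_fun_le n"
  shows "(\<lambda>z. \<Sum>i\<in>I. p i z) \<in> poly_fun_le n"
proof -
  have "\<forall>i\<in>I. \<exists>c. p i = (\<lambda>z. \<Sum>(a, k)\<in>exponents n. c a k * cone_monomial a k z)"
    using assms(2) unfolding poly_fun_le_iff by auto
  from bchoice[OF this] obtain c where c: "\<And>i. i \<in> I \<Longrightarrow> p i = (\<lambda>z. \<Sum>(a, k)\<in>exponents n. c i a k * cone_monomial a k z)"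
    by blast
  have eq: "(\<Sum>i\<in>I. p i z) = (\<Sum>(a, k)\<in>exponents n. (\<Sum>i\<in>I. c i a k) * cone_monomial a k z)" for z
  proof -
    have "(\<Sum>i\<in>I. p i z) = (\<Sum>i\<in>I. \<Sum>(a, k)\<in>exponents n. c i a k * cone_monomial a k z)"
      by (intro sum.cong refl) (simp add: c)
    also have "\<dots> = (\<Sum>y\<in>exponents n. \<Sum>i\<in>I. c i (fst y) (snd y) * cone_monomial (fst y) (snd y) z)"
      unfolding split_beta by (rule sum.swap)
    also have "\<dots> = (\<Sum>(a, k)\<in>exponents n. (\<Sum>i\<in>I. c i a k) * cone_monomial a k z)"
      unfolding split_beta sum_distrib_right ..
    finally show ?thesis .
  qed
  show ?thesis unfolding poly_fun_le_iff by (rule exI[of _ "\<lambda>a k. \<Sum>i\<in>I. c i a k"], rule ext, rule eq)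
qed

lemma sum_multi_index: "b \<in> multi_index A n \<Longrightarrow> sum b A = n"
  by (simp add: multi_index_def)

lemma kernel_sum_poly: "kernel_sum n z \<in> poly_fun_le n"
proof -
  obtain x t where xt: "z = (x, t)" by force
  have "kernel_sum n z = (\<lambda>w. kernel_sum n (x, t) w)" by (simp add: xt)
  also have "\<dots> \<in> poly_fun_le n"
    unfolding kernel_sum_expand bessel_part_expand
    by (intro poly_fun_le_sum poly_fun_le_cmult poly_fun_le_monomial)
       (auto simp: finite_multi_index dest!: sum_multi_index)
  finally show ?thesis .
qed

text \<open>Linear in \<open>p\<close>, hence reduced to monomials. For a monomial of degree below
  \<open>m\<close>, extending the sum from its own degree to \<open>m\<close> only adds
  zeros.\<close>

lemma kernel_sum_reproduces:
  assumes z: "z \<in> conic_surface" and p: "p \<in> poly_fun_le m"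
  obtains v where "\<And>n. has_cone_mean (\<lambda>w. p w * kernel_sum n z w) (v n)"
    "\<And>n. n > m \<Longrightarrow> v n = 0" "(\<Sum>n\<le>m. v n) = p z"
proof -
  obtain c where c: "p = (\<lambda>z. \<Sum>(a, k)\<in>exponents m. c a k * cone_monomial a k z)"
    using p unfolding poly_fun_le_iff by auto
  note v = kernel_sum_monomial_mean[of _ _ _ z] pair_value_sum[OF z]
  show thesis
  proof (rule that[of "\<lambda>n. \<Sum>(a, k)\<in>exponents m. c a k * pair_value a k z n"])
    fix n
    have "has_cone_mean (\<lambda>w. \<Sum>y\<in>exponents m. c (fst y) (snd y) * (cone_monomial (fst y) (snd y) w * kernel_sum n z w))
      (\<Sum>y\<in>exponents m. c (fst y) (snd y) * pair_value (fst y) (snd y) z n)"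
      by (intro has_cone_mean_sum has_cone_mean_cmult v)
    then show "has_cone_mean (\<lambda>w. p w * kernel_sum n z w) (\<Sum>(a, k)\<in>exponents m. c a k * pair_value a k z n)"
      by (simp add: c sum_distrib_right split_beta mult.assoc)
    show "(\<Sum>(a, k)\<in>exponents m. c a k * pair_value a k z n) = 0" if "n > m"
    proof (rule sum.neutral, safe)
      fix a :: "'d \<Rightarrow> nat" and k assume "(a, k) \<in> exponents m"
      then have "n > sum a UNIV + k" using that by (simp add: exponents_def)
      then show "c a k * pair_value a k z n = 0" by (simp add: v(2))
    qed
  next
    have "(\<Sum>n\<le>m. \<Sum>(a, k)\<in>exponents m. c a k * pair_value a k z n) = (\<Sum>(a, k)\<in>exponents m. c a k * (\<Sum>n\<le>m. pair_value a k z n))"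
      unfolding split_beta sum_distrib_left by (rule sum.swap)
    also have "\<dots> = p z"
      unfolding c
    proof (intro sum.cong refl, safe)
      fix a :: "'d \<Rightarrow> nat" and k assume "(a, k) \<in> exponents m"
      then have "sum a UNIV + k \<le> m" by (simp add: exponents_def)
      then have "(\<Sum>n\<le>m. pair_value a k z n) = (\<Sum>n\<le>sum a UNIV + k. pair_value a k z n)"
        by (intro sum.mono_neutral_right) (auto intro: v(2))
      then show "c a k * (\<Sum>n\<le>m. pair_value a k z n) = c a k * cone_monomial a k z" by (simp add: v(3))
    qed
    finally show "(\<Sum>n\<le>m. \<Sum>(a, k)\<in>exponents m. c a k * pair_value a k z n) = p z" .
  qed
qed

definition cone_restrict :: "((real ^ 'd) \<times> real \<Rightarrow> real) \<Rightarrow> (real ^ 'd) \<times> real \<Rightarrow> real" where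
  "cone_restrict p = (\<lambda>z. if z \<in> conic_surface then p z else 0)"

lemma conic_surface_borel: "conic_surface \<in> sets (borel :: ((real ^ 'd) \<times> real) measure)"
proof -
  have "conic_surface = {z :: (real ^ 'd) \<times> real. 0 \<le> snd z} \<inter> {z. norm (fst z) = snd z}"
    by (auto simp: conic_surface_def)
  also have "closed \<dots>" by (intro closed_Int closed_Collect_le closed_Collect_eq continuous_intros)
  finally show ?thesis by (rule borel_closed)
qed

lemma sets_conic_measure: "sets (conic_measure :: ((real ^ 'd) \<times> real) measure) = sets borel"
  by (simp add: conic_measure_def)

lemma AE_conic_measure: "AE z in (conic_measure :: ((real ^ 'd) \<times> real) measure). z \<in> conic_surface"
proof -
  interpret S: finite_measure "sphere_measure :: (real ^ 'd) measure" by (rule finite_measure_sphere_measure)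
  interpret pair_sigma_finite "radial_measure CARD('d)" "sphere_measure :: (real ^ 'd) measure"
    unfolding pair_sigma_finite_def using sigma_finite_radial_measure S.sigma_finite_measure_axioms by auto
  have [measurable]: "(\<lambda>(t, \<xi>). (t *\<^sub>R \<xi>, t)) \<in> borel \<Otimes>\<^sub>M borel \<rightarrow>\<^sub>M (borel :: ((real ^ 'd) \<times> real) measure)"
    unfolding borel_prod by (intro borel_measurable_continuous_onI)
      (auto simp: case_prod_unfold intro!: continuous_intros)
  have "AE t in radial_measure CARD('d). t \<ge> 0"
    unfolding radial_measure_def by (subst AE_density) (auto simp: indicator_def)
  then have "AE z in radial_measure CARD('d) \<Otimes>\<^sub>M (sphere_measure :: (real ^ 'd) measure). fst z \<ge> 0 \<and> norm (snd z) = 1"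
  proof (intro AE_pair_measure)
    show "{z \<in> space (radial_measure CARD('d) \<Otimes>\<^sub>M (sphere_measure :: (real ^ 'd) measure)). fst z \<ge> 0 \<and> norm (snd z) = 1}
      \<in> sets (radial_measure CARD('d) \<Otimes>\<^sub>M sphere_measure)" by measurable
    assume "AE t in radial_measure CARD('d). t \<ge> 0"
    then show "AE t in radial_measure CARD('d). AE x in (sphere_measure :: (real ^ 'd) measure). fst (t, x) \<ge> 0 \<and> norm (snd (t, x)) = 1"
    proof eventually_elim
      case (elim t)
      then show ?case using AE_sphere_measure by simp
    qed
  qed
  then have "AE z in radial_measure CARD('d) \<Otimes>\<^sub>M (sphere_measure :: (real ^ 'd) measure).
      (\<lambda>(t, \<xi>). (t *\<^sub>R \<xi>, t)) z \<in> conic_surface"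
    by eventually_elim (auto simp: conic_surface_def)
  then show ?thesis
    unfolding conic_measure_def radial_measure_def[symmetric]
    by (subst AE_distr_iff) (use conic_surface_borel in \<open>auto simp: Collect_mem_eq\<close>)
qed

text \<open>The measure is concentrated on the surface, so extension by zero does not affect the
  integrals.\<close>

lemma cone_inner_restrict:
  assumes "has_cone_mean (\<lambda>w. p w * q w) v"
  shows "cone_inner \<kappa> (cone_restrict p) (cone_restrict q) = v"
proof -
  have hb: "has_bochner_integral conic_measure (\<lambda>z. p z * q z * cone_weight \<kappa> z) (cone_mass \<kappa> * v)"
    using assms by (simp add: has_cone_mean_def)
  have eq: "(\<lambda>z. cone_restrict p z * cone_restrict q z * cone_weight \<kappa> z) =
      (\<lambda>z. indicator conic_surface z *\<^sub>R (p z * q z * cone_weight \<kappa> z))"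
    by (auto simp: cone_restrict_def fun_eq_iff)
  have "(LINT z|conic_measure. cone_restrict p z * cone_restrict q z * cone_weight \<kappa> z)
     = (LINT z|conic_measure. p z * q z * cone_weight \<kappa> z)"
    unfolding eq
  proof (rule integral_cong_AE)
    show "(\<lambda>z. p z * q z * cone_weight \<kappa> z) \<in> borel_measurable conic_measure"
      using hb by (auto simp: has_bochner_integral_iff)
    then show "(\<lambda>z. indicator conic_surface z *\<^sub>R (p z * q z * cone_weight \<kappa> z)) \<in> borel_measurable conic_measure"
      using conic_surface_borel by (intro borel_measurable_scaleR borel_measurable_indicator) (auto simp: sets_conic_measure)
    show "AE z in conic_measure. indicator conic_surface z *\<^sub>R (p z * q z * cone_weight \<kappa> z) = p z * q z * cone_weight \<kappa> z"
      using AE_conic_measure by eventually_elim auto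
  qed
  then show ?thesis
    using hb cone_mass_pos[OF card \<kappa>]
    by (simp add: cone_inner_def cone_const_eq[OF card \<kappa>] has_bochner_integral_iff)
qed

lemma cone_inner_commute: "cone_inner \<kappa> f g = cone_inner \<kappa> g f"
  by (simp add: cone_inner_def mult.commute)

lemma cone_poly_le_eq: "cone_poly_le n = cone_restrict ` poly_fun_le n"
  unfolding cone_poly_le_def cone_restrict_def ..

theorem cone_kernel_eq:
  assumes z: "z \<in> conic_surface" and w: "w \<in> conic_surface"
  shows "cone_kernel \<kappa> n z w = kernel_sum n z w"
proof -
  define K where "K y = cone_restrict (kernel_sum n y)" for y
  have KV: "K y \<in> orth_poly_space \<kappa> n" if y: "y \<in> conic_surface" for y
  proof -
    have "cone_inner \<kappa> (K y) g = 0" if m: "m < n" and g: "g \<in> cone_poly_le m" for m g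
    proof -
      obtain p where p: "g = cone_restrict p" "p \<in> poly_fun_le m" using g unfolding cone_poly_le_eq by (rule imageE)
      obtain v where v: "\<And>n. has_cone_mean (\<lambda>w. p w * kernel_sum n y w) (v n)" "\<And>n. n > m \<Longrightarrow> v n = 0"
        "(\<Sum>n\<le>m. v n) = p y"
        by (rule kernel_sum_reproduces[OF y p(2)]) blast
      show ?thesis
        using cone_inner_restrict[OF v(1)] v(2)[OF m] by (simp add: K_def p(1) cone_inner_commute[of "cone_restrict p"])
    qed
    moreover have "K y \<in> cone_poly_le n"
      unfolding K_def cone_poly_le_eq by (rule imageI[OF kernel_sum_poly])
    ultimately show ?thesis unfolding orth_poly_space_def by simp
  qed
  \<comment> \<open>The pairings of \<open>f\<close> with the kernels of degree up to
    \<open>n\<close> add up to \<open>f y\<close>. Those of degree below \<open>n\<close> vanish by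
    orthogonality, so the one of degree \<open>n\<close> carries the whole value.\<close>
  have rep: "cone_inner \<kappa> f (K y) = f y" if f: "f \<in> orth_poly_space \<kappa> n" and y: "y \<in> conic_surface" for f y
  proof -
    from f have "f \<in> cone_restrict ` poly_fun_le n"
      by (simp add: orth_poly_space_def cone_poly_le_eq)
    then obtain p where p: "f = cone_restrict p" "p \<in> poly_fun_le n" by (rule imageE)
    obtain v where v: "\<And>n. has_cone_mean (\<lambda>w. p w * kernel_sum n y w) (v n)"
      "\<And>m. m > n \<Longrightarrow> v m = 0" "(\<Sum>m\<le>n. v m) = p y"
      by (rule kernel_sum_reproduces[OF y p(2)]) blast
    have "v m = 0" if "m < n" for m
    proof -
      have "cone_restrict (kernel_sum m y) \<in> cone_poly_le m"
        unfolding cone_poly_le_eq by (rule imageI[OF kernel_sum_poly])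
      then have "cone_inner \<kappa> f (cone_restrict (kernel_sum m y)) = 0"
        using f that by (simp add: orth_poly_space_def)
      then show ?thesis using cone_inner_restrict[OF v(1)] by (simp add: p(1))
    qed
    then have "(\<Sum>m\<le>n. v m) = (\<Sum>m\<in>{n}. v m)" by (intro sum.mono_neutral_right) auto
    then have "v n = p y" using v(3) by simp
    then show ?thesis using cone_inner_restrict[OF v(1), of n] y by (simp add: K_def p(1)) (simp add: cone_restrict_def)
  qed
  have "cone_kernel \<kappa> n z = K z"
    unfolding cone_kernel_def reproducing_kernel_def
  proof (rule the_equality)
    show "K z \<in> orth_poly_space \<kappa> n \<and> (\<forall>f\<in>orth_poly_space \<kappa> n. cone_inner \<kappa> f (K z) = f z)"
      using KV rep z by auto
    txt \<open>The symmetry of \<open>K\<close> gives \<open>k(y) = \<langle>k, K\<^sub>y\<rangle> = K\<^sub>y(z)\<close>, so positivity of the inner product is not needed.\<close>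
    fix k assume k: "k \<in> orth_poly_space \<kappa> n \<and> (\<forall>f\<in>orth_poly_space \<kappa> n. cone_inner \<kappa> f k = f z)"
    show "k = K z"
    proof
      fix y
      show "k y = K z y"
      proof (cases "y \<in> conic_surface")
        case True
        have "k y = cone_inner \<kappa> (K y) k" using rep[of k y] k True by (simp add: cone_inner_commute)
        also have "\<dots> = K y z" using k KV[OF True] by auto
        also have "\<dots> = K z y" using z True by (simp add: K_def cone_restrict_def kernel_sum_commute)
        finally show ?thesis .
      next
        case False
        from k have "k \<in> cone_restrict ` poly_fun_le n"
          by (simp add: orth_poly_space_def cone_poly_le_eq)
        then obtain p where "k = cone_restrict p" by (rule imageE)
        then show ?thesis using False by (simp add: K_def cone_restrict_def)
      qed
    qed
  qed
  then show ?thesis using w by (simp add: K_def cone_restrict_def)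
qed

end

subsection \<open>The integral representation\<close>

definition coordinate_measure :: "real \<Rightarrow> real measure" where
  "coordinate_measure k = (if k = 0 then return lborel 1 else lebesgue_pm1)"

definition coordinate_weight :: "real \<Rightarrow> real \<Rightarrow> real" where
  "coordinate_weight k u = (if k = 0 then 1 else (1 + u) * (1 - u\<^sup>2) powr (k - 1))"

definition coordinate_const :: "real \<Rightarrow> real" where
  "coordinate_const k = (if k = 0 then 1 else c_const (k - 1/2))"

lemma sets_lebesgue_pm1 [measurable_cong, simp]: "sets lebesgue_pm1 = sets borel"
  by (simp add: lebesgue_pm1_def)

lemma sets_coordinate_measure [measurable_cong, simp]: "sets (coordinate_measure k) = sets borel"
  by (simp add: coordinate_measure_def)

lemma finite_measure_lebesgue_pm1: "finite_measure lebesgue_pm1"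
  by (rule finite_measureI) (simp add: lebesgue_pm1_def emeasure_density)

lemma sigma_finite_coordinate_measure: "sigma_finite_measure (coordinate_measure k)"
proof (cases "k = 0")
  case True
  interpret prob_space "return lborel (1::real)" by (rule prob_space_return) simp
  show ?thesis unfolding coordinate_measure_def if_P[OF True] by unfold_locales
next
  case False
  interpret finite_measure lebesgue_pm1 by (rule finite_measure_lebesgue_pm1)
  show ?thesis unfolding coordinate_measure_def if_not_P[OF False] by unfold_locales
qed

lemma coordinate_weight_measurable [measurable]: "coordinate_weight k \<in> borel_measurable borel"
  unfolding coordinate_weight_def by measurable

lemma has_bochner_integral_lebesgue_pm1:
  fixes f :: "real \<Rightarrow> real"
  assumes "has_bochner_integral lborel (\<lambda>v. indicator {-1..1} v * f v) w"
    and [measurable]: "f \<in> borel_measurable borel"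
  shows "has_bochner_integral lebesgue_pm1 f w"
proof -
  have "has_bochner_integral (density lborel (\<lambda>v. ennreal (indicator {-1..1} v))) f w"
    by (rule has_bochner_integral_density) (use assms in auto)
  then show ?thesis by (simp add: lebesgue_pm1_def ennreal_indicator)
qed

lemma c_const_pos: "k > 0 \<Longrightarrow> c_const (k - 1/2) > 0"
  unfolding c_const_def by (intro divide_pos_pos mult_pos_pos Gamma_real_pos) auto

lemma coordinate_const_pos: "k \<ge> 0 \<Longrightarrow> coordinate_const k > 0"
  using c_const_pos[of k] by (simp add: coordinate_const_def)

text \<open>\<open>c_const (k - 1/2)\<close> is the reciprocal of \<open>Beta (1/2) k\<close>, so
  these are the normalized even moments of the symmetric weight.\<close>

lemma c_const_Beta:
  assumes "k > 0"
  shows "c_const (k - 1/2) * Beta (real q + 1/2) k = pochhammer (1/2) q / pochhammer (k + 1/2) q"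
proof -
  have 1: "Gamma (1/2 + real q) = pochhammer (1/2) q * Gamma (1/2 :: real)" by (rule Gamma_add_nat) auto
  have 2: "Gamma (k + 1/2 + real q) = pochhammer (k + 1/2) q * Gamma (k + 1/2)"
    using assms by (intro Gamma_add_nat) auto
  define g :: real where "g = Gamma (1/2)"
  have "g > 0" "Gamma k > 0" "Gamma (k + 1/2) > 0" "pochhammer (k + 1/2) q > 0"
    using assms by (auto simp: g_def intro!: Gamma_real_pos pochhammer_pos)
  moreover have "c_const (k - 1/2) = Gamma (k + 1/2) / (g * Gamma k)"
  proof -
    have "k - 1/2 + 1 = k + 1/2" "k - 1/2 + 1/2 = k" by simp_all
    then show ?thesis by (simp only: c_const_def g_def)
  qed
  moreover have "Beta (real q + 1/2) k = pochhammer (1/2) q * g * Gamma k / (pochhammer (k + 1/2) q * Gamma (k + 1/2))"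
    unfolding Beta_def g_def 1[symmetric] 2[symmetric] by (simp add: add_ac)
  ultimately show ?thesis by simp
qed

text \<open>The factor \<open>1 + u\<close> splits the integral into two moments of the symmetric
  weight, exactly one of which has an even exponent. For \<open>k = 0\<close> the point mass at 1
  has all moments 1, in agreement with \<open>moment_ratio\<close>.\<close>

lemma coordinate_moment:
  assumes k: "k \<ge> 0"
  shows "has_bochner_integral (coordinate_measure k) (\<lambda>u. u ^ n * coordinate_weight k u) (moment_ratio k n / coordinate_const k)"
proof (cases "k = 0")
  case True
  have "moment_ratio 0 n = 1"
    using pochhammer_pos[of "1/2::real" "(n + 1) div 2"] by (simp add: moment_ratio_def)
  moreover have "has_bochner_integral (return lborel 1) (\<lambda>u::real. u ^ n) 1"
  proof (rule has_bochner_integral_nn_integral)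
    show "AE u in return lborel 1. 0 \<le> (u::real) ^ n" by (subst AE_return) auto
    show "(\<integral>\<^sup>+u. ennreal (u ^ n) \<partial>return lborel 1) = ennreal 1" by (subst nn_integral_return) auto
  qed auto
  ultimately show ?thesis
    using True by (simp add: coordinate_measure_def coordinate_weight_def coordinate_const_def)
next
  case False
  then have k: "k > 0" using k by simp
  define q where "q = (n + 1) div 2"
  have "has_bochner_integral lborel (\<lambda>v. indicator {-1..1} v * (v ^ n * (1 - v\<^sup>2) powr (k - 1)) +
       indicator {-1..1} v * (v ^ Suc n * (1 - v\<^sup>2) powr (k - 1)))
     ((if even n then Beta ((real n + 1) / 2) k else 0) + (if even (Suc n) then Beta ((real (Suc n) + 1) / 2) k else 0))"
    by (intro has_bochner_integral_add beta_moment k)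
  also have "(\<lambda>v. indicator {-1..1} v * (v ^ n * (1 - v\<^sup>2) powr (k - 1)) +
       indicator {-1..1} v * (v ^ Suc n * (1 - v\<^sup>2) powr (k - 1)))
     = (\<lambda>v::real. indicator {-1..1} v * (v ^ n * coordinate_weight k v))"
    using False by (auto simp: coordinate_weight_def fun_eq_iff algebra_simps)
  also have "(if even n then Beta ((real n + 1) / 2) k else 0) + (if even (Suc n) then Beta ((real (Suc n) + 1) / 2) k else 0)
     = Beta (real q + 1/2) k"
    by (auto simp: q_def elim!: evenE oddE) (simp_all add: field_simps)
  also have "Beta (real q + 1/2) k = moment_ratio k n / coordinate_const k"
  proof -
    have "moment_ratio k n = c_const (k - 1/2) * Beta (real q + 1/2) k"
      using c_const_Beta[OF k, of q] by (simp add: moment_ratio_def q_def)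
    then show ?thesis using c_const_pos[OF k] False by (simp add: coordinate_const_def)
  qed
  finally show ?thesis
    using False by (simp add: coordinate_measure_def has_bochner_integral_lebesgue_pm1)
qed

lemma du_measure_eq: "du_measure \<kappa> = (\<Pi>\<^sub>M i\<in>UNIV. coordinate_measure (\<kappa> $ i))"
  by (simp add: du_measure_def coordinate_measure_def)

lemma Phi_eq: "Phi \<kappa> u = (\<Prod>i\<in>UNIV. coordinate_weight (\<kappa> $ i) (u i))"
  by (simp add: Phi_def coordinate_weight_def)

lemma c_kappa_eq: "c_kappa \<kappa> = (\<Prod>i\<in>UNIV. coordinate_const (\<kappa> $ i))"
  by (simp add: c_kappa_def coordinate_const_def)

lemma component_measurable_du [measurable]:
  "(\<lambda>u. u i) \<in> borel_measurable (du_measure \<kappa>)"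
proof -
  have "(\<lambda>u. u i) \<in> du_measure \<kappa> \<rightarrow>\<^sub>M coordinate_measure (\<kappa> $ i)"
    unfolding du_measure_eq by (rule measurable_component_singleton) simp
  then show ?thesis by (simp only: measurable_cong_sets[OF refl sets_coordinate_measure])
qed

lemma Phi_measurable [measurable]: "Phi \<kappa> \<in> borel_measurable (du_measure \<kappa>)"
  unfolding Phi_eq by measurable

text \<open>The underlying space consists of all functions; the cube is only a set of full measure
  in it, so bounds on \<open>rho\<close> hold almost everywhere.\<close>

lemma AE_du_measure: "AE u in du_measure \<kappa>. \<forall>i. \<bar>u i\<bar> \<le> 1" for \<kappa> :: "real ^ 'd"
proof -
  interpret product_sigma_finite "\<lambda>i :: 'd. coordinate_measure (\<kappa> $ i)"
    by (simp add: product_sigma_finite_def sigma_finite_coordinate_measure)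
  have "AE u in du_measure \<kappa>. \<bar>u i\<bar> \<le> 1" for i
  proof (rule AE_I)
    let ?A = "\<lambda>j. if j = i then - {-1..1} else (UNIV :: real set)"
    show "{u \<in> space (du_measure \<kappa>). \<not> \<bar>u i\<bar> \<le> 1} \<subseteq> Pi\<^sub>E UNIV ?A"
      by (auto simp: PiE_def)
    have "emeasure (coordinate_measure (\<kappa> $ i)) (- {-1..1}) = 0"
    proof (cases "\<kappa> $ i = 0")
      case False
      have "(\<integral>\<^sup>+x. indicator {-1..1} x * indicator (- {-1..1}) x \<partial>(lborel :: real measure)) = (\<integral>\<^sup>+x. 0 \<partial>(lborel :: real measure))"
        by (intro nn_integral_cong) (auto simp: indicator_def)
      then show ?thesis using False by (simp add: coordinate_measure_def lebesgue_pm1_def emeasure_density)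
    qed (simp add: coordinate_measure_def)
    then have "(\<Prod>j\<in>UNIV. emeasure (coordinate_measure (\<kappa> $ j)) (?A j)) = 0"
      by (intro prod_zero) (auto intro!: bexI[of _ i])
    then show "emeasure (du_measure \<kappa>) (Pi\<^sub>E UNIV ?A) = 0"
      unfolding du_measure_eq by (subst emeasure_PiM) auto
    show "Pi\<^sub>E UNIV ?A \<in> sets (du_measure \<kappa>)"
      unfolding du_measure_eq by (intro sets_PiM_I_finite) auto
  qed
  then show ?thesis by (subst AE_all_countable) auto
qed

section \<open>Moments of the product measure and termwise integration of the exponential\<close>

context
  fixes \<kappa> :: "real ^ 'd"
  assumes \<kappa>: "\<And>i. 0 \<le> \<kappa> $ i"
begin

lemma c_kappa_pos: "c_kappa \<kappa> > 0"
  unfolding c_kappa_eq by (intro prod_pos ballI coordinate_const_pos \<kappa>)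

lemma sigma_finite_du_measure: "sigma_finite_measure (du_measure \<kappa>)"
proof -
  interpret product_sigma_finite "\<lambda>i :: 'd. coordinate_measure (\<kappa> $ i)"
    by (simp add: product_sigma_finite_def sigma_finite_coordinate_measure)
  show ?thesis unfolding du_measure_eq by (rule sigma_finite) simp
qed

lemma du_moment:
  "has_bochner_integral (du_measure \<kappa>) (\<lambda>u. (\<Prod>i\<in>UNIV. u i ^ b i) * Phi \<kappa> u)
     ((\<Prod>i\<in>UNIV. moment_ratio (\<kappa> $ i) (b i)) / c_kappa \<kappa>)"
proof -
  interpret product_sigma_finite "\<lambda>i :: 'd. coordinate_measure (\<kappa> $ i)"
    by (simp add: product_sigma_finite_def sigma_finite_coordinate_measure)
  have m: "integrable (coordinate_measure (\<kappa> $ i)) (\<lambda>u. u ^ b i * coordinate_weight (\<kappa> $ i) u)"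
    "(\<integral>u. u ^ b i * coordinate_weight (\<kappa> $ i) u \<partial>coordinate_measure (\<kappa> $ i)) = moment_ratio (\<kappa> $ i) (b i) / coordinate_const (\<kappa> $ i)" for i
    using coordinate_moment[OF \<kappa>] by (auto simp: has_bochner_integral_iff)
  have "has_bochner_integral (du_measure \<kappa>) (\<lambda>u. \<Prod>i\<in>UNIV. u i ^ b i * coordinate_weight (\<kappa> $ i) (u i))
     (\<Prod>i\<in>UNIV. moment_ratio (\<kappa> $ i) (b i) / coordinate_const (\<kappa> $ i))"
    unfolding du_measure_eq has_bochner_integral_iff
    using product_integrable_prod[of UNIV "\<lambda>i u. u ^ b i * coordinate_weight (\<kappa> $ i) u"]
      product_integral_prod[of UNIV "\<lambda>i u. u ^ b i * coordinate_weight (\<kappa> $ i) u"] m by simp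
  then show ?thesis by (simp add: prod.distrib Phi_eq c_kappa_eq prod_dividef)
qed

text \<open>After multinomial expansion, integration replaces every monomial in \<open>u\<close> by
  its moments, which is how \<open>intertwined_power\<close> is formed.\<close>

lemma du_power_moment:
  "has_bochner_integral (du_measure \<kappa>) (\<lambda>u. (c + (\<Sum>i\<in>UNIV. z i * u i)) ^ k * Phi \<kappa> u)
     (fact k * intertwined_power \<kappa> z c k / c_kappa \<kappa>)"
proof -
  have e: "(c + (\<Sum>i\<in>UNIV. z i * u i)) ^ k * Phi \<kappa> u = (\<Sum>l\<le>k. \<Sum>b\<in>multi_index UNIV l.
      (fact k * (c ^ (k - l) / fact (k - l)) * (\<Prod>i\<in>UNIV. z i ^ b i / fact (b i))) * ((\<Prod>i\<in>UNIV. u i ^ b i) * Phi \<kappa> u))" for u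
  proof -
    have "(c + (\<Sum>i\<in>UNIV. z i * u i)) ^ k = fact k * (\<Sum>l\<le>k. c ^ (k - l) / fact (k - l) *
      (\<Sum>b\<in>multi_index UNIV l. \<Prod>i\<in>UNIV. (z i * u i) ^ b i / fact (b i)))"
      unfolding power_add_sum_multi_index[symmetric] by simp
    then have "(c + (\<Sum>i\<in>UNIV. z i * u i)) ^ k * Phi \<kappa> u = (\<Sum>l\<le>k. \<Sum>b\<in>multi_index UNIV l.
       fact k * (c ^ (k - l) / fact (k - l) * (\<Prod>i\<in>UNIV. (z i * u i) ^ b i / fact (b i))) * Phi \<kappa> u)"
      by (simp only: sum_distrib_left sum_distrib_right)
    also have "\<dots> = (\<Sum>l\<le>k. \<Sum>b\<in>multi_index UNIV l.
      (fact k * (c ^ (k - l) / fact (k - l)) * (\<Prod>i\<in>UNIV. z i ^ b i / fact (b i))) * ((\<Prod>i\<in>UNIV. u i ^ b i) * Phi \<kappa> u))"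
    proof (intro sum.cong refl)
      fix l b
      have "(\<Prod>i\<in>UNIV. (z i * u i) ^ b i / fact (b i)) = (\<Prod>i\<in>UNIV. z i ^ b i / fact (b i)) * (\<Prod>i\<in>UNIV. u i ^ b i)"
        unfolding prod.distrib[symmetric] by (intro prod.cong refl) (simp add: power_mult_distrib)
      then show "fact k * (c ^ (k - l) / fact (k - l) * (\<Prod>i\<in>UNIV. (z i * u i) ^ b i / fact (b i))) * Phi \<kappa> u =
        (fact k * (c ^ (k - l) / fact (k - l)) * (\<Prod>i\<in>UNIV. z i ^ b i / fact (b i))) * ((\<Prod>i\<in>UNIV. u i ^ b i) * Phi \<kappa> u)"
        by (simp only: mult.assoc)
    qed
    finally show ?thesis .
  qed
  have "has_bochner_integral (du_measure \<kappa>) (\<lambda>u. (c + (\<Sum>i\<in>UNIV. z i * u i)) ^ k * Phi \<kappa> u)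
     (\<Sum>l\<le>k. \<Sum>b\<in>multi_index UNIV l. (fact k * (c ^ (k - l) / fact (k - l)) * (\<Prod>i\<in>UNIV. z i ^ b i / fact (b i))) *
        ((\<Prod>i\<in>UNIV. moment_ratio (\<kappa> $ i) (b i)) / c_kappa \<kappa>))"
    unfolding e by (intro has_bochner_integral_sum has_bochner_integral_mult_right du_moment)
  also have "(\<Sum>l\<le>k. \<Sum>b\<in>multi_index UNIV l. (fact k * (c ^ (k - l) / fact (k - l)) * (\<Prod>i\<in>UNIV. z i ^ b i / fact (b i))) *
        ((\<Prod>i\<in>UNIV. moment_ratio (\<kappa> $ i) (b i)) / c_kappa \<kappa>)) = fact k * intertwined_power \<kappa> z c k / c_kappa \<kappa>"
    unfolding intertwined_power_def sum_distrib_left sum_divide_distrib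
  proof (intro sum.cong refl)
    fix l b
    have "(\<Prod>i\<in>UNIV. z i ^ b i * moment_ratio (\<kappa> $ i) (b i) / fact (b i))
      = (\<Prod>i\<in>UNIV. z i ^ b i / fact (b i)) * (\<Prod>i\<in>UNIV. moment_ratio (\<kappa> $ i) (b i))"
      unfolding prod.distrib[symmetric] by (intro prod.cong refl) simp
    then show "(fact k * (c ^ (k - l) / fact (k - l)) * (\<Prod>i\<in>UNIV. z i ^ b i / fact (b i))) *
        ((\<Prod>i\<in>UNIV. moment_ratio (\<kappa> $ i) (b i)) / c_kappa \<kappa>)
      = fact k * (c ^ (k - l) / fact (k - l) * (\<Prod>i\<in>UNIV. z i ^ b i * moment_ratio (\<kappa> $ i) (b i) / fact (b i))) / c_kappa \<kappa>"
      by simp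
  qed
  finally show ?thesis .
qed

text \<open>Multiplying the coordinates of \<open>y\<close> by the \<open>u i\<close> does not
  increase its norm, so Cauchy-Schwarz bounds the sum by \<open>t * s\<close>. This makes the
  radicand nonnegative and \<open>rho\<close> bounded.\<close>

lemma rho_bounds:
  fixes x y :: "real ^ 'd"
  assumes xt: "(x, t) \<in> conic_surface" and ys: "(y, s) \<in> conic_surface" and u: "\<And>i. \<bar>u i\<bar> \<le> 1"
  shows "0 \<le> t * s + (\<Sum>i\<in>UNIV. x $ i * y $ i * u i)" "\<bar>rho (x, t) (y, s) u\<bar> \<le> sqrt (t * s)"
proof -
  define w where "w = (\<chi> i. y $ i * u i)"
  have "norm w \<le> norm y"
    by (rule norm_le_componentwise_cart) (use u in \<open>simp add: w_def abs_mult mult_left_le\<close>)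
  then have "norm x * norm w \<le> t * s"
    using xt ys by (auto simp: conic_surface_def intro!: mult_mono)
  moreover have "x \<bullet> w = (\<Sum>i\<in>UNIV. x $ i * y $ i * u i)"
    by (simp add: inner_vec_def w_def mult.assoc)
  ultimately have b: "\<bar>\<Sum>i\<in>UNIV. x $ i * y $ i * u i\<bar> \<le> t * s"
    using Cauchy_Schwarz_ineq2[of x w] by linarith
  then show 0: "0 \<le> t * s + (\<Sum>i\<in>UNIV. x $ i * y $ i * u i)" by linarith
  have "rho (x, t) (y, s) u \<le> sqrt (t * s)"
  proof -
    have "1/2 * (t * s + (\<Sum>i\<in>UNIV. x $ i * y $ i * u i)) \<le> 1/2 * (2 * (t * s))"
      using b by (intro mult_left_mono) linarith+
    then have "1/2 * (t * s + (\<Sum>i\<in>UNIV. x $ i * y $ i * u i)) \<le> t * s" by simp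
    then show ?thesis unfolding rho_def prod.case by (rule real_sqrt_le_mono)
  qed
  moreover have "rho (x, t) (y, s) u \<ge> 0" unfolding rho_def using 0 by simp
  ultimately show "\<bar>rho (x, t) (y, s) u\<bar> \<le> sqrt (t * s)" by simp
qed

lemma rho_measurable [measurable]: "rho z w \<in> borel_measurable (du_measure \<kappa>)"
  unfolding rho_def split_beta by measurable

text \<open>The exponential series is integrated term by term; boundedness of \<open>rho\<close> and
  \<open>v\<close> makes the norms of the terms summable. Odd powers of \<open>v\<close> integrate
  to 0, and the even powers of \<open>rho\<close> are polynomials in \<open>u\<close>.\<close>

lemma exp_integral_sums:
  fixes x y :: "real ^ 'd"
  assumes xt: "(x, t) \<in> conic_surface" and ys: "(y, s) \<in> conic_surface" and a: "a > 0"
  shows "(\<lambda>k. c ^ (2 * k) / fact (2 * k) * ((1/2) ^ k * (fact k * intertwined_power \<kappa> (\<lambda>i. x $ i * y $ i) (t * s) k / c_kappa \<kappa>))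
        * Beta (real k + 1/2) a)
     sums (\<integral>(u, v). exp (c * v * rho (x, t) (y, s) u) * Phi \<kappa> u * (1 - v\<^sup>2) powr (a - 1) \<partial>(du_measure \<kappa> \<Otimes>\<^sub>M lebesgue_pm1))"
proof -
  interpret L: finite_measure lebesgue_pm1 by (rule finite_measure_lebesgue_pm1)
  define R where "R = rho (x, t) (y, s)"
  define w where "w v = (1 - v\<^sup>2) powr (a - 1)" for v :: real
  define C where "C = sqrt (t * s)"
  have [measurable]: "R \<in> borel_measurable (du_measure \<kappa>)" unfolding R_def by measurable
  have [measurable]: "w \<in> borel_measurable borel" unfolding w_def by measurable
  have RC: "AE u in du_measure \<kappa>. \<bar>R u\<bar> \<le> C"
    using AE_du_measure by eventually_elim (use rho_bounds(2)[OF xt ys] in \<open>auto simp: R_def C_def\<close>)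
  have V: "has_bochner_integral lebesgue_pm1 (\<lambda>v. v ^ n * w v) (if even n then Beta ((real n + 1) / 2) a else 0)" for n
    unfolding w_def by (rule has_bochner_integral_lebesgue_pm1[OF beta_moment[OF a]]) measurable
  have AEv: "AE v in lebesgue_pm1. \<bar>v\<bar> \<le> 1"
    unfolding lebesgue_pm1_def by (subst AE_density) (auto simp: indicator_def)
  have Phi: "integrable (du_measure \<kappa>) (Phi \<kappa>)"
    using du_moment[of "\<lambda>_. 0"] by (simp add: has_bochner_integral_iff)
  have W: "integrable lebesgue_pm1 w" using V[of 0] by (simp add: has_bochner_integral_iff)
  have Rb: "AE u in du_measure \<kappa>. norm (R u ^ n * Phi \<kappa> u) \<le> norm (C ^ n * Phi \<kappa> u)" for n
    using RC by eventually_elim (auto simp: abs_mult power_abs intro!: mult_right_mono power_mono)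
  have RI: "integrable (du_measure \<kappa>) (\<lambda>u. R u ^ n * Phi \<kappa> u)" for n
    by (rule Bochner_Integration.integrable_bound[OF _ _ Rb]) (use Phi in auto)
  have VI: "integrable lebesgue_pm1 (\<lambda>v. v ^ n * w v)" for n
    using V[of n] by (simp add: has_bochner_integral_iff)
  define f where "f n = (\<lambda>(u, v). c ^ n / fact n * ((R u ^ n * Phi \<kappa> u) * (v ^ n * w v)))" for n
  have fb: "has_bochner_integral (du_measure \<kappa> \<Otimes>\<^sub>M lebesgue_pm1) (f n)
     (c ^ n / fact n * ((\<integral>u. R u ^ n * Phi \<kappa> u \<partial>du_measure \<kappa>) * (if even n then Beta ((real n + 1) / 2) a else 0)))" for n
  proof -
    have "has_bochner_integral (du_measure \<kappa> \<Otimes>\<^sub>M lebesgue_pm1) (\<lambda>(u, v). (R u ^ n * Phi \<kappa> u) * (v ^ n * w v))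
      ((\<integral>u. R u ^ n * Phi \<kappa> u \<partial>du_measure \<kappa>) * (if even n then Beta ((real n + 1) / 2) a else 0))"
      by (intro has_bochner_integral_pair_mult sigma_finite_du_measure L.sigma_finite_measure_axioms V)
         (use RI in \<open>simp add: has_bochner_integral_iff\<close>)
    from has_bochner_integral_mult_right[OF this, of "c ^ n / fact n", unfolded split_beta]
    show ?thesis unfolding f_def split_beta .
  qed
  have nf: "(\<integral>z. norm (f n z) \<partial>(du_measure \<kappa> \<Otimes>\<^sub>M lebesgue_pm1)) \<le>
      (\<bar>c\<bar> * C) ^ n / fact n * ((\<integral>u. \<bar>Phi \<kappa> u\<bar> \<partial>du_measure \<kappa>) * (\<integral>v. \<bar>w v\<bar> \<partial>lebesgue_pm1))" for n
  proof -
    have "has_bochner_integral (du_measure \<kappa> \<Otimes>\<^sub>M lebesgue_pm1) (\<lambda>(u, v). \<bar>R u ^ n * Phi \<kappa> u\<bar> * \<bar>v ^ n * w v\<bar>)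
      ((\<integral>u. \<bar>R u ^ n * Phi \<kappa> u\<bar> \<partial>du_measure \<kappa>) * (\<integral>v. \<bar>v ^ n * w v\<bar> \<partial>lebesgue_pm1))"
      by (intro has_bochner_integral_pair_mult sigma_finite_du_measure L.sigma_finite_measure_axioms)
         (use RI VI in \<open>simp_all add: has_bochner_integral_iff\<close>)
    from has_bochner_integral_mult_right[OF this, of "\<bar>c\<bar> ^ n / fact n"]
    have "(\<integral>z. norm (f n z) \<partial>(du_measure \<kappa> \<Otimes>\<^sub>M lebesgue_pm1)) =
      \<bar>c\<bar> ^ n / fact n * ((\<integral>u. \<bar>R u ^ n * Phi \<kappa> u\<bar> \<partial>du_measure \<kappa>) * (\<integral>v. \<bar>v ^ n * w v\<bar> \<partial>lebesgue_pm1))"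
      by (simp add: f_def split_beta abs_mult power_abs has_bochner_integral_iff)
    also have "\<dots> \<le> \<bar>c\<bar> ^ n / fact n * ((\<integral>u. C ^ n * \<bar>Phi \<kappa> u\<bar> \<partial>du_measure \<kappa>) * (\<integral>v. \<bar>w v\<bar> \<partial>lebesgue_pm1))"
    proof (intro mult_left_mono mult_mono)
      show "(\<integral>u. \<bar>R u ^ n * Phi \<kappa> u\<bar> \<partial>du_measure \<kappa>) \<le> (\<integral>u. C ^ n * \<bar>Phi \<kappa> u\<bar> \<partial>du_measure \<kappa>)"
      proof (rule integral_mono_AE)
        show "AE u in du_measure \<kappa>. \<bar>R u ^ n * Phi \<kappa> u\<bar> \<le> C ^ n * \<bar>Phi \<kappa> u\<bar>"
          using RC by eventually_elim (auto simp: abs_mult power_abs intro!: mult_right_mono power_mono)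
      qed (use RI Phi in auto)
      show "(\<integral>v. \<bar>v ^ n * w v\<bar> \<partial>lebesgue_pm1) \<le> (\<integral>v. \<bar>w v\<bar> \<partial>lebesgue_pm1)"
      proof (rule integral_mono_AE)
        show "AE v in lebesgue_pm1. \<bar>v ^ n * w v\<bar> \<le> \<bar>w v\<bar>"
          using AEv by eventually_elim (auto simp: abs_mult power_abs intro!: mult_left_le_one_le power_le_one)
      qed (use VI W in auto)
      show "0 \<le> (\<integral>u. C ^ n * \<bar>Phi \<kappa> u\<bar> \<partial>du_measure \<kappa>)"
        using xt ys by (intro Bochner_Integration.integral_nonneg) (auto simp: C_def conic_surface_def)
    qed auto
    also have "\<dots> = (\<bar>c\<bar> * C) ^ n / fact n * ((\<integral>u. \<bar>Phi \<kappa> u\<bar> \<partial>du_measure \<kappa>) * (\<integral>v. \<bar>w v\<bar> \<partial>lebesgue_pm1))"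
      by (simp add: power_mult_distrib)
    finally show ?thesis .
  qed
  have ps: "f n (u, v) = (c * v * R u) ^ n / fact n * (Phi \<kappa> u * w v)" for n u v
    by (simp add: f_def power_mult_distrib)
  have ex: "(\<lambda>n. b ^ n / fact n) sums exp b" for b :: real
    using exp_converges[of b] by (simp add: divide_inverse mult.commute)
  have "(\<lambda>n. integral\<^sup>L (du_measure \<kappa> \<Otimes>\<^sub>M lebesgue_pm1) (f n)) sums
      (\<integral>z. (\<Sum>n. f n z) \<partial>(du_measure \<kappa> \<Otimes>\<^sub>M lebesgue_pm1))"
  proof (rule sums_integral)
    show "integrable (du_measure \<kappa> \<Otimes>\<^sub>M lebesgue_pm1) (f n)" for n
      using fb[of n] by (simp add: has_bochner_integral_iff)
    show "AE z in du_measure \<kappa> \<Otimes>\<^sub>M lebesgue_pm1. summable (\<lambda>n. norm (f n z))"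
    proof (rule AE_I2)
      fix z :: "('d \<Rightarrow> real) \<times> real"
      obtain u v where z: "z = (u, v)" by force
      have "summable (\<lambda>n. \<bar>c * v * R u\<bar> ^ n / fact n * \<bar>Phi \<kappa> u * w v\<bar>)"
        using ex[of "\<bar>c * v * R u\<bar>"] by (intro summable_mult2) (auto simp: sums_iff)
      then show "summable (\<lambda>n. norm (f n z))" by (simp add: z ps abs_mult power_abs)
    qed
    show "summable (\<lambda>n. \<integral>z. norm (f n z) \<partial>(du_measure \<kappa> \<Otimes>\<^sub>M lebesgue_pm1))"
    proof (rule summable_comparison_test'[where N = 0])
      show "summable (\<lambda>n. (\<bar>c\<bar> * C) ^ n / fact n * ((\<integral>u. \<bar>Phi \<kappa> u\<bar> \<partial>du_measure \<kappa>) * (\<integral>v. \<bar>w v\<bar> \<partial>lebesgue_pm1)))"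
        using ex[of "\<bar>c\<bar> * C"] by (intro summable_mult2) (auto simp: sums_iff)
      fix n show "norm (\<integral>z. norm (f n z) \<partial>(du_measure \<kappa> \<Otimes>\<^sub>M lebesgue_pm1)) \<le>
        (\<bar>c\<bar> * C) ^ n / fact n * ((\<integral>u. \<bar>Phi \<kappa> u\<bar> \<partial>du_measure \<kappa>) * (\<integral>v. \<bar>w v\<bar> \<partial>lebesgue_pm1))"
        using nf[of n] by simp
    qed
  qed
  also have "(\<lambda>z. (\<Sum>n. f n z)) = (\<lambda>(u, v). exp (c * v * R u) * Phi \<kappa> u * w v)"
  proof
    fix z :: "('d \<Rightarrow> real) \<times> real"
    obtain u v where z: "z = (u, v)" by force
    have "(\<lambda>n. (c * v * R u) ^ n / fact n * (Phi \<kappa> u * w v)) sums (exp (c * v * R u) * (Phi \<kappa> u * w v))"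
      by (intro sums_mult2 ex)
    then show "(\<Sum>n. f n z) = (\<lambda>(u, v). exp (c * v * R u) * Phi \<kappa> u * w v) z"
      by (simp add: z ps sums_iff mult.assoc)
  qed
  finally have S: "(\<lambda>n. integral\<^sup>L (du_measure \<kappa> \<Otimes>\<^sub>M lebesgue_pm1) (f n)) sums
    (\<integral>(u, v). exp (c * v * R u) * Phi \<kappa> u * w v \<partial>(du_measure \<kappa> \<Otimes>\<^sub>M lebesgue_pm1))" .
  have fv: "integral\<^sup>L (du_measure \<kappa> \<Otimes>\<^sub>M lebesgue_pm1) (f n) = c ^ n / fact n *
     ((\<integral>u. R u ^ n * Phi \<kappa> u \<partial>du_measure \<kappa>) * (if even n then Beta ((real n + 1) / 2) a else 0))" for n
    using fb[of n] by (simp add: has_bochner_integral_iff)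
  have "(\<lambda>k. integral\<^sup>L (du_measure \<kappa> \<Otimes>\<^sub>M lebesgue_pm1) (f (2 * k))) sums
    (\<integral>(u, v). exp (c * v * R u) * Phi \<kappa> u * w v \<partial>(du_measure \<kappa> \<Otimes>\<^sub>M lebesgue_pm1))"
    by (subst sums_mono_reindex[of "\<lambda>k. 2 * k"]) (use S in \<open>auto simp: fv strict_mono_def\<close>)
  moreover have "integral\<^sup>L (du_measure \<kappa> \<Otimes>\<^sub>M lebesgue_pm1) (f (2 * k)) = c ^ (2 * k) / fact (2 * k) *
     ((1/2) ^ k * (fact k * intertwined_power \<kappa> (\<lambda>i. x $ i * y $ i) (t * s) k / c_kappa \<kappa>)) * Beta (real k + 1/2) a" for k
  proof -
    have "(\<integral>u. R u ^ (2 * k) * Phi \<kappa> u \<partial>du_measure \<kappa>) =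
      (\<integral>u. (1/2) ^ k * ((t * s + (\<Sum>i\<in>UNIV. (x $ i * y $ i) * u i)) ^ k * Phi \<kappa> u) \<partial>du_measure \<kappa>)"
    proof (rule integral_cong_AE)
      show "AE u in du_measure \<kappa>. R u ^ (2 * k) * Phi \<kappa> u =
        (1/2) ^ k * ((t * s + (\<Sum>i\<in>UNIV. (x $ i * y $ i) * u i)) ^ k * Phi \<kappa> u)"
        using AE_du_measure
      proof eventually_elim
        case (elim u)
        have "(R u)\<^sup>2 = 1/2 * (t * s + (\<Sum>i\<in>UNIV. (x $ i * y $ i) * u i))"
          using rho_bounds(1)[OF xt ys, of u] elim by (simp add: R_def rho_def)
        then show ?case by (simp only: power_mult power_mult_distrib mult.assoc)
      qed
    qed measurable
    also have "\<dots> = (1/2) ^ k * (fact k * intertwined_power \<kappa> (\<lambda>i. x $ i * y $ i) (t * s) k / c_kappa \<kappa>)"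
      using du_power_moment[of "t * s" "\<lambda>i. x $ i * y $ i" k] by (simp add: has_bochner_integral_iff)
    finally show ?thesis by (simp add: fv add_divide_distrib)
  qed
  ultimately show ?thesis by (simp add: R_def w_def)
qed

end

theorem theorem3p6:
  fixes \<kappa> :: "real ^ 'd" and r t s :: real and x y :: "real ^ 'd"
  assumes "CARD('d) \<ge> 2"
    and "\<And>i. 0 \<le> \<kappa> $ i"
    and "0 \<le> r" and "r < 1"
    and "(x, t) \<in> conic_surface" and "(y, s) \<in> conic_surface"
  shows "summable (\<lambda>n. cone_kernel \<kappa> n (x, t) (y, s) * r ^ n)
    \<and> (alpha \<kappa> > 0 \<longrightarrow>
        poisson_kernel \<kappa> r (x, t) (y, s) =
          exp (- ((t + s) * r / (1 - r))) / (1 - r) powr (2 * alpha \<kappa> + 1)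
          * c_const (alpha \<kappa> - 1/2) * c_kappa \<kappa>
          * (\<integral>(u, v). exp (2 * sqrt r * v / (1 - r) * rho (x, t) (y, s) u)
                * Phi \<kappa> u * (1 - v\<^sup>2) powr (alpha \<kappa> - 1)
              \<partial>(du_measure \<kappa> \<Otimes>\<^sub>M lebesgue_pm1)))
    \<and> (alpha \<kappa> = 0 \<longleftrightarrow> \<kappa> = 0 \<and> CARD('d) = 2)
    \<and> (alpha \<kappa> = 0 \<longrightarrow>
        poisson_kernel 0 r (x, t) (y, s) =
          exp (- ((t + s) * r / (1 - r))) / (1 - r)
          * cosh (2 * sqrt r / (1 - r) * sqrt (1/2 * (t * s + x \<bullet> y))))"
proof -
  note card = assms(1) and \<kappa> = assms(2) and r = assms(3,4) and xt = assms(5) and ys = assms(6)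
  define q where "q = r / (1 - r)\<^sup>2"
  define z where "z i = x $ i * y $ i" for i
  have zf: "z = (\<lambda>i. x $ i * y $ i)" by (simp add: fun_eq_iff z_def)
  define B where "B = bessel_part \<kappa> z (t * s)"
  define c where "c = 2 * sqrt r / (1 - r)"
  have a0: "alpha \<kappa> \<ge> 0" by (rule alpha_nonneg[OF card \<kappa>])
  have cq: "c ^ (2 * k) = 4 ^ k * q ^ k" for k
  proof -
    have "c\<^sup>2 = 4 * q" using r by (simp add: c_def q_def power_divide power_mult_distrib)
    then show ?thesis by (simp only: power_mult power_mult_distrib)
  qed
  have kernel_term: "cone_kernel \<kappa> n (x, t) (y, s) * r ^ n =
      (\<Sum>i\<le>n. B i * laguerre_coeff (2 * alpha \<kappa> + 1 + 2 * real i) (t + s) (n - i)) * r ^ n" for n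
    unfolding cone_kernel_eq[OF card \<kappa> xt ys] by (simp add: kernel_sum_def[OF card \<kappa>] B_def zf)
  have sums: "(\<lambda>n. cone_kernel \<kappa> n (x, t) (y, s) * r ^ n) sums
     (exp (- ((t + s) * r / (1 - r))) / (1 - r) powr (2 * alpha \<kappa> + 1) * (\<Sum>i. B i * q ^ i))"
    unfolding kernel_term q_def
    by (rule laguerre_series_sums(1)[where D = "\<bar>t * s\<bar> + (\<Sum>i\<in>UNIV. \<bar>z i\<bar>)", OF r])
       (use a0 abs_bessel_part_le[OF \<kappa> a0] in \<open>auto simp: B_def intro!: add_nonneg_nonneg sum_nonneg\<close>)
  then have pk: "poisson_kernel \<kappa> r (x, t) (y, s) =
     exp (- ((t + s) * r / (1 - r))) / (1 - r) powr (2 * alpha \<kappa> + 1) * (\<Sum>i. B i * q ^ i)"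
    by (simp add: poisson_kernel_def sums_iff)
  have zero: "alpha \<kappa> = 0 \<longleftrightarrow> \<kappa> = 0 \<and> CARD('d) = 2"
  proof
    assume a: "alpha \<kappa> = 0"
    have "(\<Sum>i\<in>UNIV. \<kappa> $ i) \<ge> 0" using \<kappa> by (intro sum_nonneg) auto
    moreover have "(real CARD('d) - 2) / 2 \<ge> 0" using card by simp
    ultimately have *: "(\<Sum>i\<in>UNIV. \<kappa> $ i) = 0" "(real CARD('d) - 2) / 2 = 0"
      using a unfolding alpha_def by linarith+
    have "\<kappa> $ i = 0" for i
      using *(1) \<kappa> by (subst (asm) sum_nonneg_eq_0_iff) auto
    then show "\<kappa> = 0 \<and> CARD('d) = 2" using *(2) by (auto simp: vec_eq_iff)
  qed (auto simp: alpha_def)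
  have pos: "poisson_kernel \<kappa> r (x, t) (y, s) =
          exp (- ((t + s) * r / (1 - r))) / (1 - r) powr (2 * alpha \<kappa> + 1)
          * c_const (alpha \<kappa> - 1/2) * c_kappa \<kappa>
          * (\<integral>(u, v). exp (2 * sqrt r * v / (1 - r) * rho (x, t) (y, s) u)
                * Phi \<kappa> u * (1 - v\<^sup>2) powr (alpha \<kappa> - 1)
              \<partial>(du_measure \<kappa> \<Otimes>\<^sub>M lebesgue_pm1))" if a: "alpha \<kappa> > 0"
  proof -
    let ?I = "\<integral>(u, v). exp (c * v * rho (x, t) (y, s) u) * Phi \<kappa> u * (1 - v\<^sup>2) powr (alpha \<kappa> - 1)
              \<partial>(du_measure \<kappa> \<Otimes>\<^sub>M lebesgue_pm1)"
    have "(\<lambda>k. c_const (alpha \<kappa> - 1/2) * c_kappa \<kappa> * (c ^ (2 * k) / fact (2 * k) * ((1/2) ^ k *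
        (fact k * intertwined_power \<kappa> z (t * s) k / c_kappa \<kappa>)) * Beta (real k + 1/2) (alpha \<kappa>)))
      sums (c_const (alpha \<kappa> - 1/2) * c_kappa \<kappa> * ?I)"
      using exp_integral_sums[OF \<kappa> xt ys a, of c] unfolding z_def by (rule sums_mult)
    \<comment> \<open>The identities \<open>(2k)! = 4^k (1/2)_k k!\<close> and
      \<open>c^2 = 4 q\<close> reduce each term to the one in the series of the Poisson
      kernel.\<close>
    also have "(\<lambda>k. c_const (alpha \<kappa> - 1/2) * c_kappa \<kappa> * (c ^ (2 * k) / fact (2 * k) * ((1/2) ^ k *
        (fact k * intertwined_power \<kappa> z (t * s) k / c_kappa \<kappa>)) * Beta (real k + 1/2) (alpha \<kappa>)))
      = (\<lambda>k. B k * q ^ k)"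
    proof
      fix k
      have "pochhammer (1/2) k > (0::real)" by (intro pochhammer_pos) auto
      moreover have "(fact (2 * k) :: real) = 4 ^ k * pochhammer (1/2) k * fact k"
        using fact_double[of k, where 'a = real] by (simp add: power_mult)
      moreover have "c_const (alpha \<kappa> - 1/2) * c_kappa \<kappa> * (c ^ (2 * k) / fact (2 * k) * ((1/2) ^ k *
        (fact k * intertwined_power \<kappa> z (t * s) k / c_kappa \<kappa>)) * Beta (real k + 1/2) (alpha \<kappa>))
        = c ^ (2 * k) / fact (2 * k) * ((1/2) ^ k * (fact k * intertwined_power \<kappa> z (t * s) k)) *
          (c_const (alpha \<kappa> - 1/2) * Beta (real k + 1/2) (alpha \<kappa>))"
        using c_kappa_pos[OF \<kappa>] by simp
      ultimately show "c_const (alpha \<kappa> - 1/2) * c_kappa \<kappa> * (c ^ (2 * k) / fact (2 * k) * ((1/2) ^ k *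
        (fact k * intertwined_power \<kappa> z (t * s) k / c_kappa \<kappa>)) * Beta (real k + 1/2) (alpha \<kappa>)) = B k * q ^ k"
        unfolding c_const_Beta[OF a] cq by (simp add: B_def bessel_part_def power_divide)
    qed
    finally have "(\<Sum>k. B k * q ^ k) = c_const (alpha \<kappa> - 1/2) * c_kappa \<kappa> * ?I"
      by (rule sums_unique[symmetric])
    moreover have "2 * sqrt r * v / (1 - r) = c * v" for v by (simp add: c_def)
    ultimately show ?thesis unfolding pk by (simp only: mult.assoc)
  qed
  \<comment> \<open>For \<kappa> = 0 the intertwined powers are ordinary powers, and at \<alpha> = 0
    the denominator \<open>(1/2)_k\<close> completes \<open>k!\<close> to \<open>(2k)!\<close>, so
    the series is that of \<open>cosh\<close>.\<close>
  have cosh: "poisson_kernel 0 r (x, t) (y, s) =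
          exp (- ((t + s) * r / (1 - r))) / (1 - r)
          * cosh (2 * sqrt r / (1 - r) * sqrt (1/2 * (t * s + x \<bullet> y)))" if a: "alpha \<kappa> = 0"
  proof -
    have k0: "\<kappa> = 0" using zero a by blast
    define X where "X = c * sqrt (1/2 * (t * s + x \<bullet> y))"
    have xy: "x \<bullet> y = (\<Sum>i\<in>UNIV. z i)" by (simp add: inner_vec_def z_def)
    have nn: "t * s + x \<bullet> y \<ge> 0"
      using rho_bounds(1)[OF \<kappa> xt ys, of "\<lambda>_. 1"] by (simp add: xy z_def)
    have "(\<lambda>k. if even k then X ^ k / fact k else 0) sums cosh X"
      using cosh_converges[of X] by (simp add: if_distrib divide_inverse mult.commute cong: if_cong)
    then have "(\<lambda>k. (\<lambda>n. if even n then X ^ n / fact n else 0) (2 * k)) sums cosh X"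
      by (subst sums_mono_reindex) (auto simp: strict_mono_def)
    then have 1: "(\<lambda>k. X ^ (2 * k) / fact (2 * k)) sums cosh X" by simp
    have "X ^ (2 * k) / fact (2 * k) = B k * q ^ k" for k
    proof -
      have p: "pochhammer (1/2) k > (0::real)" by (intro pochhammer_pos) auto
      have f: "(fact (2 * k) :: real) = 4 ^ k * pochhammer (1/2) k * fact k"
        using fact_double[of k, where 'a = real] by (simp add: power_mult)
      have "sqrt (1/2 * (t * s + x \<bullet> y)) ^ (2 * k) = (1/2 * (t * s + x \<bullet> y)) ^ k"
        using nn by (simp add: power_mult)
      then have "X ^ (2 * k) = 4 ^ k * q ^ k * (1/2 * (t * s + x \<bullet> y)) ^ k"
        unfolding X_def power_mult_distrib cq by simp
      moreover have "B k = (t * s + x \<bullet> y) ^ k / fact k / (2 ^ k * pochhammer (1/2) k)"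
        unfolding B_def bessel_part_def k0 intertwined_power_zero xy using a by (simp add: k0)
      ultimately show ?thesis using p unfolding f by (simp add: power_mult_distrib power_divide mult_ac)
    qed
    then have "(\<Sum>k. B k * q ^ k) = cosh X" using 1 by (simp add: sums_iff)
    then show ?thesis
      using pk r unfolding a by (simp add: k0 X_def c_def)
  qed
  show ?thesis using sums pos zero cosh by (auto simp: sums_iff)
qed

end
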